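(* Let $l,m\in\mathbb N$ and let $E=\bigcup_{j=1}^{l}E_j$, $E_j=[a_{2j-1},a_{2j}]$, with $-\infty<a_1<a_2<\dots<a_{2l}<\infty$. Let $(n)$ be a strictly monotone increasing subsequence of $\mathbb N$, and for each $n$ in this subsequence let $I_n=\bigcup_{k=1}^{m}[B_{k,n},C_{k,n}]$ be a union of $m$ pairwise disjoint real intervals with $B_{k,n}<C_{k,n}$. Assume that there is a constant $\delta>0$ independent of $n$ with $\operatorname{dist}(E,I_n)\ge\delta$ for all $n$, and that $\bigcap_{n}[B_{k,n},C_{k,n}]=\{c_k\}$ for $k=1,\dots,m$. Put $\omega_{k,n}=\omega(\infty,[B_{k,n},C_{k,n}],E\cup I_n)$ and assume that $\omega_{k,n}\to0$ as $n\to\infty$ for $k=1,\dots,m$. Then, as $n\to\infty$ along the subsequence, the following hold. (a) $$\operatorname{cap}\Bigl(E\cup\bigcup_{k=1}^{m}[B_{k,n},C_{k,n}]\Bigr)=\operatorname{cap}(E)\,\prod_{k=1}^{m}|\phi(\infty,c_k,E)|^{\omega_{k,n}}\Bigl(1+O\bigl(\max_{k}\omega_{k,n}^2\bigr)\Bigr).$$ (b) For $j=1,\dots,l$, $$\omega\Bigl(\infty,E_j,E\cup\bigcup_{k=1}^{m}[B_{k,n},C_{k,n}]\Bigr)=\omega(\infty,E_j,E)-\sum_{k=1}^{m}\omega_{k,n}\,\omega(c_k,E_j,E)+O\bigl(\max_{k}\omega_{k,n}^2\bigr).$$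
   Context: For a finite union $K$ of disjoint compact real intervals, $\omega(z,A,K)$ denotes the harmonic measure, at the point $z\in\overline{\mathbb C}\setminus K$ and with respect to the domain $\overline{\mathbb C}\setminus K$, of the set $A\subset K$. For $z_0\in\overline{\mathbb C}\setminus K$, $\phi(z,z_0,K)$ is the complex Green's function: the (in general multi-valued) analytic function on $\overline{\mathbb C}\setminus K$ with a simple pole at $z_0$ such that $\log|\phi(z,z_0,K)|$ is the Green's function of $\overline{\mathbb C}\setminus K$ with pole at $z_0$. In particular $|\phi|$ is single-valued, and $|\phi(\infty,c_k,E)|=\exp g_E(\infty,c_k)$, where $g_E(\cdot,c_k)$ is the Green's function of $\overline{\mathbb C}\setminus E$ with pole at $c_k$. The (logarithmic) capacity is $\operatorname{cap}(K)=\lim_{z\to\infty}\left|\frac{z}{\phi(z,\infty,K)}\right|$. *)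

theory Defs
  imports "HOL-Complex_Analysis.Complex_Analysis" "HOL-Library.Landau_Symbols"
begin

datatype sphere = Fin complex | Infty

text \<open>
  Local coordinates on the Riemann sphere, given as parametrisations: \<open>1/w\<close> at infinity,
  the translate \<open>c + w\<close> at a finite point \<open>c\<close>.
\<close>

definition inf_chart :: "complex \<Rightarrow> sphere" where
  "inf_chart w = (if w = 0 then Infty else Fin (1 / w))"

definition chart_at :: "sphere \<Rightarrow> complex \<Rightarrow> sphere" where
  "chart_at p w = (case p of Fin c \<Rightarrow> Fin (c + w) | Infty \<Rightarrow> inf_chart w)"

text \<open>
  Twice continuously differentiable with vanishing Laplacian.
\<close>

definition harmonic_on :: "(complex \<Rightarrow> real) \<Rightarrow> complex set \<Rightarrow> bool" where
  "harmonic_on u U \<longleftrightarrow> open U \<and>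
     (\<exists>ux uy uxx uxy uyx uyy.
        (\<forall>z\<in>U. (u has_derivative (\<lambda>h. ux z * Re h + uy z * Im h)) (at z) \<and>
               (ux has_derivative (\<lambda>h. uxx z * Re h + uxy z * Im h)) (at z) \<and>
               (uy has_derivative (\<lambda>h. uyx z * Re h + uyy z * Im h)) (at z) \<and>
               uxx z + uyy z = 0) \<and>
        continuous_on U uxx \<and> continuous_on U uxy \<and> continuous_on U uyx \<and> continuous_on U uyy)"

text \<open>
  Perron's method may be run with continuous subharmonic functions, so the value \<open>-\<infinity>\<close>
  and upper semicontinuity are not needed.
\<close>

definition subharmonic_on :: "(complex \<Rightarrow> real) \<Rightarrow> complex set \<Rightarrow> bool" where
  "subharmonic_on v U \<longleftrightarrow> open U \<and> continuous_on U v \<and>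
     (\<forall>z\<in>U. \<exists>R>0. cball z R \<subseteq> U \<and>
        (\<forall>r\<in>{0<..R}. v z \<le> 1 / (2 * pi) * integral {0..2 * pi} (\<lambda>t. v (z + of_real r * cis t))))"

definition harmonic_on_sphere :: "(sphere \<Rightarrow> real) \<Rightarrow> sphere set \<Rightarrow> bool" where
  "harmonic_on_sphere u U \<longleftrightarrow>
     harmonic_on (u \<circ> Fin) (Fin -` U) \<and> harmonic_on (u \<circ> inf_chart) (inf_chart -` U)"

definition subharmonic_on_sphere :: "(sphere \<Rightarrow> real) \<Rightarrow> sphere set \<Rightarrow> bool" where
  "subharmonic_on_sphere v U \<longleftrightarrow>
     subharmonic_on (v \<circ> Fin) (Fin -` U) \<and> subharmonic_on (v \<circ> inf_chart) (inf_chart -` U)"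

definition sphere_compl :: "complex set \<Rightarrow> sphere set" where
  "sphere_compl K = - (Fin ` K)"

text \<open>
  \<open>harmonic_measure z A K\<close> is \<open>\<omega>(z, A, K)\<close> for compact \<open>K\<close>: the Perron solution of the Dirichlet
  problem on the complement of \<open>K\<close> in the sphere with the indicator of \<open>A\<close> as boundary function,
  evaluated at \<open>z\<close>.
\<close>

definition harmonic_measure :: "sphere \<Rightarrow> complex set \<Rightarrow> complex set \<Rightarrow> real" where
  "harmonic_measure z A K =
     Sup {v z | v. subharmonic_on_sphere v (sphere_compl K) \<and>
       (\<forall>\<zeta>\<in>K. Limsup (at \<zeta> within - K) (\<lambda>w. ereal (v (Fin w))) \<le> ereal (indicator A \<zeta>))}"

text \<open>
  The boundary condition is imposed at every point of \<open>K\<close>, which is appropriate when all of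
  them are regular, as for a finite union of nondegenerate intervals.
\<close>

definition is_green_function :: "complex set \<Rightarrow> sphere \<Rightarrow> (sphere \<Rightarrow> real) \<Rightarrow> bool" where
  "is_green_function K p g \<longleftrightarrow>
     harmonic_on_sphere g (sphere_compl K - {p}) \<and>
     (\<exists>r>0. \<exists>h. harmonic_on h (ball 0 r) \<and>
        (\<forall>w\<in>ball 0 r - {0}. g (chart_at p w) = h w - ln (norm w))) \<and>
     (\<forall>\<zeta>\<in>K. ((\<lambda>w. g (Fin w)) \<longlongrightarrow> 0) (at \<zeta> within - K))"

definition green :: "complex set \<Rightarrow> sphere \<Rightarrow> sphere \<Rightarrow> real" where
  "green K z p = (THE x. \<exists>g. is_green_function K p g \<and> g z = x)"

text \<open>
  The modulus \<open>|\<phi>(z, p, K)|\<close> of the complex Green's function. The function \<open>\<phi>\<close> itself is in general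
  multi-valued; its modulus is fixed by the requirement that \<open>log |\<phi>|\<close> be the Green's function.
\<close>

definition abs_complex_green :: "sphere \<Rightarrow> sphere \<Rightarrow> complex set \<Rightarrow> real" where
  "abs_complex_green z p K = exp (green K z p)"

definition capacity :: "complex set \<Rightarrow> real" where
  "capacity K = Lim at_infinity (\<lambda>z. norm z / abs_complex_green (Fin z) Infty K)"

end

theory Submission
  imports Defs
begin

text \<open>
  Every potential needed here is explicit. For a finite union of intervals \<open>[\<alpha>\<^sub>j, \<beta>\<^sub>j]\<close> put
  \<open>S(z)\<^sup>2 = \<Prod>\<^sub>j (z - \<alpha>\<^sub>j) (z - \<beta>\<^sub>j)\<close>. A differential \<open>p dz / S\<close> with \<open>p\<close> real is imaginary along the intervals, so the
  real part of its integral is single-valued and constant on each of them. Letting \<open>p\<close> range over polynomials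
  gives harmonic measures and the Green's function with pole at infinity: by the maximum principle the linear map from \<open>p\<close>
  to the boundary constants is injective, hence bijective. Finite poles give the functions \<open>Q c\<close> with boundary
  values \<open>ln |x - c|\<close>.

  Let \<open>u\<close> be the harmonic measure of \<open>E\<^sub>j\<close> or the Green's function of \<open>E\<close>. Its difference with the corresponding
  function of \<open>E \<union> I\<^sub>n\<close> has boundary values \<open>0\<close> on \<open>E\<close> and \<open>u\<close> on \<open>I\<^sub>n\<close>, so at infinity it is
  \<open>\<Sum>\<^sub>k \<omega>\<^sub>k u(c\<^sub>k)\<close> up to \<open>O(\<Sum>\<^sub>k \<omega>\<^sub>k)\<close> times the longest interval length, and that length is \<open>O(\<Sum>\<^sub>k \<omega>\<^sub>k)\<close>.

  Part (a) involves the Green's function with pole \<open>c\<close> at infinity rather than the one with pole infinity at \<open>c\<close>. Their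
  symmetry is obtained by regarding \<open>T c = Q c \<infinity>\<close> as a function of \<open>c\<close>: it has the mean value property
  because the Dirichlet problem is linear, and \<open>T + \<gamma> - G\<close> is nonnegative with mean \<open>0\<close> on large circles, so it vanishes.
\<close>

section \<open>Harmonic functions\<close>

text \<open>The square in the error term shapes the last part. The oscillation of \<open>u\<close>
  over a short interval has to be bounded by the harmonic measures, whereas the hypotheses give no
  rate at which the lengths shrink. The rate comes from a lower bound: a short interval around
  \<open>c\<close> of length \<open>len\<close> has harmonic measure at least a constant times
  \<open>len\<close>. The true order is \<open>1 / ln (1 / len)\<close>, but the linear bound
  suffices.

  The Dirichlet problem is solved only for data that are constant on each interval and for
  \<open>ln |x - c|\<close>. Solutions are therefore never integrated over \<open>c\<close>: the
  mean value property of \<open>T\<close> is obtained by comparing finite Riemann sums of boundary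
  data with a solution that is already known.

  The differentials have to be real on the real axis, so a pole \<open>c\<close> always occurs
  together with its conjugate.

  Harmonicity is expressed at a point, as being locally the real part of an analytic function. This
  is stable under the charts of the sphere, and the definition by second derivatives is reached only
  where the statement demands it.\<close>

definition harmonic_at :: "(complex \<Rightarrow> real) \<Rightarrow> complex \<Rightarrow> bool" where
  "harmonic_at u z \<longleftrightarrow> (\<exists>F. F analytic_on {z} \<and> (\<forall>\<^sub>F w in nhds z. u w = Re (F w)))"

lemma harmonic_atI:
  assumes "F analytic_on {z}" "\<forall>\<^sub>F w in nhds z. u w = Re (F w)"
  shows "harmonic_at u z"
  using assms unfolding harmonic_at_def by blast

lemma harmonic_at_iff_ball:
  "harmonic_at u z \<longleftrightarrow> (\<exists>r>0. \<exists>F. F holomorphic_on ball z r \<and> (\<forall>w\<in>ball z r. u w = Re (F w)))"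
proof
  assume "harmonic_at u z"
  then obtain F where F: "F analytic_on {z}" "\<forall>\<^sub>F w in nhds z. u w = Re (F w)"
    unfolding harmonic_at_def by blast
  obtain r1 where r1: "r1 > 0" "F holomorphic_on ball z r1"
    using F(1) unfolding analytic_on_def by auto
  obtain r2 where r2: "r2 > 0" "\<And>w. dist w z < r2 \<Longrightarrow> u w = Re (F w)"
    using F(2) unfolding eventually_nhds_metric by blast
  show "\<exists>r>0. \<exists>F. F holomorphic_on ball z r \<and> (\<forall>w\<in>ball z r. u w = Re (F w))"
    by (rule exI[of _ "min r1 r2"], intro conjI exI[of _ F] ballI)
       (use r1 r2 in \<open>auto intro!: holomorphic_on_subset[OF r1(2)] simp: dist_commute\<close>)
next
  assume "\<exists>r>0. \<exists>F. F holomorphic_on ball z r \<and> (\<forall>w\<in>ball z r. u w = Re (F w))"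
  then obtain r F where r: "r > 0" "F holomorphic_on ball z r" "\<And>w. w\<in>ball z r \<Longrightarrow> u w = Re (F w)" by blast
  show "harmonic_at u z"
  proof (rule harmonic_atI)
    show "F analytic_on {z}" using r by (auto simp: analytic_on_def)
    show "\<forall>\<^sub>F w in nhds z. u w = Re (F w)"
      using r by (intro eventually_nhds_in_open[THEN eventually_mono, of "ball z r"]) auto
  qed
qed

lemma eq_Re_primitive_plus_const:
  fixes u :: "complex \<Rightarrow> real"
  assumes "convex S" "open S" "\<And>z. z \<in> S \<Longrightarrow> (u has_derivative (\<lambda>h. Re (D z * h))) (at z)"
    "\<And>z. z \<in> S \<Longrightarrow> (F has_field_derivative D z) (at z)"
  obtains k where "\<And>z. z \<in> S \<Longrightarrow> u z = Re (F z) + k"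
proof -
  have zero: "((\<lambda>z. u z - Re (F z)) has_derivative (\<lambda>h. 0)) (at z within S)" if "z \<in> S" for z
  proof -
    have "((\<lambda>z. Re (F z)) has_derivative (\<lambda>h. Re (D z * h))) (at z)"
      using assms(4)[OF that] by (intro has_derivative_Re) (simp add: has_field_derivative_def)
    from has_derivative_diff[OF assms(3)[OF that] this]
    show ?thesis using has_derivative_at_withinI by fastforce
  qed
  obtain k where k: "\<And>z. z \<in> S \<Longrightarrow> u z - Re (F z) = k"
    using has_derivative_zero_constant[OF assms(1) zero] by auto
  show ?thesis by (rule that[of k]) (use k in \<open>force simp: algebra_simps\<close>)
qed

text \<open>\<open>D\<close> plays the role of \<open>u_x - i u_y\<close>. On a disc it has a
  primitive, whose real part has the same differential as \<open>u\<close>. Potentials are built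
  from their gradients later, and this is how they are recognised as harmonic.\<close>

lemma harmonic_at_of_gradient:
  assumes "open U" "D holomorphic_on U" "\<And>z. z \<in> U \<Longrightarrow> (u has_derivative (\<lambda>h. Re (D z * h))) (at z)"
    and "z0 \<in> U"
  shows "harmonic_at u z0"
proof -
  obtain r where r: "r > 0" "ball z0 r \<subseteq> U" using assms(1,4) openE by blast
  have "D holomorphic_on ball z0 r" using assms(2) r(2) by (rule holomorphic_on_subset)
  then obtain F where F: "\<And>z. z \<in> ball z0 r \<Longrightarrow> (F has_field_derivative D z) (at z)"
    using holomorphic_convex_primitive'[of "ball z0 r" D] at_within_open[of _ "ball z0 r"] by auto
  obtain k where k: "\<And>z. z \<in> ball z0 r \<Longrightarrow> u z = Re (F z) + k"
    by (rule eq_Re_primitive_plus_const[OF convex_ball open_ball _ F, of z0 r u]) (use assms(3) r(2) in blast)+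
  show ?thesis unfolding harmonic_at_iff_ball
  proof (intro exI conjI ballI)
    show "(\<lambda>z. F z + of_real k) holomorphic_on ball z0 r"
      using F by (intro holomorphic_intros) (meson field_differentiable_at_within field_differentiable_def holomorphic_onI)
  qed (use r k in auto)
qed

lemma harmonic_at_cong:
  assumes "\<forall>\<^sub>F w in nhds z. u w = v w"
  shows "harmonic_at u z \<longleftrightarrow> harmonic_at v z"
  unfolding harmonic_at_def
  by (rule ex_cong1, rule conj_cong[OF refl], rule eventually_cong[OF assms]) simp

lemma harmonic_at_transform:
  "harmonic_at v z \<Longrightarrow> \<forall>\<^sub>F w in nhds z. u w = v w \<Longrightarrow> harmonic_at u z"
  using harmonic_at_cong[of u v z] by simp

lemma harmonic_at_const: "harmonic_at (\<lambda>_. t) z"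
  by (rule harmonic_atI[where F = "\<lambda>_. of_real t"]) auto

lemma harmonic_at_add:
  assumes "harmonic_at u z" "harmonic_at v z"
  shows "harmonic_at (\<lambda>w. u w + v w) z"
proof -
  from assms obtain F G where "F analytic_on {z}" "\<forall>\<^sub>F w in nhds z. u w = Re (F w)"
    "G analytic_on {z}" "\<forall>\<^sub>F w in nhds z. v w = Re (G w)"
    unfolding harmonic_at_def by blast
  thus ?thesis
    by (intro harmonic_atI[where F = "\<lambda>w. F w + G w"])
       (auto intro!: analytic_intros elim: eventually_elim2)
qed

lemma harmonic_at_cmult:
  assumes "harmonic_at u z"
  shows "harmonic_at (\<lambda>w. t * u w) z"
proof -
  from assms obtain F where "F analytic_on {z}" "\<forall>\<^sub>F w in nhds z. u w = Re (F w)"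
    unfolding harmonic_at_def by blast
  thus ?thesis
    by (intro harmonic_atI[where F = "\<lambda>w. of_real t * F w"])
       (auto intro!: analytic_intros elim: eventually_mono)
qed

lemma harmonic_at_diff:
  assumes "harmonic_at u z" "harmonic_at v z"
  shows "harmonic_at (\<lambda>w. u w - v w) z"
  using harmonic_at_add[OF assms(1) harmonic_at_cmult[OF assms(2), of "-1"]] by simp

lemma harmonic_at_compose:
  assumes "harmonic_at u (f z)" "f analytic_on {z}"
  shows "harmonic_at (\<lambda>w. u (f w)) z"
proof -
  from assms obtain F where F: "F analytic_on {f z}" "\<forall>\<^sub>F w in nhds (f z). u w = Re (F w)"
    unfolding harmonic_at_def by blast
  have "(F \<circ> f) analytic_on {z}" using F assms by (intro analytic_on_compose) auto
  moreover have "filterlim f (nhds (f z)) (nhds z)"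
    using analytic_at_imp_isCont[OF assms(2)] by (simp add: isCont_def tendsto_at_iff_tendsto_nhds)
  ultimately show ?thesis
    using F(2) by (intro harmonic_atI[where F = "F \<circ> f"]) (auto simp: filterlim_iff)
qed

text \<open>Dividing by \<open>f z\<close> moves the value to 1, away from the branch cut of
  \<open>Ln\<close>; the modulus lost in this way returns as a constant.\<close>

lemma harmonic_at_ln_norm:
  assumes "f analytic_on {z}" "f z \<noteq> 0"
  shows "harmonic_at (\<lambda>w. ln (norm (f w))) z"
proof (rule harmonic_atI[where F = "\<lambda>w. Ln (f w / f z) + of_real (ln (norm (f z)))"])
  show "(\<lambda>w. Ln (f w / f z) + of_real (ln (norm (f z)))) analytic_on {z}"
    using assms by (intro analytic_intros) auto
  have "isCont f z" using analytic_at_imp_isCont assms(1) by blast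
  hence "\<forall>\<^sub>F w in nhds z. f w \<noteq> 0"
    using assms(2) by (simp add: isCont_def eventually_nhds_conv_at tendsto_imp_eventually_ne)
  thus "\<forall>\<^sub>F w in nhds z. ln (norm (f w)) = Re (Ln (f w / f z) + of_real (ln (norm (f z))))"
    by eventually_elim (use assms in \<open>simp add: norm_divide ln_div\<close>)
qed

lemma analytic_at_eventually:
  assumes "f analytic_on {z}" shows "\<forall>\<^sub>F w in nhds z. f analytic_on {w}"
proof -
  obtain s where "open s" "z \<in> s" "f holomorphic_on s" using assms analytic_at by blast
  thus ?thesis
    by (intro eventually_nhds_in_open[THEN eventually_mono, of s]) (auto simp: analytic_at)
qed

lemma harmonic_at_eventually:
  assumes "harmonic_at u z" shows "\<forall>\<^sub>F w in nhds z. harmonic_at u w"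
proof -
  obtain r F where r: "r > 0" "F holomorphic_on ball z r" "\<And>w. w\<in>ball z r \<Longrightarrow> u w = Re (F w)"
    using assms unfolding harmonic_at_iff_ball by blast
  have "harmonic_at u w" if "w \<in> ball z r" for w
  proof (rule harmonic_atI[where F = F])
    show "F analytic_on {w}" using r that by (auto simp: analytic_at)
    show "\<forall>\<^sub>F w in nhds w. u w = Re (F w)"
      using r that by (intro eventually_nhds_in_open[THEN eventually_mono, of "ball z r"]) auto
  qed
  thus ?thesis
    using r by (intro eventually_nhds_in_open[THEN eventually_mono, of "ball z r"]) auto
qed

lemma harmonic_at_isCont: "harmonic_at u z \<Longrightarrow> isCont u z"
proof -
  assume "harmonic_at u z"
  then obtain F where F: "F analytic_on {z}" "\<forall>\<^sub>F w in nhds z. u w = Re (F w)"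
    unfolding harmonic_at_def by blast
  have "isCont (\<lambda>w. Re (F w)) z" using analytic_at_imp_isCont[OF F(1)] by (intro isCont_Re)
  thus ?thesis using isCont_cong[OF F(2)] by simp
qed

lemma harmonic_at_continuous_on: "(\<And>z. z \<in> U \<Longrightarrow> harmonic_at u z) \<Longrightarrow> continuous_on U u"
  by (intro continuous_at_imp_continuous_on ballI harmonic_at_isCont)

text \<open>The local functions \<open>F z\<close> are unrelated, but the differential of
  \<open>u\<close> determines their derivatives, and so these glue to one holomorphic
  \<open>D\<close>.\<close>

lemma harmonic_at_gradient:
  assumes "open U" "\<And>z. z \<in> U \<Longrightarrow> harmonic_at u z"
  obtains D where "D holomorphic_on U"
    "\<And>z. z \<in> U \<Longrightarrow> (u has_derivative (\<lambda>h. Re (D z * h))) (at z)"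
proof -
  have "\<exists>F. F analytic_on {z} \<and> (\<forall>\<^sub>F w in nhds z. u w = Re (F w))" if "z \<in> U" for z
    using assms(2)[OF that] unfolding harmonic_at_def .
  then obtain F where F: "\<And>z. z \<in> U \<Longrightarrow> F z analytic_on {z}"
    "\<And>z. z \<in> U \<Longrightarrow> \<forall>\<^sub>F w in nhds z. u w = Re (F z w)" by metis
  have der: "(u has_derivative (\<lambda>h. Re (deriv (F z) w * h))) (at w)"
    if "F z analytic_on {w}" "\<forall>\<^sub>F w' in nhds w. u w' = Re (F z w')" for z w
  proof -
    have "(F z has_field_derivative deriv (F z) w) (at w)"
      using that(1) by (simp add: analytic_on_imp_differentiable_at DERIV_deriv_iff_field_differentiable)
    hence "(F z has_derivative (\<lambda>h. deriv (F z) w * h)) (at w)"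
      by (simp add: has_field_derivative_def)
    hence "((\<lambda>w. Re (F z w)) has_derivative (\<lambda>h. Re (deriv (F z) w * h))) (at w)"
      by (rule has_derivative_Re)
    thus ?thesis
      by (rule has_derivative_transform_eventually)
         (use that(2) in \<open>auto simp: eventually_nhds_conv_at elim: eventually_mono\<close>)
  qed
  define D where "D = (\<lambda>z. deriv (F z) z)"
  have uD: "(u has_derivative (\<lambda>h. Re (D z * h))) (at z)" if "z \<in> U" for z
    unfolding D_def using der F that by blast
  have "D analytic_on {z}" if "z \<in> U" for z
  proof -
    have ev: "\<forall>\<^sub>F w in nhds z. F z analytic_on {w} \<and> (\<forall>\<^sub>F w' in nhds w. u w' = Re (F z w')) \<and> w \<in> U"
    proof (intro eventually_conj)
      show "\<forall>\<^sub>F w in nhds z. F z analytic_on {w}"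
        using F(1)[OF that] by (rule analytic_at_eventually)
      show "\<forall>\<^sub>F w in nhds z. \<forall>\<^sub>F w' in nhds w. u w' = Re (F z w')"
        using F(2)[OF that] by (simp add: eventually_eventually)
      show "\<forall>\<^sub>F w in nhds z. w \<in> U" using assms(1) that by (rule eventually_nhds_in_open)
    qed
    have eq: "\<forall>\<^sub>F w in nhds z. deriv (F z) w = D w" using ev
    proof eventually_elim
      case (elim w)
      have "(\<lambda>h. Re (deriv (F z) w * h)) = (\<lambda>h. Re (D w * h))"
        using has_derivative_unique[OF der uD] elim by blast
      from fun_cong[OF this, of 1] fun_cong[OF this, of \<i>] show ?case
        by (auto simp: complex_eq_iff)
    qed
    have "deriv (F z) analytic_on {z}" using F(1)[OF that] by (rule analytic_deriv)
    thus ?thesis using analytic_at_cong[OF eq] by simp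
  qed
  hence "D holomorphic_on U"
    using assms(1) analytic_on_analytic_at analytic_imp_holomorphic by blast
  thus ?thesis using that uD by blast
qed

section \<open>Agreement with the definition by second derivatives\<close>

lemma harmonic_at_imp_harmonic_on:
  assumes "open U" "\<And>z. z \<in> U \<Longrightarrow> harmonic_at u z"
  shows "harmonic_on u U"
proof -
  obtain D where D: "D holomorphic_on U"
    "\<And>z. z \<in> U \<Longrightarrow> (u has_derivative (\<lambda>h. Re (D z * h))) (at z)"
    using harmonic_at_gradient[OF assms] by blast
  have dD: "(D has_derivative (\<lambda>h. deriv D z * h)) (at z)" if "z \<in> U" for z
    using holomorphic_derivI[OF D(1) assms(1) that] by (simp add: has_field_derivative_def)
  have cont: "continuous_on U (deriv D)"
    using holomorphic_deriv[OF D(1) assms(1)] by (rule holomorphic_on_imp_continuous_on)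
  show ?thesis unfolding harmonic_on_def
  proof (intro conjI assms(1) exI ballI)
    fix z assume z: "z \<in> U"
    show "(u has_derivative (\<lambda>h. (\<lambda>z. Re (D z)) z * Re h + (\<lambda>z. - Im (D z)) z * Im h)) (at z)"
      using D(2)[OF z] by simp
    show "((\<lambda>z. Re (D z)) has_derivative
        (\<lambda>h. (\<lambda>z. Re (deriv D z)) z * Re h + (\<lambda>z. - Im (deriv D z)) z * Im h)) (at z)"
      using has_derivative_Re[OF dD[OF z]] by simp
    show "((\<lambda>z. - Im (D z)) has_derivative
        (\<lambda>h. (\<lambda>z. - Im (deriv D z)) z * Re h + (\<lambda>z. - Re (deriv D z)) z * Im h)) (at z)"
      using has_derivative_minus[OF has_derivative_Im[OF dD[OF z]]] by (simp add: algebra_simps)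
    show "(\<lambda>z. Re (deriv D z)) z + (\<lambda>z. - Re (deriv D z)) z = 0" by simp
  qed (intro continuous_intros cont)+
qed

text \<open>Schwarz's theorem. The second difference of \<open>u\<close> over a small square is
  evaluated by the mean value theorem in both orders of the variables, so \<open>uxy\<close> and
  \<open>uyx\<close> take a common value at two points close to \<open>z0\<close>.\<close>

lemma mixed_partials_commute:
  fixes u ux uy :: "complex \<Rightarrow> real"
  assumes "open U" "z0 \<in> U"
    and u: "\<And>z. z \<in> U \<Longrightarrow> (u has_derivative (\<lambda>h. ux z * Re h + uy z * Im h)) (at z)"
    and ux: "\<And>z. z \<in> U \<Longrightarrow> (ux has_derivative (\<lambda>h. uxx z * Re h + uxy z * Im h)) (at z)"
    and uy: "\<And>z. z \<in> U \<Longrightarrow> (uy has_derivative (\<lambda>h. uyx z * Re h + uyy z * Im h)) (at z)"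
    and cont: "continuous_on U uxy" "continuous_on U uyx"
  shows "uxy z0 = uyx z0"
proof (rule ccontr)
  assume ne: "uxy z0 \<noteq> uyx z0"
  define \<epsilon> where "\<epsilon> = \<bar>uxy z0 - uyx z0\<bar> / 2"
  have \<epsilon>: "\<epsilon> > 0" using ne by (simp add: \<epsilon>_def)
  have c: "isCont uxy z0" "isCont uyx z0"
    using cont assms(1,2) continuous_on_eq_continuous_at by blast+
  have "\<forall>\<^sub>F z in nhds z0. z \<in> U \<and> \<bar>uxy z - uxy z0\<bar> < \<epsilon> \<and> \<bar>uyx z - uyx z0\<bar> < \<epsilon>"
    using eventually_nhds_in_open[OF assms(1,2)]
      tendstoD[OF isCont_def[THEN iffD1, OF c(1), unfolded tendsto_at_iff_tendsto_nhds] \<epsilon>]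
      tendstoD[OF isCont_def[THEN iffD1, OF c(2), unfolded tendsto_at_iff_tendsto_nhds] \<epsilon>]
    by eventually_elim (auto simp: dist_norm)
  then obtain d where d: "d > 0" "\<And>z. dist z z0 < d \<Longrightarrow> z \<in> U \<and> \<bar>uxy z - uxy z0\<bar> < \<epsilon> \<and> \<bar>uyx z - uyx z0\<bar> < \<epsilon>"
    unfolding eventually_nhds_metric by blast
  define p where "p = (\<lambda>s t::real. z0 + Complex s t)"
  \<comment> \<open>A point with both coordinates at most \<open>h\<close> lies within
    \<open>2 * h < d\<close> of \<open>z0\<close>.\<close>
  define h where "h = d / 4"
  have h: "h > 0" using d by (simp add: h_def)
  have near: "dist (p s t) z0 < d" if "0 \<le> s" "s \<le> h" "0 \<le> t" "t \<le> h" for s t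
    using cmod_le[of "Complex s t"] that d(1) by (simp add: p_def dist_norm h_def)
  have U: "p s t \<in> U" if "0 \<le> s" "s \<le> h" "0 \<le> t" "t \<le> h" for s t
    using d(2)[OF near[OF that]] by blast
  have ps: "((\<lambda>s. p s t) has_derivative (\<lambda>k. of_real k)) (at s)" for s t
    unfolding p_def Complex_eq by (auto intro!: derivative_eq_intros)
  have pt: "((\<lambda>t. p s t) has_derivative (\<lambda>k. \<i> * of_real k)) (at t)" for s t
    unfolding p_def Complex_eq by (auto intro!: derivative_eq_intros)
  have ds: "((\<lambda>s. f (p s t)) has_real_derivative a (p s t)) (at s)"
    if "(f has_derivative (\<lambda>h. a (p s t) * Re h + b (p s t) * Im h)) (at (p s t))" for f a b s t
    using has_derivative_compose[OF ps that]
    by (simp add: has_field_derivative_def)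
  have dt: "((\<lambda>t. f (p s t)) has_real_derivative b (p s t)) (at t)"
    if "(f has_derivative (\<lambda>h. a (p s t) * Re h + b (p s t) * Im h)) (at (p s t))" for f a b s t
    using has_derivative_compose[OF pt that]
    by (simp add: has_field_derivative_def)
  have "\<exists>s>0. s < h \<and> (u (p h h) - u (p h 0)) - (u (p 0 h) - u (p 0 0)) =
      (h - 0) * (ux (p s h) - ux (p s 0))"
    by (rule MVT2[OF h, where f = "\<lambda>s. u (p s h) - u (p s 0)"])
       (rule DERIV_diff; rule ds; rule u; rule U; use h in simp)
  then obtain s where s: "0 < s" "s < h" "(u (p h h) - u (p h 0)) - (u (p 0 h) - u (p 0 0)) =
      (h - 0) * (ux (p s h) - ux (p s 0))" by blast
  have "\<exists>t>0. t < h \<and> ux (p s h) - ux (p s 0) = (h - 0) * uxy (p s t)"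
    by (rule MVT2[OF h, where f = "\<lambda>t. ux (p s t)"]) (rule dt; rule ux; rule U; use h s in simp)
  then obtain t where t: "0 < t" "t < h" "ux (p s h) - ux (p s 0) = (h - 0) * uxy (p s t)" by blast
  have "\<exists>t>0. t < h \<and> (u (p h h) - u (p 0 h)) - (u (p h 0) - u (p 0 0)) =
      (h - 0) * (uy (p h t) - uy (p 0 t))"
    by (rule MVT2[OF h, where f = "\<lambda>t. u (p h t) - u (p 0 t)"])
       (rule DERIV_diff; rule dt; rule u; rule U; use h in simp)
  then obtain t' where t': "0 < t'" "t' < h" "(u (p h h) - u (p 0 h)) - (u (p h 0) - u (p 0 0)) =
      (h - 0) * (uy (p h t') - uy (p 0 t'))" by blast
  have "\<exists>s>0. s < h \<and> uy (p h t') - uy (p 0 t') = (h - 0) * uyx (p s t')"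
    by (rule MVT2[OF h, where f = "\<lambda>s. uy (p s t')"]) (rule ds; rule uy; rule U; use h t' in simp)
  then obtain s' where s': "0 < s'" "s' < h" "uy (p h t') - uy (p 0 t') = (h - 0) * uyx (p s' t')" by blast
  have "h * (h * uxy (p s t)) = h * (h * uyx (p s' t'))"
    using s(3)[unfolded t(3)] t'(3)[unfolded s'(3)] unfolding diff_zero by linarith
  hence "uxy (p s t) = uyx (p s' t')" using h by simp
  moreover have "\<bar>uxy (p s t) - uxy z0\<bar> < \<epsilon>" "\<bar>uyx (p s' t') - uyx z0\<bar> < \<epsilon>"
    using d(2)[OF near[of s t]] d(2)[OF near[of s' t']] s t s' t' by auto
  moreover have "\<bar>uxy z0 - uyx z0\<bar> \<le> \<bar>uxy (p s t) - uxy z0\<bar> + \<bar>uxy (p s t) - uyx z0\<bar>" by linarith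
  ultimately show False unfolding \<epsilon>_def by simp
qed

text \<open>\<open>P = u_x - i u_y\<close> satisfies the Cauchy-Riemann equations: one is the
  Laplace equation, the other the symmetry of the mixed partials.\<close>

lemma harmonic_on_imp_harmonic_at:
  assumes "harmonic_on u U" "z0 \<in> U"
  shows "harmonic_at u z0"
proof -
  from assms(1) obtain ux uy uxx uxy uyx uyy where U: "open U" and
    d: "\<And>z. z\<in>U \<Longrightarrow> (u has_derivative (\<lambda>h. ux z * Re h + uy z * Im h)) (at z)"
       "\<And>z. z\<in>U \<Longrightarrow> (ux has_derivative (\<lambda>h. uxx z * Re h + uxy z * Im h)) (at z)"
       "\<And>z. z\<in>U \<Longrightarrow> (uy has_derivative (\<lambda>h. uyx z * Re h + uyy z * Im h)) (at z)"
       "\<And>z. z\<in>U \<Longrightarrow> uxx z + uyy z = 0"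
    and c: "continuous_on U uxy" "continuous_on U uyx"
    unfolding harmonic_on_def by blast
  have sym: "uxy z = uyx z" if "z \<in> U" for z
    by (rule mixed_partials_commute[OF U that d(1-3) c])
  define P where "P = (\<lambda>z. Complex (ux z) (- uy z))"
  have P: "(P has_field_derivative Complex (uxx z) (- uxy z)) (at z)" if "z \<in> U" for z
  proof -
    have "(P has_derivative (\<lambda>h. of_real (uxx z * Re h + uxy z * Im h) +
        \<i> * of_real (- (uyx z * Re h + uyy z * Im h)))) (at z)"
      unfolding P_def Complex_eq
      by (intro derivative_intros d that)
    moreover have "(\<lambda>h. of_real (uxx z * Re h + uxy z * Im h) +
        \<i> * of_real (- (uyx z * Re h + uyy z * Im h))) = (\<lambda>h. Complex (uxx z) (- uxy z) * h)"
      using sym[OF that] d(4)[OF that] by (auto simp: fun_eq_iff complex_eq_iff algebra_simps add_eq_0_iff)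
    ultimately show ?thesis by (simp add: has_field_derivative_def)
  qed
  have "P holomorphic_on U"
    using P by (meson field_differentiable_at_within field_differentiable_def holomorphic_onI)
  moreover have "(u has_derivative (\<lambda>h. Re (P z * h))) (at z)" if "z \<in> U" for z
    using d(1)[OF that] by (simp add: P_def)
  ultimately show ?thesis using U assms(2) by (intro harmonic_at_of_gradient[of U P u])
qed

text \<open>Cauchy's integral formula for a holomorphic \<open>F\<close> with
  \<open>u = Re F + k\<close>. By convexity a single \<open>F\<close> serves on a disc slightly
  larger than \<open>cball z0 r\<close>.\<close>

lemma harmonic_mean_value:
  assumes "r > 0" "\<And>z. z \<in> cball z0 r \<Longrightarrow> harmonic_at u z"
  shows "((\<lambda>t. u (z0 + of_real r * cis t)) has_integral 2 * pi * u z0) {0..2 * pi}"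
proof -
  have op: "open {z. harmonic_at u z}"
  proof (subst open_subopen, intro ballI)
    fix x assume "x \<in> {z. harmonic_at u z}"
    then obtain T where "open T" "x \<in> T" "\<forall>w\<in>T. harmonic_at u w"
      using harmonic_at_eventually[of u x] unfolding eventually_nhds by auto
    thus "\<exists>T. open T \<and> x \<in> T \<and> T \<subseteq> {z. harmonic_at u z}" by auto
  qed
  \<comment> \<open>The points of harmonicity form an open set, so by compactness the closed disc
    can be enlarged by some \<epsilon>.\<close>
  obtain \<epsilon> where \<epsilon>: "\<epsilon> > 0" "(\<Union>x\<in>cball z0 r. ball x \<epsilon>) \<subseteq> {z. harmonic_at u z}"
    by (rule compact_subset_open_imp_ball_epsilon_subset[of "cball z0 r" "{z. harmonic_at u z}"])
       (use assms(2) op in \<open>auto simp del: mem_cball\<close>)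
  define R where "R = r + \<epsilon>"
  have har: "harmonic_at u z" if "z \<in> ball z0 R" for z
  proof (cases "z \<in> cball z0 r")
    case False
    \<comment> \<open>The radial projection of \<open>z\<close> to the circle of radius
      \<open>r\<close>.\<close>
    define x where "x = z0 + of_real (r / norm (z - z0)) * (z - z0)"
    have n: "norm (z - z0) > r" "norm (z - z0) < r + \<epsilon>"
      using False that by (auto simp: R_def dist_norm norm_minus_commute)
    have "x \<in> cball z0 r" using n assms(1) by (simp add: x_def dist_norm norm_mult norm_divide)
    moreover have "dist x z < \<epsilon>"
    proof -
      have "z - x = of_real (1 - r / norm (z - z0)) * (z - z0)" by (simp add: x_def algebra_simps)
      hence "norm (z - x) = \<bar>1 - r / norm (z - z0)\<bar> * norm (z - z0)" by (simp only: norm_mult norm_of_real)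
      also have "\<dots> = norm (z - z0) - r" using n assms(1) by (auto simp: abs_if field_simps)
      finally show ?thesis using n by (simp add: dist_norm norm_minus_commute)
    qed
    ultimately have "z \<in> (\<Union>x\<in>cball z0 r. ball x \<epsilon>)" by (auto simp del: mem_cball)
    thus ?thesis using \<epsilon>(2) by blast
  qed (use assms in auto)
  obtain D where D: "D holomorphic_on ball z0 R"
    "\<And>z. z \<in> ball z0 R \<Longrightarrow> (u has_derivative (\<lambda>h. Re (D z * h))) (at z)"
    using harmonic_at_gradient[OF open_ball har] by blast
  obtain F where F: "\<And>z. z \<in> ball z0 R \<Longrightarrow> (F has_field_derivative D z) (at z)"
    using holomorphic_convex_primitive'[of "ball z0 R" D] D(1) at_within_open[of _ "ball z0 R"] by auto
  obtain k where k: "\<And>z. z \<in> ball z0 R \<Longrightarrow> u z = Re (F z) + k"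
    using eq_Re_primitive_plus_const[OF convex_ball open_ball D(2) F] by metis
  have sub: "cball z0 r \<subseteq> ball z0 R" using \<epsilon> by (auto simp: R_def)
  have "F holomorphic_on ball z0 R"
    using F by (meson field_differentiable_at_within field_differentiable_def holomorphic_onI)
  hence holF: "F holomorphic_on cball z0 r" using sub holomorphic_on_subset by blast
  have "((\<lambda>w. F w / (w - z0)) has_contour_integral 2 * of_real pi * \<i> * F z0) (part_circlepath z0 r 0 (2 * pi))"
    using Cauchy_integral_circlepath_simple[OF holF] assms(1) by (simp add: circlepath_def)
  hence "((\<lambda>t. F (z0 + of_real r * cis t) / (z0 + of_real r * cis t - z0) * of_real r * \<i> * cis t)
      has_integral 2 * of_real pi * \<i> * F z0) {0..2 * pi}"
    by (subst (asm) has_contour_integral_part_circlepath_iff) auto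
  hence "((\<lambda>t. \<i> * F (z0 + of_real r * cis t)) has_integral 2 * of_real pi * \<i> * F z0) {0..2 * pi}"
    using assms(1) by (simp add: mult_ac)
  from has_integral_mult_right[OF this, of "- \<i>"]
  have "((\<lambda>t. F (z0 + of_real r * cis t)) has_integral 2 * of_real pi * F z0) {0..2 * pi}" by (simp add: mult_ac)
  hence "((\<lambda>t. Re (F (z0 + of_real r * cis t)) + k) has_integral Re (2 * of_real pi * F z0) + 2 * pi * k) {0..2 * pi}"
    by (intro has_integral_add has_integral_Re) (auto intro: has_integral_const_real[of k 0 "2*pi", simplified])
  moreover have "Re (F z) + k = u z" if "z \<in> cball z0 r" for z using k sub that by auto
  moreover have "z0 + of_real r * cis t \<in> cball z0 r" for t using assms(1) by (simp add: dist_norm norm_mult)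
  moreover have "Re (2 * of_real pi * F z0) + 2 * pi * k = 2 * pi * u z0"
    using k[of z0] assms(1) \<epsilon>(1) by (simp add: R_def algebra_simps)
  ultimately show ?thesis by simp
qed

lemma harmonic_at_imp_subharmonic_on:
  assumes "open U" "\<And>z. z \<in> U \<Longrightarrow> harmonic_at u z"
  shows "subharmonic_on u U"
  unfolding subharmonic_on_def
proof (intro conjI assms(1) ballI)
  show "continuous_on U u" using assms by (intro harmonic_at_continuous_on)
  fix z assume "z \<in> U"
  then obtain R where R: "R > 0" "cball z R \<subseteq> U" using assms(1) open_contains_cball by blast
  have "u z \<le> 1 / (2 * pi) * integral {0..2 * pi} (\<lambda>t. u (z + of_real r * cis t))" if "r \<in> {0<..R}" for r
  proof -
    have "((\<lambda>t. u (z + of_real r * cis t)) has_integral 2 * pi * u z) {0..2 * pi}"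
    proof (rule harmonic_mean_value)
      show "harmonic_at u w" if "w \<in> cball z r" for w
        using that \<open>r \<in> {0<..R}\<close> R(2) by (intro assms(2) subsetD[OF R(2)]) auto
    qed (use that in auto)
    thus ?thesis by (simp add: integral_unique)
  qed
  thus "\<exists>R>0. cball z R \<subseteq> U \<and> (\<forall>r\<in>{0<..R}. u z \<le> 1 / (2 * pi) * integral {0..2 * pi} (\<lambda>t. u (z + of_real r * cis t)))"
    using R by blast
qed

section \<open>The maximum principle on the sphere\<close>

text \<open>\<open>M - f\<close> is continuous and nonnegative, and its integral is at most
  0.\<close>

lemma mean_ge_max_imp_eq:
  fixes f :: "real \<Rightarrow> real"
  assumes "continuous_on {0..2 * pi} f" "\<And>t. t \<in> {0..2*pi} \<Longrightarrow> f t \<le> M"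
    "M \<le> 1 / (2 * pi) * integral {0..2 * pi} f" "t \<in> {0..2*pi}"
  shows "f t = M"
proof -
  have int: "f integrable_on {0..2*pi}" using assms(1) by (rule integrable_continuous_real)
  have "integral {0..2*pi} (\<lambda>t. M - f t) = 2 * pi * M - integral {0..2*pi} f"
    using int by (subst integral_diff) auto
  also have "\<dots> \<le> 0" using assms(3) by (simp add: field_simps)
  finally have "integral {0..2*pi} (\<lambda>t. M - f t) \<le> 0" .
  moreover have "integral {0..2*pi} (\<lambda>t. M - f t) \<ge> 0"
    using assms(2) int by (intro integral_nonneg) (auto intro!: integrable_diff)
  ultimately have "integral {0..2*pi} (\<lambda>t. M - f t) = 0" by linarith
  moreover have "continuous_on {0..2*pi} (\<lambda>t. M - f t)" using assms(1) by (intro continuous_intros)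
  ultimately show ?thesis
    using integral_eq_0_iff[of 0 "2*pi" "\<lambda>t. M - f t"] assms(2,4) by auto
qed

lemma complex_as_circle_point:
  obtains t where "t \<in> {0..2*pi}" "w = z + of_real (norm (w - z)) * cis t"
proof -
  define t where "t = Arg2pi (w - z)"
  have "w - z = of_real (norm (w - z)) * cis t"
    unfolding t_def cis_conv_exp by (metis Arg2pi_eq mult.commute)
  moreover have "t \<in> {0..2*pi}" using Arg2pi[of "w - z"] by (auto simp: t_def)
  ultimately show ?thesis using that by (metis add.commute diff_add_cancel)
qed

lemma subharmonic_onE:
  assumes "subharmonic_on v U" "z \<in> U"
  obtains R where "R > 0" "cball z R \<subseteq> U"
    "\<forall>r\<in>{0<..R}. v z \<le> 1 / (2 * pi) * integral {0..2 * pi} (\<lambda>t. v (z + of_real r * cis t))"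
proof -
  have "\<exists>R>0. cball z R \<subseteq> U \<and>
      (\<forall>r\<in>{0<..R}. v z \<le> 1 / (2 * pi) * integral {0..2 * pi} (\<lambda>t. v (z + of_real r * cis t)))"
    using assms unfolding subharmonic_on_def by (elim conjE) (erule bspec)
  then obtain R where R: "R > 0 \<and> cball z R \<subseteq> U \<and>
      (\<forall>r\<in>{0<..R}. v z \<le> 1 / (2 * pi) * integral {0..2 * pi} (\<lambda>t. v (z + of_real r * cis t)))" ..
  show ?thesis
    by (rule that[OF R[THEN conjunct1] R[THEN conjunct2, THEN conjunct1]
      R[THEN conjunct2, THEN conjunct2]])
qed

text \<open>Around a maximum point the mean inequality holds for every small radius. Each of these
  circles therefore consists of maximum points, and together they fill a disc.\<close>

lemma max_set_open:
  assumes "subharmonic_on v U" "\<And>w. w \<in> U \<Longrightarrow> v w \<le> M"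
  shows "open {z\<in>U. v z = M}"
proof (subst open_subopen, intro ballI)
  fix z assume z: "z \<in> {z\<in>U. v z = M}"
  hence "z \<in> U" by simp
  have cont: "continuous_on U v" using assms(1) unfolding subharmonic_on_def by blast
  obtain R where R: "R > 0" "cball z R \<subseteq> U"
    "\<forall>r\<in>{0<..R}. v z \<le> 1 / (2 * pi) * integral {0..2 * pi} (\<lambda>t. v (z + of_real r * cis t))"
    by (rule subharmonic_onE[OF assms(1) \<open>z \<in> U\<close>])
  have "v w = M" if "w \<in> ball z R" for w
  proof (cases "w = z")
    case False
    obtain t where t: "t \<in> {0..2*pi}" "w = z + of_real (norm (w - z)) * cis t"
      using complex_as_circle_point .
    define r where "r = norm (w - z)"
    have r: "r \<in> {0<..R}" using that False by (auto simp: r_def dist_norm norm_minus_commute)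
    have circ: "z + of_real r * cis t \<in> U" for t
      using r by (intro subsetD[OF R(2)]) (simp add: dist_norm norm_mult)
    have "v (z + of_real r * cis t) = M"
    proof (rule mean_ge_max_imp_eq[of "\<lambda>t. v (z + of_real r * cis t)"])
      show "continuous_on {0..2*pi} (\<lambda>t. v (z + of_real r * cis t))"
        using circ by (intro continuous_on_compose2[OF cont]) (auto intro!: continuous_intros)
      show "M \<le> 1 / (2 * pi) * integral {0..2 * pi} (\<lambda>t. v (z + of_real r * cis t))"
        using bspec[OF R(3) r] z by simp
    qed (use assms(2) circ t in auto)
    thus ?thesis using t by (simp add: r_def)
  qed (use z in auto)
  thus "\<exists>T. open T \<and> z \<in> T \<and> T \<subseteq> {z\<in>U. v z = M}"
    using R by (intro exI[of _ "ball z R"]) auto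
qed

text \<open>Infinity is treated through the limit \<open>L\<close> and large circles;
  \<open>mean\<close> is the sub-mean value property there. A positive supremum would be attained,
  and the set where it is attained is clopen in the whole plane, since the boundary condition keeps
  it away from \<open>K\<close>. It would then be the plane, although \<open>K\<close> is
  nonempty.\<close>

lemma subharmonic_max_principle:
  assumes K: "compact K" "K \<noteq> {}" and v: "subharmonic_on v (-K)" and L: "(v \<longlongrightarrow> L) at_infinity"
    and mean: "\<forall>\<^sub>F \<rho> in at_top. L \<le> 1 / (2 * pi) * integral {0..2 * pi} (\<lambda>t. v (of_real \<rho> * cis t))"
    and bd: "\<And>\<zeta> \<epsilon>. \<zeta> \<in> K \<Longrightarrow> \<epsilon> > 0 \<Longrightarrow> \<forall>\<^sub>F w in at \<zeta> within -K. v w < \<epsilon>"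
    and z: "z \<notin> K"
  shows "v z \<le> 0"
proof (rule ccontr)
  assume "\<not> v z \<le> 0"
  hence pos: "v z > 0" by simp
  have cont: "continuous_on (-K) v" and opn: "open (-K)"
    using v unfolding subharmonic_on_def by blast+
  \<comment> \<open>Closed in the plane and not only in \<open>- K\<close>: near \<open>K\<close>
    the values drop below \<open>m\<close>.\<close>
  have closed: "closed {w\<in>-K. v w \<in> S}" if S: "closed S" "S \<subseteq> {m..}" "m > 0" for m S
  proof -
    have "w \<in> {w\<in>-K. v w \<in> S}" if w: "w \<in> closure {w\<in>-K. v w \<in> S}" for w
    proof -
      have wK: "w \<in> -K"
      proof (rule ccontr)
        assume "w \<notin> -K"
        hence wK: "w \<in> K" by simp
        have "\<forall>\<^sub>F x in at w within -K. v x < m" by (rule bd[OF wK S(3)])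
        then obtain d where d: "d > 0" "\<And>x. x \<in> -K \<Longrightarrow> x \<noteq> w \<Longrightarrow> dist x w < d \<Longrightarrow> v x < m"
          unfolding eventually_at by blast
        obtain x where x: "x \<in> -K" "v x \<in> S" "dist x w < d"
          using w d(1) unfolding closure_approachable by blast
        have "v x < m" using x wK by (intro d(2)) auto
        moreover have "m \<le> v x" using S(2) x(2) by auto
        ultimately show False by linarith
      qed
      obtain x where x: "\<And>n. x n \<in> {w\<in>-K. v w \<in> S}" "x \<longlonglongrightarrow> w"
        using w unfolding closure_sequential by blast
      have "isCont v w" using wK cont opn continuous_on_eq_continuous_at by blast
      hence lim: "(\<lambda>n. v (x n)) \<longlonglongrightarrow> v w" using x(2) by (rule isCont_tendsto_compose)
      have "v w \<in> S" by (rule closed_sequentially[OF S(1) _ lim]) (use x(1) in blast)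
      thus ?thesis using wK by blast
    qed
    thus ?thesis using closure_subset_eq by blast
  qed
  \<comment> \<open>Either some value exceeds both 0 and \<open>L\<close>, and the supremum is
    attained on a compact set; or \<open>L\<close> is an upper bound, and a large circle with mean
    at least \<open>L\<close> consists of maximum points.\<close>
  have "\<exists>z1\<in>-K. v z1 > 0 \<and> (\<forall>w\<in>-K. v w \<le> v z1)"
  proof (cases "\<exists>w\<in>-K. v w > max L 0")
    case True
    then obtain z0 where z0: "z0 \<in> -K" "v z0 > L" "v z0 > 0" by auto
    define A where "A = {w\<in>-K. v w \<in> {v z0..}}"
    have "\<forall>\<^sub>F w in at_infinity. v w < v z0" using L z0(2) by (rule order_tendstoD)
    then obtain b where b: "\<And>w. b \<le> norm w \<Longrightarrow> v w < v z0" unfolding eventually_at_infinity by blast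
    have "A \<subseteq> cball 0 b"
    proof
      fix w assume "w \<in> A"
      hence "\<not> b \<le> norm w" using b[of w] by (auto simp: A_def)
      thus "w \<in> cball 0 b" by simp
    qed
    moreover have "closed A" unfolding A_def by (rule closed[OF closed_atLeast order_refl z0(3)])
    ultimately have "compact A" by (meson bounded_cball bounded_subset compact_eq_bounded_closed)
    moreover have "z0 \<in> A" using z0 by (simp add: A_def)
    moreover have "continuous_on A v" using cont by (rule continuous_on_subset) (auto simp: A_def)
    ultimately obtain z1 where z1: "z1 \<in> A" "\<And>w. w \<in> A \<Longrightarrow> v w \<le> v z1"
      using continuous_attains_sup[of A v] by blast
    have "v w \<le> v z1" if "w \<in> -K" for w
    proof (cases "w \<in> A")
      case False
      thus ?thesis using that z1(2)[OF \<open>z0 \<in> A\<close>] by (auto simp: A_def)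
    qed (rule z1(2))
    moreover from z1 have "v z1 > 0" using z1(2)[OF \<open>z0 \<in> A\<close>] z0(3) by linarith
    ultimately show ?thesis using z1(1) by (intro bexI[of _ z1]) (auto simp: A_def)
  next
    case False
    hence le0: "v w \<le> max L 0" if "w \<in> -K" for w using that by (meson not_less)
    have Lpos: "L > 0" using le0[of z] pos z by auto
    have le: "v w \<le> L" if "w \<in> -K" for w using le0[OF that] Lpos by simp
    obtain R where R: "\<And>w. w \<in> K \<Longrightarrow> norm w \<le> R"
      using compact_imp_bounded[OF K(1)] unfolding bounded_iff by blast
    have "\<forall>\<^sub>F \<rho> in at_top. \<rho> > R \<and> \<rho> > 0" by (intro eventually_conj eventually_gt_at_top)
    from eventually_conj[OF this mean] obtain \<rho> where
      \<rho>: "\<rho> > R" "\<rho> > 0" "L \<le> 1 / (2 * pi) * integral {0..2 * pi} (\<lambda>t. v (of_real \<rho> * cis t))"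
      using eventually_happens'[OF trivial_limit_at_top_linorder] by blast
    have circ: "of_real \<rho> * cis t \<in> -K" for t
      using R[of "of_real \<rho> * cis t"] \<rho> by (auto simp: norm_mult)
    have "v (of_real \<rho> * cis 0) = L"
    proof (rule mean_ge_max_imp_eq[of "\<lambda>t. v (of_real \<rho> * cis t)"])
      show "continuous_on {0..2*pi} (\<lambda>t. v (of_real \<rho> * cis t))"
        using circ by (intro continuous_on_compose2[OF cont]) (auto intro!: continuous_intros)
    qed (use \<rho>(3) circ le in auto)
    thus ?thesis using le Lpos circ[of 0] by (intro bexI[of _ "of_real \<rho> * cis 0"]) auto
  qed
  then obtain z1 where z1: "z1 \<in> -K" "v z1 > 0" "\<And>w. w \<in> -K \<Longrightarrow> v w \<le> v z1" by blast
  let ?Z = "{w\<in>-K. v w = v z1}"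
  have "closed ?Z" using closed[of "{v z1}" "v z1"] z1 by simp
  moreover have "open ?Z" by (rule max_set_open[OF v z1(3)])
  ultimately have "?Z = {} \<or> ?Z = UNIV" by (simp only: clopen[symmetric])
  moreover have "z1 \<in> ?Z" using z1(1) by simp
  moreover have "?Z \<noteq> UNIV" using K(2) by auto
  ultimately show False by (metis empty_iff)
qed

text \<open>Harmonic off \<open>K\<close>, with \<open>u z = \<kappa> ln |z| + L + o(1)\<close> at infinity; so \<open>L\<close> is the value there if \<open>\<kappa> = 0\<close>, and
  Robin's constant if \<open>\<kappa> = 1\<close> and \<open>u\<close> is the Green's function.\<close>

definition log_harmonic :: "real \<Rightarrow> (complex \<Rightarrow> real) \<Rightarrow> real \<Rightarrow> complex set \<Rightarrow> bool" where
  "log_harmonic \<kappa> u L K \<longleftrightarrow> (\<forall>z\<in>-K. harmonic_at u z) \<and>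
     harmonic_at (\<lambda>w. if w = 0 then L else u (1 / w) + \<kappa> * ln (norm w)) 0"

lemma log_harmonic_add:
  assumes "log_harmonic \<kappa> u L K" "log_harmonic \<kappa>' u' L' K"
  shows "log_harmonic (\<kappa> + \<kappa>') (\<lambda>z. u z + u' z) (L + L') K"
proof -
  have "harmonic_at (\<lambda>w. (if w = 0 then L else u (1 / w) + \<kappa> * ln (norm w)) +
     (if w = 0 then L' else u' (1 / w) + \<kappa>' * ln (norm w))) 0"
    using assms unfolding log_harmonic_def by (elim conjE) (rule harmonic_at_add)
  also have "(\<lambda>w. (if w = 0 then L else u (1 / w) + \<kappa> * ln (norm w)) +
     (if w = 0 then L' else u' (1 / w) + \<kappa>' * ln (norm w))) =
     (\<lambda>w. if w = 0 then L + L' else u (1 / w) + u' (1 / w) + (\<kappa> + \<kappa>') * ln (norm w))"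
    by (auto simp: fun_eq_iff algebra_simps)
  finally show ?thesis using assms unfolding log_harmonic_def by (auto intro: harmonic_at_add)
qed

lemma log_harmonic_cmult:
  assumes "log_harmonic \<kappa> u L K"
  shows "log_harmonic (t * \<kappa>) (\<lambda>z. t * u z) (t * L) K"
proof -
  have "harmonic_at (\<lambda>w. t * (if w = 0 then L else u (1 / w) + \<kappa> * ln (norm w))) 0"
    using assms unfolding log_harmonic_def by (elim conjE) (rule harmonic_at_cmult)
  also have "(\<lambda>w. t * (if w = 0 then L else u (1 / w) + \<kappa> * ln (norm w))) =
     (\<lambda>w. if w = 0 then t * L else t * u (1 / w) + t * \<kappa> * ln (norm w))"
    by (auto simp: fun_eq_iff algebra_simps)
  finally show ?thesis using assms unfolding log_harmonic_def by (auto intro: harmonic_at_cmult)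
qed

lemma log_harmonic_diff:
  assumes "log_harmonic \<kappa> u L K" "log_harmonic \<kappa>' u' L' K"
  shows "log_harmonic (\<kappa> - \<kappa>') (\<lambda>z. u z - u' z) (L - L') K"
  using log_harmonic_add[OF assms(1) log_harmonic_cmult[OF assms(2), of "-1"]] by simp

lemma log_harmonic_const: "log_harmonic 0 (\<lambda>_. t) t K"
proof -
  have "harmonic_at (\<lambda>w. if w = 0 then t else t + 0 * ln (norm w)) 0"
    using harmonic_at_const[of t 0] by (simp cong: if_cong)
  thus ?thesis unfolding log_harmonic_def using harmonic_at_const by blast
qed

lemma log_harmonic_sum:
  assumes "\<And>i. i \<in> A \<Longrightarrow> log_harmonic 0 (u i) (L i) K"
  shows "log_harmonic 0 (\<lambda>z. \<Sum>i\<in>A. u i z) (\<Sum>i\<in>A. L i) K"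
  using assms
proof (induction A rule: infinite_finite_induct)
  case (insert i A)
  thus ?case using log_harmonic_add[of 0 "u i" "L i" K 0] by simp
qed (auto intro: log_harmonic_const)

lemma log_harmonic_mono: "log_harmonic \<kappa> u L K \<Longrightarrow> K \<subseteq> K' \<Longrightarrow> log_harmonic \<kappa> u L K'"
  unfolding log_harmonic_def by blast

lemma log_harmonic_tendsto:
  assumes "log_harmonic \<kappa> u L K"
  shows "((\<lambda>z. u z - \<kappa> * ln (norm z)) \<longlongrightarrow> L) at_infinity"
proof -
  have "isCont (\<lambda>w. if w = 0 then L else u (1 / w) + \<kappa> * ln (norm w)) 0"
    using assms harmonic_at_isCont unfolding log_harmonic_def by blast
  hence "((\<lambda>w. if w = 0 then L else u (1 / w) + \<kappa> * ln (norm w)) \<longlongrightarrow> L) (at 0)"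
    by (simp add: isCont_def)
  hence "((\<lambda>w. u (inverse w) - \<kappa> * ln (norm (inverse w))) \<longlongrightarrow> L) (at 0)"
    by (rule Lim_transform_eventually) (auto simp: eventually_at_filter norm_inverse ln_inverse inverse_eq_divide[symmetric])
  from this[unfolded at_to_infinity filterlim_filtermap] show ?thesis by simp
qed

lemma has_integral_circle_reflect:
  assumes "((\<lambda>t. f (cis t)) has_integral I) {0..2*pi}"
  shows "((\<lambda>t. f (cis (- t)) :: real) has_integral I) {0..2*pi}"
proof -
  have "((\<lambda>t. f (cis (- 1 * t + 2 * pi))) has_integral I) {0..2*pi}"
    using has_integral_affinity[of "\<lambda>t. f (cis t)" I 0 "2*pi" "-1" "2*pi"] assms
    by (simp add: image_affinity_atLeastAtMost)
  moreover have "cis (2*pi - t) = cis (- t)" for t by (simp add: complex_eq_iff)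
  ultimately show ?thesis by simp
qed

text \<open>Inversion maps the circle of radius \<open>r\<close> to that of radius
  \<open>1 / r\<close> and reverses its direction, which the reflection undoes.\<close>

lemma mean_inf_chart:
  assumes "((\<lambda>t. u (1 / (of_real r * cis t)) :: real) has_integral I) {0..2*pi}"
  shows "((\<lambda>t. u (of_real (1 / r) * cis t)) has_integral I) {0..2*pi}"
proof -
  have "1 / (of_real r * cis (- t)) = of_real (1 / r) * cis t" for t
    by (simp add: divide_inverse)
  thus ?thesis using has_integral_circle_reflect[of "\<lambda>c. u (1 / (of_real r * c))", OF assms] by simp
qed

text \<open>The mean value property at 0 in the coordinate \<open>1 / z\<close>. It is an identity
  on every large circle and not merely asymptotic; because of this exactness the mean of
  \<open>G - T - \<gamma>\<close> will be zero.\<close>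

lemma log_harmonic_mean_infinity:
  assumes "log_harmonic \<kappa> u L K"
  shows "\<forall>\<^sub>F \<rho> in at_top. ((\<lambda>t. u (of_real \<rho> * cis t)) has_integral 2 * pi * (L + \<kappa> * ln \<rho>)) {0..2*pi}"
proof -
  let ?f = "\<lambda>w. if w = 0 then L else u (1 / w) + \<kappa> * ln (norm w)"
  have "harmonic_at ?f 0" using assms by (simp add: log_harmonic_def)
  from harmonic_at_eventually[OF this] obtain d where d: "d > 0" "\<And>w. dist w 0 < d \<Longrightarrow> harmonic_at ?f w"
    unfolding eventually_nhds_metric by blast
  have "((\<lambda>t. u (of_real \<rho> * cis t)) has_integral 2 * pi * (L + \<kappa> * ln \<rho>)) {0..2*pi}"
    if "\<rho> > 1 / d" "\<rho> > 0" for \<rho>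
  proof -
    have r: "1 / \<rho> > 0" "1 / \<rho> < d" using that d(1) by (auto simp: field_simps)
    have "((\<lambda>t. ?f (0 + of_real (1 / \<rho>) * cis t)) has_integral 2 * pi * ?f 0) {0..2*pi}"
      using r d(2) by (intro harmonic_mean_value) auto
    hence "((\<lambda>t. u (1 / (of_real (1 / \<rho>) * cis t)) - \<kappa> * ln \<rho>) has_integral 2 * pi * L) {0..2*pi}"
      using that by (simp add: norm_mult norm_divide ln_div cong: if_cong)
    from has_integral_add[OF this has_integral_const_real[of "\<kappa> * ln \<rho>" 0 "2*pi"]]
    have "((\<lambda>t. u (1 / (of_real (1 / \<rho>) * cis t))) has_integral 2 * pi * (L + \<kappa> * ln \<rho>)) {0..2*pi}"
      by (simp add: algebra_simps)
    from mean_inf_chart[OF this] show ?thesis by simp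
  qed
  thus ?thesis
    by (intro eventually_mono[OF eventually_conj[OF eventually_gt_at_top[of "1/d"] eventually_gt_at_top[of 0]]]) auto
qed

text \<open>The boundary condition is one-sided and does not ask for a limit, because later
  competitors have a logarithmic pole or are only known to be bounded near a part of the
  boundary.\<close>

lemma log_harmonic_max_principle:
  assumes K: "compact K" "K \<noteq> {}" and u: "log_harmonic 0 u L K"
    and bd: "\<And>\<zeta> \<epsilon>. \<zeta> \<in> K \<Longrightarrow> \<epsilon> > 0 \<Longrightarrow> \<forall>\<^sub>F w in at \<zeta> within -K. u w < \<epsilon>"
  shows "z \<notin> K \<Longrightarrow> u z \<le> 0" "L \<le> 0"
proof -
  have lim: "(u \<longlongrightarrow> L) at_infinity" using log_harmonic_tendsto[OF u] by simp
  have all: "u z \<le> 0" if "z \<notin> K" for z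
  proof (rule subharmonic_max_principle[OF K _ lim _ bd that])
    show "subharmonic_on u (- K)"
    proof (rule harmonic_at_imp_subharmonic_on)
      show "open (- K)" using K(1) by (simp add: compact_imp_closed open_Compl)
      show "harmonic_at u z" if "z \<in> - K" for z using u that unfolding log_harmonic_def by blast
    qed
    show "\<forall>\<^sub>F \<rho> in at_top. L \<le> 1 / (2 * pi) * integral {0..2 * pi} (\<lambda>t. u (of_real \<rho> * cis t))"
      using log_harmonic_mean_infinity[OF u] by eventually_elim (simp add: integral_unique)
  qed
  show "z \<notin> K \<Longrightarrow> u z \<le> 0" by (rule all)
  obtain R where R: "\<And>w. w \<in> K \<Longrightarrow> norm w \<le> R"
    using compact_imp_bounded[OF K(1)] unfolding bounded_iff by blast
  have "\<forall>\<^sub>F z in at_infinity. u z \<le> 0"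
    unfolding eventually_at_infinity
  proof (intro exI allI impI)
    fix z :: complex assume "R + 1 \<le> norm z"
    thus "u z \<le> 0" using R[of z] by (intro all) auto
  qed
  thus "L \<le> 0" using tendsto_upperbound[OF lim] trivial_limit_at_infinity by blast
qed

lemma log_harmonic_le:
  assumes K: "compact K" "K \<noteq> {}" and u: "log_harmonic 0 u L K" "log_harmonic 0 v M K"
    and bd: "\<And>\<zeta> \<epsilon>. \<zeta> \<in> K \<Longrightarrow> \<epsilon> > 0 \<Longrightarrow> \<forall>\<^sub>F w in at \<zeta> within -K. u w < v w + \<epsilon>"
  shows "z \<notin> K \<Longrightarrow> u z \<le> v z" "L \<le> M"
proof -
  have d: "log_harmonic 0 (\<lambda>z. u z - v z) (L - M) K" using log_harmonic_diff[OF u] by simp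
  have b: "\<forall>\<^sub>F w in at \<zeta> within -K. u w - v w < \<epsilon>" if "\<zeta> \<in> K" "\<epsilon> > 0" for \<zeta> \<epsilon>
    using bd[OF that] by eventually_elim simp
  show "u z \<le> v z" if "z \<notin> K"
    using log_harmonic_max_principle(1)[OF K d b that] by simp
  show "L \<le> M" using log_harmonic_max_principle(2)[OF K d b] by simp
qed

lemma log_harmonic_le_boundary:
  assumes K: "compact K" "K \<noteq> {}" and u: "log_harmonic 0 u L K" "log_harmonic 0 v M K"
    and bd: "\<And>\<zeta>. \<zeta> \<in> K \<Longrightarrow> (u \<longlongrightarrow> f \<zeta>) (at \<zeta> within -K)" "\<And>\<zeta>. \<zeta> \<in> K \<Longrightarrow> (v \<longlongrightarrow> g \<zeta>) (at \<zeta> within -K)"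
      "\<And>\<zeta>. \<zeta> \<in> K \<Longrightarrow> f \<zeta> \<le> g \<zeta>"
  shows "z \<notin> K \<Longrightarrow> u z \<le> v z" "L \<le> M"
proof -
  have b: "\<forall>\<^sub>F w in at \<zeta> within -K. u w < v w + \<epsilon>" if "\<zeta> \<in> K" "\<epsilon> > 0" for \<zeta> \<epsilon>
  proof -
    have "\<forall>\<^sub>F w in at \<zeta> within -K. u w - v w < \<epsilon>"
      by (rule order_tendstoD(2)[OF tendsto_diff[OF bd(1,2)[OF that(1)]]]) (use bd(3)[OF that(1)] that(2) in linarith)
    thus ?thesis by eventually_elim simp
  qed
  show "u z \<le> v z" if "z \<notin> K" by (rule log_harmonic_le(1)[OF K u b that])
  show "L \<le> M" by (rule log_harmonic_le(2)[OF K u b])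
qed

lemma log_harmonic_unique:
  assumes K: "compact K" "K \<noteq> {}" and u: "log_harmonic 0 u L K" "log_harmonic 0 v M K"
    and bd: "\<And>\<zeta>. \<zeta> \<in> K \<Longrightarrow> (u \<longlongrightarrow> f \<zeta>) (at \<zeta> within -K)" "\<And>\<zeta>. \<zeta> \<in> K \<Longrightarrow> (v \<longlongrightarrow> f \<zeta>) (at \<zeta> within -K)"
  shows "z \<notin> K \<Longrightarrow> u z = v z" "L = M"
proof -
  show "u z = v z" if "z \<notin> K"
    using log_harmonic_le_boundary(1)[OF K u bd order_refl that]
      log_harmonic_le_boundary(1)[OF K u(2,1) bd(2,1) order_refl that] by simp
  show "L = M"
    using log_harmonic_le_boundary(2)[OF K u bd order_refl]
      log_harmonic_le_boundary(2)[OF K u(2,1) bd(2,1) order_refl] by simp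
qed

section \<open>The complement of an interval\<close>

definition seg :: "real \<Rightarrow> real \<Rightarrow> complex set" where
  "seg \<alpha> \<beta> = complex_of_real ` {\<alpha>..\<beta>}"

lemma mem_seg_iff: "z \<in> seg \<alpha> \<beta> \<longleftrightarrow> Im z = 0 \<and> \<alpha> \<le> Re z \<and> Re z \<le> \<beta>"
  unfolding seg_def by (auto simp: complex_eq_iff image_iff intro!: bexI[of _ "Re z"])

lemma of_real_mem_seg [simp]: "complex_of_real x \<in> seg \<alpha> \<beta> \<longleftrightarrow> \<alpha> \<le> x \<and> x \<le> \<beta>"
  by (simp add: mem_seg_iff)

lemma compact_seg: "compact (seg \<alpha> \<beta>)"
  unfolding seg_def by (intro compact_continuous_image continuous_intros) auto

text \<open>The branch of \<open>sqrt ((z - \<alpha>) (z - \<beta>))\<close> that is cut along the interval and asymptotic to \<open>z\<close> at infinity.\<close>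

definition interval_sqrt :: "real \<Rightarrow> real \<Rightarrow> complex \<Rightarrow> complex" where
  "interval_sqrt \<alpha> \<beta> z =
     (z - of_real ((\<alpha> + \<beta>) / 2)) * csqrt (1 - (of_real ((\<beta> - \<alpha>) / 2) / (z - of_real ((\<alpha> + \<beta>) / 2)))\<^sup>2)"

text \<open>The conformal map from the complement of the interval onto the exterior of the unit
  disc; the logarithm of its modulus is the Green's function with pole at infinity.\<close>

definition joukowski_inv :: "real \<Rightarrow> real \<Rightarrow> complex \<Rightarrow> complex" where
  "joukowski_inv \<alpha> \<beta> z = (z - of_real ((\<alpha> + \<beta>) / 2) + interval_sqrt \<alpha> \<beta> z) / of_real ((\<beta> - \<alpha>) / 2)"

definition joukowski :: "real \<Rightarrow> real \<Rightarrow> complex \<Rightarrow> complex" where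
  "joukowski \<alpha> \<beta> w = of_real ((\<alpha> + \<beta>) / 2) + of_real ((\<beta> - \<alpha>) / 2) * (w + 1 / w) / 2"

locale interval =
  fixes \<alpha> \<beta> :: real
  assumes less: "\<alpha> < \<beta>"
begin

abbreviation "mid \<equiv> (\<alpha> + \<beta>) / 2"
abbreviation "rad \<equiv> (\<beta> - \<alpha>) / 2"

lemma rad_pos: "rad > 0" using less by simp

lemma mid_plus_mem_seg: "\<bar>t\<bar> \<le> rad \<Longrightarrow> complex_of_real (mid + t) \<in> seg \<alpha> \<beta>"
  by (simp only: of_real_mem_seg) (auto simp: abs_le_iff field_simps)

text \<open>If the radicand \<open>1 - q^2\<close> is real and nonpositive, then \<open>q\<close> is
  real with modulus at least 1, and \<open>z = mid + rad / q\<close> lies in the interval.\<close>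

lemma radicand_off_cut:
  assumes "z \<notin> seg \<alpha> \<beta>"
  shows "z \<noteq> of_real mid" "1 - (of_real rad / (z - of_real mid))\<^sup>2 \<notin> \<real>\<^sub>\<le>\<^sub>0"
proof -
  have "complex_of_real mid \<in> seg \<alpha> \<beta>" using less by (simp only: of_real_mem_seg) simp
  thus ne: "z \<noteq> of_real mid" using assms by metis
  show "1 - (of_real rad / (z - of_real mid))\<^sup>2 \<notin> \<real>\<^sub>\<le>\<^sub>0"
  proof
    define q where "q = of_real rad / (z - of_real mid)"
    assume "1 - (of_real rad / (z - of_real mid))\<^sup>2 \<in> \<real>\<^sub>\<le>\<^sub>0"
    then obtain t where t: "1 - q\<^sup>2 = of_real t" "t \<le> 0"
      unfolding q_def by (elim nonpos_Reals_cases) auto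
    have "q\<^sup>2 = (of_real (sqrt (1 - t)))\<^sup>2"
      using t by (simp flip: of_real_power) (simp add: algebra_simps)
    hence "q = of_real (sqrt (1 - t)) \<or> q = - of_real (sqrt (1 - t))"
      by (simp only: power2_eq_iff)
    then obtain s :: real where s: "q = of_real s" "\<bar>s\<bar> \<ge> 1"
    proof
      assume "q = of_real (sqrt (1 - t))" thus ?thesis using t(2) by (intro that[of "sqrt (1 - t)"]) auto
    next
      assume "q = - of_real (sqrt (1 - t))" thus ?thesis using t(2) by (intro that[of "- sqrt (1 - t)"]) auto
    qed
    have s0: "s \<noteq> 0" using s(2) by auto
    have "of_real rad / (z - of_real mid) = of_real s" using s(1) by (simp only: q_def)
    moreover have "a / d = b \<Longrightarrow> d \<noteq> 0 \<Longrightarrow> b \<noteq> 0 \<Longrightarrow> d = a / b" for a b d :: complex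
      by (auto simp: field_simps)
    ultimately have "z - of_real mid = of_real rad / of_real s" using ne s0 by (metis eq_iff_diff_eq_0 of_real_eq_0_iff)
    hence "z - of_real mid = of_real (rad / s)" by simp
    hence "z = of_real (mid + rad / s)" by (simp add: algebra_simps)
    moreover have "\<bar>rad / s\<bar> \<le> rad"
    proof -
      have "\<bar>rad / s\<bar> = rad / \<bar>s\<bar>" using less by simp
      also have "\<dots> \<le> rad / 1" using s(2) rad_pos by (intro divide_left_mono) auto
      finally show ?thesis by simp
    qed
    ultimately have "z \<in> seg \<alpha> \<beta>" by (simp only: mid_plus_mem_seg)
    thus False using assms by simp
  qed
qed

lemma interval_sqrt_holomorphic: "interval_sqrt \<alpha> \<beta> holomorphic_on - seg \<alpha> \<beta>"
  unfolding interval_sqrt_def using radicand_off_cut by (intro holomorphic_intros) auto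

lemma interval_sqrt_nonzero:
  assumes "z \<notin> seg \<alpha> \<beta>" shows "interval_sqrt \<alpha> \<beta> z \<noteq> 0"
proof -
  have "1 - (of_real rad / (z - of_real mid))\<^sup>2 \<noteq> 0" using radicand_off_cut(2)[OF assms] by auto
  thus ?thesis using radicand_off_cut(1)[OF assms] unfolding interval_sqrt_def by simp
qed

lemma interval_sqrt_cnj:
  assumes "z \<notin> seg \<alpha> \<beta>" shows "interval_sqrt \<alpha> \<beta> (cnj z) = cnj (interval_sqrt \<alpha> \<beta> z)"
proof -
  have "cnj (csqrt (1 - (of_real rad / (z - of_real mid))\<^sup>2)) = csqrt (cnj (1 - (of_real rad / (z - of_real mid))\<^sup>2))"
    by (rule cnj_csqrt[OF radicand_off_cut(2)[OF assms]])
  thus ?thesis unfolding interval_sqrt_def by (simp only: complex_cnj_mult complex_cnj_diff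
    complex_cnj_complex_of_real complex_cnj_one complex_cnj_power complex_cnj_divide)
qed

lemma joukowski_endpoints:
  assumes "w \<noteq> 0"
  shows "joukowski \<alpha> \<beta> w - of_real \<alpha> = of_real rad * (w + 1)\<^sup>2 / (2 * w)"
    "joukowski \<alpha> \<beta> w - of_real \<beta> = of_real rad * (w - 1)\<^sup>2 / (2 * w)"
  using assms unfolding joukowski_def by (simp_all add: field_simps power2_eq_square)

text \<open>Circles around 0 go to confocal ellipses with foci at the endpoints. This recovers the
  modulus of \<open>w\<close> from \<open>z\<close> without a choice of branch.\<close>

lemma joukowski_ellipse:
  assumes "w \<noteq> 0"
  shows "norm (joukowski \<alpha> \<beta> w - of_real \<alpha>) + norm (joukowski \<alpha> \<beta> w - of_real \<beta>) =
    rad * (norm w + 1 / norm w)"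
proof -
  have s: "(norm (w + 1))\<^sup>2 + (norm (w - 1))\<^sup>2 = 2 * (norm w)\<^sup>2 + 2"
    unfolding cmod_power2 by (simp add: power2_eq_square algebra_simps)
  have "norm (joukowski \<alpha> \<beta> w - of_real \<alpha>) + norm (joukowski \<alpha> \<beta> w - of_real \<beta>) =
     rad * ((norm (w + 1))\<^sup>2 + (norm (w - 1))\<^sup>2) / (2 * norm w)"
    unfolding joukowski_endpoints[OF assms] using rad_pos
    by (simp add: norm_mult norm_divide norm_power add_divide_distrib distrib_left del: of_real_divide of_real_diff)
  also have "\<dots> = rad * (norm w + 1 / norm w)"
    unfolding s using assms by (simp add: field_simps power2_eq_square)
  finally show ?thesis .
qed

text \<open>On the interval the sum of the focal distances takes its minimum \<open>2 * rad\<close>,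
  which forces \<open>|w| + 1 / |w| = 2\<close>.\<close>

lemma joukowski_notin_seg:
  assumes "norm w > 1" shows "joukowski \<alpha> \<beta> w \<notin> seg \<alpha> \<beta>"
proof
  assume "joukowski \<alpha> \<beta> w \<in> seg \<alpha> \<beta>"
  then obtain x where x: "joukowski \<alpha> \<beta> w = of_real x" "\<alpha> \<le> x" "x \<le> \<beta>" unfolding seg_def by auto
  have w0: "w \<noteq> 0" using assms by auto
  have "norm (joukowski \<alpha> \<beta> w - of_real \<alpha>) + norm (joukowski \<alpha> \<beta> w - of_real \<beta>) = 2 * rad"
    unfolding x(1) of_real_diff[symmetric] norm_of_real using x by simp
  hence "rad * (norm w + 1 / norm w) = rad * 2"
    unfolding joukowski_ellipse[OF w0] by simp
  hence "norm w + 1 / norm w = 2" using rad_pos by (simp only: mult_cancel_left) auto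
  hence "(norm w + 1 / norm w) * norm w = 2 * norm w" by simp
  hence "norm w * norm w + 1 = 2 * norm w" using w0 by (simp add: distrib_right)
  hence "(norm w - 1)\<^sup>2 = 0" by (simp add: power2_eq_square algebra_simps)
  thus False using assms by simp
qed

text \<open>The radicand is the square of \<open>q = (w^2 - 1) / (w^2 + 1)\<close>, and
  \<open>Re q > 0\<close> because \<open>|w^2| > 1\<close>; so \<open>q\<close> is its principal
  root.\<close>

lemma interval_sqrt_joukowski:
  assumes "norm w > 1"
  shows "interval_sqrt \<alpha> \<beta> (joukowski \<alpha> \<beta> w) = of_real rad * (w - 1 / w) / 2"
proof -
  have w0: "w \<noteq> 0" using assms by auto
  have w2: "w\<^sup>2 + 1 \<noteq> 0"
  proof
    assume "w\<^sup>2 + 1 = 0"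
    hence "w\<^sup>2 = -1" by (simp add: add_eq_0_iff2)
    hence "norm (w\<^sup>2) = 1" by simp
    thus False using one_less_power[OF assms, of 2] by (simp add: norm_power)
  qed
  define q where "q = (w\<^sup>2 - 1) / (w\<^sup>2 + 1)"
  have c: "joukowski \<alpha> \<beta> w - of_real mid = of_real rad * (w\<^sup>2 + 1) / (2 * w)"
    unfolding joukowski_def using w0 by (simp add: field_simps power2_eq_square)
  have "1 - (of_real rad / (joukowski \<alpha> \<beta> w - of_real mid))\<^sup>2 = 1 - (2 * w / (w\<^sup>2 + 1))\<^sup>2"
    unfolding c using rad_pos less w0 w2 by (simp del: of_real_divide of_real_diff)
  also have "\<dots> = q\<^sup>2" unfolding q_def using w2 by (simp add: divide_simps) algebra
  finally have e: "1 - (of_real rad / (joukowski \<alpha> \<beta> w - of_real mid))\<^sup>2 = q\<^sup>2" .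
  have "Re q > 0"
  proof -
    define a where "a = w\<^sup>2"
    have "norm a > 1" using assms by (simp add: a_def norm_power one_less_power)
    hence "(Re a)\<^sup>2 + (Im a)\<^sup>2 > 1" unfolding cmod_power2[symmetric] by (simp add: one_less_power)
    moreover have "(Re (a + 1))\<^sup>2 + (Im (a + 1))\<^sup>2 > 0"
      using w2 unfolding a_def[symmetric] cmod_power2[symmetric] by simp
    ultimately show ?thesis unfolding q_def a_def[symmetric]
      by (simp add: Re_divide) (simp add: zero_less_divide_iff power2_eq_square algebra_simps)
  qed
  hence "csqrt (q\<^sup>2) = q" by (intro csqrt_square) auto
  hence "interval_sqrt \<alpha> \<beta> (joukowski \<alpha> \<beta> w) = of_real rad * (w\<^sup>2 + 1) / (2 * w) * q"
    unfolding interval_sqrt_def e by (simp only: c)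
  also have "\<dots> = of_real rad * (w - 1 / w) / 2"
    unfolding q_def using w0 w2 by (simp add: divide_simps power2_eq_square del: of_real_divide of_real_diff)
  finally show ?thesis .
qed

lemma joukowski_inv_joukowski:
  assumes "norm w > 1" shows "joukowski_inv \<alpha> \<beta> (joukowski \<alpha> \<beta> w) = w"
proof -
  have "joukowski_inv \<alpha> \<beta> (joukowski \<alpha> \<beta> w) =
     (of_real rad * (w + 1 / w) / 2 + of_real rad * (w - 1 / w) / 2) / of_real rad"
    unfolding joukowski_inv_def interval_sqrt_joukowski[OF assms] by (simp add: joukowski_def)
  also have "of_real rad * (w + 1 / w) / 2 + of_real rad * (w - 1 / w) / 2 = of_real rad * w"
    by (simp add: add_divide_distrib[symmetric] distrib_left[symmetric] del: of_real_divide of_real_diff)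
  finally show ?thesis using less by (simp del: of_real_divide of_real_diff)
qed

text \<open>The quadratic equation for \<open>w\<close> has roots \<open>w\<close> and
  \<open>1 / w\<close>. One of them lies outside the unit circle unless both lie on it, and in that
  case \<open>z\<close> is in the interval.\<close>

lemma joukowski_surj:
  assumes "z \<notin> seg \<alpha> \<beta>"
  obtains w where "norm w > 1" "joukowski \<alpha> \<beta> w = z"
proof -
  define y where "y = (z - of_real mid) / of_real rad"
  define w where "w = y + csqrt (y\<^sup>2 - 1)"
  have "(w - y)\<^sup>2 = y\<^sup>2 - 1" by (simp add: w_def)
  hence e: "w * (2 * y - w) = 1" by (simp add: power2_eq_square algebra_simps)
  hence w0: "w \<noteq> 0" by auto
  have "1 / w = 2 * y - w" using e w0 by (simp add: field_simps)
  hence y: "y = (w + 1 / w) / 2" by simp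
  have "z = of_real mid + of_real rad * y" unfolding y_def using rad_pos less by (simp del: of_real_divide of_real_diff)
  hence z: "joukowski \<alpha> \<beta> w = z" unfolding joukowski_def y by simp
  have zi: "joukowski \<alpha> \<beta> (1 / w) = z" unfolding z[symmetric] joukowski_def by simp
  consider "norm w > 1" | "norm w < 1" | "norm w = 1" by linarith
  thus ?thesis
  proof cases
    case 1 thus ?thesis using z that by blast
  next
    case 2
    hence "norm (1 / w) > 1" using w0 by (simp add: norm_divide)
    thus ?thesis using zi that by blast
  next
    case 3
    hence "1 / w = cnj w" by (simp add: divide_conv_cnj)
    hence "z = of_real (mid + rad * Re w)"
      unfolding z[symmetric] joukowski_def by (simp add: complex_add_cnj)
    moreover have "\<bar>rad * Re w\<bar> \<le> rad"
      using abs_Re_le_cmod[of w] 3 rad_pos by (simp add: abs_mult)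
    ultimately have "z \<in> seg \<alpha> \<beta>" by (simp only: mid_plus_mem_seg)
    thus ?thesis using assms by simp
  qed
qed

lemma norm_joukowski_inv_gt_1: "z \<notin> seg \<alpha> \<beta> \<Longrightarrow> norm (joukowski_inv \<alpha> \<beta> z) > 1"
  by (metis joukowski_surj joukowski_inv_joukowski)

text \<open>\<open>w * interval_sqrt \<alpha> \<beta> (1 / w)\<close> extends analytically to
  \<open>w = 0\<close> with value 1, since the branch behaves like \<open>z\<close> at
  infinity.\<close>

lemma interval_sqrt_infinity:
  obtains r \<sigma> where "r > 0" "\<sigma> holomorphic_on ball 0 r" "\<sigma> 0 = 1" "\<And>w. w \<in> ball 0 r \<Longrightarrow> \<sigma> w \<noteq> 0"
    "\<And>w. w \<in> ball 0 r - {0} \<Longrightarrow> 1 / w \<notin> seg \<alpha> \<beta> \<and> interval_sqrt \<alpha> \<beta> (1 / w) = \<sigma> w / w"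
proof -
  define g where "g = (\<lambda>w. 1 - (of_real rad * w / (1 - of_real mid * w))\<^sup>2 :: complex)"
  define \<sigma> where "\<sigma> = (\<lambda>w. (1 - of_real mid * w) * csqrt (g w))"
  define M where "M = \<bar>\<alpha>\<bar> + \<bar>\<beta>\<bar> + 1"
  have M: "M > 0" by (simp add: M_def)
  have out: "1 / w \<notin> seg \<alpha> \<beta>" if "w \<in> ball 0 (1 / M) - {0}" for w
  proof
    assume "1 / w \<in> seg \<alpha> \<beta>"
    then obtain x where x: "1 / w = of_real x" "\<alpha> \<le> x" "x \<le> \<beta>" unfolding seg_def by auto
    have "1 / norm w = \<bar>x\<bar>" using arg_cong[OF x(1), of norm] by (simp add: norm_divide)
    moreover have "1 / norm w > M" using that M by (simp add: field_simps)
    ultimately show False using x by (auto simp: M_def)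
  qed
  \<comment> \<open>If \<open>1 / w\<close> is the midpoint, both denominators vanish and both
    quotients are 0 by the convention for division.\<close>
  have eq: "w \<noteq> 0 \<Longrightarrow> of_real rad / (1 / w - of_real mid) = of_real rad * w / (1 - of_real mid * w)" for w :: complex
    by (cases "1 / w - of_real mid = 0") (auto simp: divide_simps)
  have g: "1 - of_real mid * w \<noteq> 0 \<and> g w \<notin> \<real>\<^sub>\<le>\<^sub>0" if "w \<in> ball 0 (1 / M)" for w
  proof (cases "w = 0")
    case False
    hence o: "1 / w \<notin> seg \<alpha> \<beta>" using out that by auto
    have "1 - of_real mid * w = (1 / w - of_real mid) * w" using False by (simp add: field_simps)
    hence "1 - of_real mid * w \<noteq> 0" using radicand_off_cut(1)[OF o] False by simp
    thus ?thesis using radicand_off_cut(2)[OF o] unfolding g_def eq[OF False] by simp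
  qed (simp add: g_def)
  show ?thesis
  proof (rule that)
    show "1 / M > 0" using M by simp
    show "\<sigma> holomorphic_on ball 0 (1 / M)"
      unfolding \<sigma>_def using g unfolding g_def by (intro holomorphic_intros) auto
    show "\<sigma> 0 = 1" by (simp add: \<sigma>_def g_def)
    show "\<sigma> w \<noteq> 0" if "w \<in> ball 0 (1 / M)" for w
      using g[OF that] by (auto simp: \<sigma>_def)
    show "1 / w \<notin> seg \<alpha> \<beta> \<and> interval_sqrt \<alpha> \<beta> (1 / w) = \<sigma> w / w" if w: "w \<in> ball 0 (1 / M) - {0}" for w
    proof
      have w0: "w \<noteq> 0" using w by simp
      show "1 / w \<notin> seg \<alpha> \<beta>" by (rule out[OF w])
      have "1 / w - of_real mid = (1 - of_real mid * w) / w" using w0 by (simp add: field_simps)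
      thus "interval_sqrt \<alpha> \<beta> (1 / w) = \<sigma> w / w"
        unfolding interval_sqrt_def \<sigma>_def g_def eq[OF w0] by simp
    qed
  qed
qed

lemma joukowski_inv_holomorphic: "joukowski_inv \<alpha> \<beta> holomorphic_on - seg \<alpha> \<beta>"
  unfolding joukowski_inv_def using less by (intro holomorphic_intros interval_sqrt_holomorphic) auto

text \<open>At infinity \<open>joukowski_inv \<alpha> \<beta> z\<close> is asymptotic to
  \<open>2 * z / rad = 4 * z / (\<beta> - \<alpha>)\<close>, the origin of the constant: the
  capacity of an interval is a quarter of its length.\<close>

lemma interval_green_log_harmonic:
  "log_harmonic 1 (\<lambda>z. ln (norm (joukowski_inv \<alpha> \<beta> z))) (ln (4 / (\<beta> - \<alpha>))) (seg \<alpha> \<beta>)"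
  unfolding log_harmonic_def
proof (intro conjI ballI)
  fix z assume z: "z \<in> - seg \<alpha> \<beta>"
  have "open (- seg \<alpha> \<beta>)" using compact_seg by (simp add: compact_imp_closed open_Compl)
  hence "joukowski_inv \<alpha> \<beta> analytic_on {z}" using joukowski_inv_holomorphic z analytic_at by blast
  moreover have "joukowski_inv \<alpha> \<beta> z \<noteq> 0" using norm_joukowski_inv_gt_1[of z] z by auto
  ultimately show "harmonic_at (\<lambda>z. ln (norm (joukowski_inv \<alpha> \<beta> z))) z" by (rule harmonic_at_ln_norm)
next
  obtain r \<sigma> where r: "r > 0" "\<sigma> holomorphic_on ball 0 r" "\<sigma> 0 = 1" "\<And>w. w \<in> ball 0 r \<Longrightarrow> \<sigma> w \<noteq> 0"
    "\<And>w. w \<in> ball 0 r - {0} \<Longrightarrow> 1 / w \<notin> seg \<alpha> \<beta> \<and> interval_sqrt \<alpha> \<beta> (1 / w) = \<sigma> w / w"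
    by (rule interval_sqrt_infinity) blast
  define f where "f = (\<lambda>w. (1 - of_real mid * w + \<sigma> w) / of_real rad)"
  have "\<sigma> analytic_on {0}" using r(1,2) by (auto simp: analytic_at intro!: exI[of _ "ball 0 r"])
  hence "f analytic_on {0}" unfolding f_def using less by (intro analytic_intros) auto
  moreover have f0: "f 0 = 2 / of_real rad" by (simp add: f_def r)
  hence "f 0 \<noteq> 0" using less by simp
  ultimately have h: "harmonic_at (\<lambda>w. ln (norm (f w))) 0" by (rule harmonic_at_ln_norm)
  have "\<forall>\<^sub>F w in nhds 0. (if w = 0 then ln (4 / (\<beta> - \<alpha>)) else ln (norm (joukowski_inv \<alpha> \<beta> (1 / w))) + 1 * ln (norm w)) = ln (norm (f w))"
  proof (rule eventually_nhds_in_open[THEN eventually_mono])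
    show "open (ball (0::complex) r)" "0 \<in> ball (0::complex) r" using r by auto
    fix w :: complex assume w: "w \<in> ball 0 r"
    show "(if w = 0 then ln (4 / (\<beta> - \<alpha>)) else ln (norm (joukowski_inv \<alpha> \<beta> (1 / w))) + 1 * ln (norm w)) = ln (norm (f w))"
    proof (cases "w = 0")
      case True
      have "f 0 = of_real (4 / (\<beta> - \<alpha>))" unfolding f0 by simp
      thus ?thesis using True less by (simp del: of_real_divide of_real_diff)
    next
      case False
      hence o: "1 / w \<notin> seg \<alpha> \<beta>" "interval_sqrt \<alpha> \<beta> (1 / w) = \<sigma> w / w" using r(5)[of w] w by auto
      have "f w = joukowski_inv \<alpha> \<beta> (1 / w) * w"
      proof -
        have gen: "(1 - a * w + b) / R = (1 / w - a + b / w) / R * w" for a b R :: complex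
          using False by (simp add: distrib_right left_diff_distrib)
        show ?thesis unfolding joukowski_inv_def o(2) f_def by (rule gen)
      qed
      moreover have "joukowski_inv \<alpha> \<beta> (1 / w) \<noteq> 0"
        using norm_joukowski_inv_gt_1[OF o(1)] by auto
      ultimately show ?thesis using False by (simp add: norm_mult ln_mult)
    qed
  qed
  from harmonic_at_cong[OF this] h
  show "harmonic_at (\<lambda>w. if w = 0 then ln (4 / (\<beta> - \<alpha>)) else ln (norm (joukowski_inv \<alpha> \<beta> (1 / w))) + 1 * ln (norm w)) 0"
    by (rule iffD2)
qed

end

section \<open>Potentials of real differentials\<close>

lemma has_derivative_ln_norm:
  assumes "z \<noteq> (0::complex)"
  shows "((\<lambda>w. ln (norm w)) has_derivative (\<lambda>h. Re (1 / z * h))) (at z)"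
proof -
  have "((\<lambda>w. Re (Ln (w / z)) + ln (norm z)) has_derivative (\<lambda>h. Re (1 / z * h))) (at z)"
  proof -
    have "((\<lambda>w. Ln (w / z)) has_field_derivative 1 / z) (at z)"
      using assms by (auto intro!: derivative_eq_intros simp: field_simps)
    hence "((\<lambda>w. Ln (w / z)) has_derivative (\<lambda>h. 1 / z * h)) (at z)"
      by (simp only: has_field_derivative_def)
    from has_derivative_add[OF has_derivative_Re[OF this] has_derivative_const[of "ln (norm z)"]]
    show ?thesis by simp
  qed
  thus ?thesis
  proof (rule has_derivative_transform_within[of _ _ _ _ "norm z"])
    fix w assume "dist w z < norm z"
    hence "w \<noteq> 0" by (auto simp: dist_norm)
    thus "Re (Ln (w / z)) + ln (norm z) = ln (norm w)" using assms by (simp add: norm_divide ln_div)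
  qed (use assms in auto)
qed

lemma gradient_compose:
  fixes u :: "complex \<Rightarrow> real"
  assumes "(u has_derivative (\<lambda>h. Re (D * h))) (at (f z))" "(f has_field_derivative f') (at z)"
  shows "((\<lambda>w. u (f w)) has_derivative (\<lambda>h. Re (D * f' * h))) (at z)"
  using has_derivative_compose[OF assms(2)[unfolded has_field_derivative_def] assms(1)]
  by (simp add: mult.assoc)

text \<open>The primitives of \<open>n\<close> on the starlike slit planes \<open>{Im z \<noteq> 0} \<union> ball x r\<close> are normalised to agree on
  the upper half plane. As \<open>n\<close> is real on the real axis, their real parts are then invariant under
  conjugation and fit together.\<close>

lemma potential_exists:
  assumes E: "compact E" "\<And>z. z \<in> E \<Longrightarrow> Im z = 0"
    and n: "n holomorphic_on - E" "\<And>z. z \<notin> E \<Longrightarrow> n (cnj z) = cnj (n z)"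
  obtains u where "\<And>z. z \<notin> E \<Longrightarrow> (u has_derivative (\<lambda>h. Re (n z * h))) (at z)"
proof -
  define H where "H = {z::complex. Im z > 0}"
  have H: "convex H" "open H" "H \<subseteq> - E" using E(2) unfolding H_def
    by (auto simp: convex_halfspace_Im_gt open_halfspace_Im_gt)
  obtain F where F: "\<And>z. z \<in> H \<Longrightarrow> (F has_field_derivative n z) (at z)"
    using holomorphic_convex_primitive'[OF H(1,2) holomorphic_on_subset[OF n(1) H(3)]]
      at_within_open[OF _ H(2)] by auto
  have "\<exists>r>0. ball z r \<subseteq> - E" if "z \<notin> E" for z
    using E(1) that open_contains_ball by (metis ComplI open_Compl compact_imp_closed)
  then obtain r where r: "\<And>z. z \<notin> E \<Longrightarrow> r z > 0" "\<And>z. z \<notin> E \<Longrightarrow> ball z (r z) \<subseteq> - E" by metis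
  define U where "U = (\<lambda>x. {z. Im z \<noteq> 0} \<union> ball x (r x))"
  have cnjE: "cnj z \<notin> E" if "z \<notin> E" for z
  proof
    assume "cnj z \<in> E"
    hence "cnj z = z" using E(2)[of "cnj z"] by (simp add: complex_eq_iff)
    thus False using \<open>cnj z \<in> E\<close> that by simp
  qed
  have US: "U x \<subseteq> - E" if "x \<notin> E" for x using E(2) r(2)[OF that] by (auto simp: U_def)
  have Uopen: "open (U x)" for x
  proof -
    have "{z. Im z \<noteq> 0} = {z::complex. Im z > 0} \<union> {z. Im z < 0}" by auto
    thus ?thesis unfolding U_def by (auto intro!: open_Un open_halfspace_Im_gt open_halfspace_Im_lt)
  qed
  \<comment> \<open>A segment from the real point \<open>x\<close> to a non-real point leaves the
    real axis at once and stays off it.\<close>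
  have seg_U: "closed_segment x z \<subseteq> U x" if "Im x = 0" "z \<in> U x" "r x > 0" for x z
  proof (cases "Im z = 0")
    case True
    hence "z \<in> ball x (r x)" using that(2) by (auto simp: U_def)
    hence "closed_segment x z \<subseteq> ball x (r x)" using that(3) by (intro closed_segment_subset) auto
    thus ?thesis by (auto simp: U_def)
  next
    case False
    show ?thesis
    proof
      fix w assume "w \<in> closed_segment x z"
      then obtain t where t: "w = (1 - t) *\<^sub>R x + t *\<^sub>R z" unfolding closed_segment_def by auto
      show "w \<in> U x"
      proof (cases "t = 0")
        case False
        hence "Im w \<noteq> 0" using t that(1) \<open>Im z \<noteq> 0\<close> by simp
        thus ?thesis by (simp add: U_def)
      qed (use t that(3) in \<open>simp add: U_def\<close>)
    qed
  qed
  have star: "starlike (U x)" if "x \<notin> E" "Im x = 0" for x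
    unfolding starlike_def
    using seg_U[OF that(2)] r(1)[OF that(1)] by (intro bexI[of _ x]) (auto simp: U_def)
  have "\<exists>G. (\<forall>z\<in>U x. (G has_field_derivative n z) (at z)) \<and> (\<forall>z\<in>H. G z = F z)"
    if x: "x \<notin> E" "Im x = 0" for x
  proof -
    have hol: "n holomorphic_on U x" using n(1) US[OF x(1)] by (rule holomorphic_on_subset)
    have fd: "n field_differentiable at z" if "z \<in> U x - {}" for z
      using holomorphic_on_imp_differentiable_at[OF hol Uopen] that by simp
    obtain G where G: "\<And>z. z \<in> U x \<Longrightarrow> (G has_field_derivative n z) (at z)"
      using holomorphic_starlike_primitive[OF holomorphic_on_imp_continuous_on[OF hol] star[OF x] Uopen finite.emptyI fd]
      by auto
    have HU: "H \<subseteq> U x" by (auto simp: H_def U_def)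
    have "((\<lambda>z. F z - G z) has_field_derivative 0) (at z within H)" if "z \<in> H" for z
      using DERIV_diff[OF F[OF that] G[of z]] HU that by (auto intro: has_field_derivative_at_within)
    from has_field_derivative_zero_constant[OF H(1) this]
    obtain k where k: "\<And>z. z \<in> H \<Longrightarrow> F z - G z = k" by auto
    show ?thesis
    proof (intro exI[of _ "\<lambda>z. G z + k"] conjI ballI)
      show "((\<lambda>z. G z + k) has_field_derivative n z) (at z)" if "z \<in> U x" for z
        using G[OF that] by (auto intro!: derivative_eq_intros)
      show "G z + k = F z" if "z \<in> H" for z using k[OF that] by (simp add: algebra_simps)
    qed
  qed
  then obtain G where G: "\<And>x z. x \<notin> E \<Longrightarrow> Im x = 0 \<Longrightarrow> z \<in> U x \<Longrightarrow> (G x has_field_derivative n z) (at z)"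
    "\<And>x z. x \<notin> E \<Longrightarrow> Im x = 0 \<Longrightarrow> z \<in> H \<Longrightarrow> G x z = F z" by metis
  have Gcont: "isCont (G x) z" if "x \<notin> E" "Im x = 0" "z \<in> U x" for x z
    using G(1)[OF that] DERIV_isCont by blast
  \<comment> \<open>Conjugating \<open>G x\<close> on both sides gives another primitive of
    \<open>n\<close>, so it differs from \<open>G x\<close> by a constant. Evaluated at the real
    point \<open>x\<close>, this constant is purely imaginary.\<close>
  have Gsym: "Re (G x (cnj z)) = Re (G x z)" if x: "x \<notin> E" "Im x = 0" "z \<in> U x" for x z
  proof -
    have cU: "cnj z \<in> U x" if "z \<in> U x" for z
    proof -
      have "dist x (cnj z) = dist x z"
        using x(2) by (simp add: dist_norm cmod_def)
      thus ?thesis using that by (auto simp: U_def)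
    qed
    have der: "((\<lambda>z. cnj (G x (cnj z)) - G x z) has_field_derivative 0) (at w within U x)" if w: "w \<in> U x" for w
    proof -
      have "((cnj \<circ> G x \<circ> cnj) has_field_derivative cnj (n (cnj w))) (at w)"
        using G(1)[OF x(1,2) cU[OF w]] by (rule has_field_derivative_cnj_cnj)
      moreover have "cnj (n (cnj w)) = n w" using n(2)[of w] US[OF x(1)] w by auto
      ultimately have "((\<lambda>z. cnj (G x (cnj z)) - G x z) has_field_derivative n w - n w) (at w)"
        using DERIV_diff G(1)[OF x(1,2) w] by (fastforce simp: o_def)
      thus ?thesis by (simp add: has_field_derivative_at_within)
    qed
    have "connected (U x)"
      by (rule starlike_imp_connected[OF star[OF x(1,2)]])
    hence "(\<lambda>z. cnj (G x (cnj z)) - G x z) constant_on U x"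
    proof (rule DERIV_zero_connected_constant_on[OF _ Uopen finite.emptyI])
      show "continuous_on (U x) (\<lambda>z. cnj (G x (cnj z)) - G x z)"
        unfolding continuous_on_eq_continuous_within using DERIV_continuous[OF der] by blast
      show "\<forall>w\<in>U x - {}. ((\<lambda>z. cnj (G x (cnj z)) - G x z) has_field_derivative 0) (at w)"
        using der at_within_open[OF _ Uopen[of x]] by simp
    qed
    moreover have "x \<in> U x" using r(1)[OF x(1)] by (simp add: U_def)
    ultimately have "cnj (G x (cnj z)) - G x z = cnj (G x (cnj x)) - G x x"
      using x(3) unfolding constant_on_def by metis
    moreover have "cnj x = x" using x(2) by (simp add: complex_eq_iff)
    ultimately show ?thesis by (simp add: complex_eq_iff)
  qed
  define u where "u = (\<lambda>z. if Im z > 0 then Re (F z) else if Im z < 0 then Re (F (cnj z)) else Re (G z z))"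
  have ux: "u z = Re (G x z)" if x: "x \<notin> E" "Im x = 0" "z \<in> U x" for x z
  proof -
    consider "Im z > 0" | "Im z < 0" | "Im z = 0" by linarith
    thus ?thesis
    proof cases
      case 1
      thus ?thesis using G(2)[OF x(1,2), of z] by (simp add: u_def H_def)
    next
      case 2
      thus ?thesis using G(2)[OF x(1,2), of "cnj z"] Gsym[OF x] by (simp add: u_def H_def)
    next
      case 3
      have zE: "z \<notin> E" using US[OF x(1)] x(3) by blast
      have zU: "z \<in> U z" using r(1)[OF zE] by (simp add: U_def)
      \<comment> \<open>\<open>G z\<close> and \<open>G x\<close> agree on the upper half plane;
        approaching the real point \<open>z\<close> from above transfers this to \<open>z\<close>
        itself.\<close>
      define p where "p = (\<lambda>k. z + \<i> * of_real (inverse (real (Suc k))))"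
      have "(\<lambda>k. z + \<i> * of_real (inverse (real (Suc k)))) \<longlonglongrightarrow> z + \<i> * of_real 0"
        by (intro tendsto_intros LIMSEQ_inverse_real_of_nat)
      hence p: "p \<longlonglongrightarrow> z" by (simp add: p_def)
      have pH: "p k \<in> H" for k using 3 by (simp add: p_def H_def)
      have "(\<lambda>k. G z (p k)) \<longlonglongrightarrow> G z z" "(\<lambda>k. G x (p k)) \<longlonglongrightarrow> G x z"
        using isCont_tendsto_compose[OF Gcont[OF zE 3 zU] p] isCont_tendsto_compose[OF Gcont[OF x] p] .
      moreover have "(\<lambda>k. G z (p k)) = (\<lambda>k. G x (p k))"
        using G(2)[OF zE 3 pH] G(2)[OF x(1,2) pH] by simp
      ultimately have "G z z = G x z" using LIMSEQ_unique by metis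
      thus ?thesis using 3 by (simp add: u_def)
    qed
  qed
  have "(u has_derivative (\<lambda>h. Re (n z * h))) (at z)" if z: "z \<notin> E" for z
  proof -
    obtain x where x: "x \<notin> E" "Im x = 0" "z \<in> U x"
    proof (cases "Im z = 0")
      case True thus ?thesis using z r(1)[OF z] by (intro that[of z]) (auto simp: U_def)
    next
      case False
      \<comment> \<open>A non-real \<open>z\<close> belongs to every slit plane, so any real centre
        outside the bounded set \<open>E\<close> will do.\<close>
      obtain R where R: "\<And>w. w \<in> E \<Longrightarrow> norm w \<le> R"
        using compact_imp_bounded[OF E(1)] unfolding bounded_iff by blast
      have "complex_of_real (\<bar>R\<bar> + 1) \<notin> E"
        using R[of "complex_of_real (\<bar>R\<bar> + 1)"] unfolding norm_of_real by auto
      thus ?thesis using False by (intro that[of "of_real (\<bar>R\<bar> + 1)"]) (auto simp: U_def)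
    qed
    have "((\<lambda>z. Re (G x z)) has_derivative (\<lambda>h. Re (n z * h))) (at z)"
      using G(1)[OF x] by (intro has_derivative_Re) (simp add: has_field_derivative_def)
    thus ?thesis
      by (rule has_derivative_transform_within_open[OF _ Uopen x(3)]) (use ux[OF x(1,2)] in simp)
  qed
  thus ?thesis using that by blast
qed

text \<open>In \<open>w = 1 / z\<close> the differential \<open>n dz\<close> becomes
  \<open>- \<tau> w / w dw\<close>. Its residue \<open>- \<kappa>\<close> is real and accounts for
  the term \<open>- \<kappa> * ln (norm w)\<close>; the remainder \<open>k\<close> is holomorphic
  and has a primitive.\<close>

lemma potential_log_harmonic:
  assumes E: "compact E"
    and n: "n holomorphic_on - E"
    and u: "\<And>z. z \<notin> E \<Longrightarrow> (u has_derivative (\<lambda>h. Re (n z * h))) (at z)"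
    and \<tau>: "r > 0" "\<tau> holomorphic_on ball 0 r" "\<tau> 0 = of_real \<kappa>"
      "\<And>w. w \<in> ball 0 r - {0} \<Longrightarrow> 1 / w \<notin> E \<and> n (1 / w) = w * \<tau> w"
  obtains L where "log_harmonic \<kappa> u L E"
proof -
  define k where "k = (\<lambda>w. - (if w = 0 then deriv \<tau> 0 else (\<tau> w - \<tau> 0) / (w - 0)))"
  have "k holomorphic_on ball 0 r"
    unfolding k_def using pole_lemma_open[OF \<tau>(2) open_ball, of 0] by (intro holomorphic_intros) auto
  then obtain F where F: "\<And>w. w \<in> ball 0 r \<Longrightarrow> (F has_field_derivative k w) (at w)"
    using holomorphic_convex_primitive'[of "ball 0 r" k] at_within_open[of _ "ball (0::complex) r"] by auto
  define v where "v = (\<lambda>w. u (1 / w) + \<kappa> * ln (norm w))"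
  have v: "(v has_derivative (\<lambda>h. Re (k w * h))) (at w)" if w: "w \<in> ball 0 r - {0}" for w
  proof -
    have w0: "w \<noteq> 0" using w by simp
    have o: "1 / w \<notin> E" "n (1 / w) = w * \<tau> w" using \<tau>(4)[OF w] by auto
    have "((\<lambda>w. 1 / w) has_field_derivative (- 1 / w\<^sup>2)) (at w)"
      using w0 by (auto intro!: derivative_eq_intros simp: power2_eq_square)
    from gradient_compose[where f = "\<lambda>w. 1 / w", OF u[OF o(1)] this]
    have "((\<lambda>w. u (1 / w)) has_derivative (\<lambda>h. Re (n (1 / w) * (- 1 / w\<^sup>2) * h))) (at w)" .
    from has_derivative_add[OF this has_derivative_mult_right[OF has_derivative_ln_norm[OF w0], of \<kappa>]]
    have "(v has_derivative (\<lambda>h. Re (n (1 / w) * (- 1 / w\<^sup>2) * h) + \<kappa> * Re (1 / w * h))) (at w)"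
      unfolding v_def .
    moreover have "Re (n (1 / w) * (- 1 / w\<^sup>2) * h) + \<kappa> * Re (1 / w * h) = Re (k w * h)" for h
    proof -
      have "n (1 / w) * (- 1 / w\<^sup>2) * h + of_real \<kappa> * (1 / w * h) = k w * h"
        unfolding o(2) k_def using w0 \<tau>(3) by (simp add: field_simps power2_eq_square)
      moreover have "Re a + \<kappa> * Re y = Re (a + of_real \<kappa> * y)" for a y by simp
      ultimately show ?thesis by (simp only:)
    qed
    ultimately show ?thesis by simp
  qed
  have "(\<lambda>w. v w - Re (F w)) constant_on (ball 0 r - {0})"
  proof (rule has_derivative_zero_connected_constant_on[where K = "{}"])
    show "connected (ball (0::complex) r - {0})" by (intro connected_punctured_ball) simp
    show "open (ball (0::complex) r - {0})" by auto
    have d: "((\<lambda>w. v w - Re (F w)) has_derivative (\<lambda>h. 0)) (at w)" if w: "w \<in> ball 0 r - {0}" for w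
    proof -
      have "((\<lambda>z. Re (F z)) has_derivative (\<lambda>h. Re (k w * h))) (at w)"
        using F[of w] w by (intro has_derivative_Re) (simp add: has_field_derivative_def)
      from has_derivative_diff[OF v[OF w] this] show ?thesis by simp
    qed
    thus "\<forall>w\<in>ball 0 r - {0} - {}. ((\<lambda>w. v w - Re (F w)) has_derivative (\<lambda>h. 0)) (at w within ball 0 r - {0})"
      using has_derivative_at_withinI by blast
    show "continuous_on (ball 0 r - {0}) (\<lambda>w. v w - Re (F w))"
      using d has_derivative_continuous by (intro continuous_at_imp_continuous_on) blast
  qed auto
  then obtain c where c: "\<And>w. w \<in> ball 0 r - {0} \<Longrightarrow> v w - Re (F w) = c" unfolding constant_on_def by blast
  have "log_harmonic \<kappa> u (Re (F 0) + c) E" unfolding log_harmonic_def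
  proof (intro conjI ballI)
    show "harmonic_at u z" if "z \<in> - E" for z
      using harmonic_at_of_gradient[of "- E" n u z] E n u that by (auto simp: compact_imp_closed open_Compl)
    show "harmonic_at (\<lambda>w. if w = 0 then Re (F 0) + c else u (1 / w) + \<kappa> * ln (norm w)) 0"
      unfolding harmonic_at_iff_ball
    proof (intro exI conjI ballI)
      show "(\<lambda>w. F w + of_real c) holomorphic_on ball 0 r"
        using F by (intro holomorphic_intros) (meson field_differentiable_at_within field_differentiable_def holomorphic_onI)
      fix w assume "w \<in> ball (0::complex) r"
      thus "(if w = 0 then Re (F 0) + c else u (1 / w) + \<kappa> * ln (norm w)) = Re (F w + of_real c)"
        using c[of w] by (auto simp: v_def algebra_simps)
    qed (rule \<tau>(1))
  qed
  thus ?thesis using that by blast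
qed

text \<open>In the coordinate \<open>\<zeta>\<close> with \<open>z = joukowski (exp \<zeta>)\<close> the differential \<open>r dz / sqrt ((z - \<alpha>) (z - \<beta>))\<close>
  becomes \<open>r d\<zeta>\<close>, which has no singularity; its primitive has constant real part on the
  imaginary axis, the preimage of the interval.\<close>

lemma (in interval) boundary_constant:
  assumes V: "open V" "seg \<alpha> \<beta> \<subseteq> V" and r: "r holomorphic_on V"
    and real: "\<And>x. x \<in> seg \<alpha> \<beta> \<Longrightarrow> Im (r x) = 0"
    and u: "\<And>z. z \<in> V - seg \<alpha> \<beta> \<Longrightarrow>
      (u has_derivative (\<lambda>h. Re (r z / interval_sqrt \<alpha> \<beta> z * h))) (at z)"
  obtains k where "\<And>x. x \<in> seg \<alpha> \<beta> \<Longrightarrow> (u \<longlongrightarrow> k) (at x within - seg \<alpha> \<beta>)"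
proof -
  define Z where "Z = (\<lambda>\<zeta>. joukowski \<alpha> \<beta> (exp \<zeta>))"
  have Z': "(Z has_field_derivative of_real rad * (exp \<zeta> - 1 / exp \<zeta>) / 2) (at \<zeta>)" for \<zeta>
    unfolding Z_def joukowski_def
    by (auto intro!: derivative_eq_intros simp: field_simps power2_eq_square)
  have Zcont: "continuous_on UNIV Z"
    using Z' DERIV_isCont by (intro continuous_at_imp_continuous_on) blast
  have Zim: "Z \<zeta> \<in> seg \<alpha> \<beta>" if "Re \<zeta> = 0" for \<zeta>
  proof -
    have "norm (exp \<zeta>) = 1" using that by simp
    hence "1 / exp \<zeta> = cnj (exp \<zeta>)" by (simp add: divide_conv_cnj)
    hence "Z \<zeta> = of_real (mid + rad * Re (exp \<zeta>))"
      unfolding Z_def joukowski_def by (simp add: complex_add_cnj)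
    moreover have "\<bar>rad * Re (exp \<zeta>)\<bar> \<le> rad"
      using abs_Re_le_cmod[of "exp \<zeta>"] \<open>norm (exp \<zeta>) = 1\<close> less by (simp add: abs_mult)
    ultimately show ?thesis by (simp only: mid_plus_mem_seg)
  qed
  \<comment> \<open>The half-height 4 exceeds \<open>pi\<close>, so the segment covers a full period
    of \<open>exp\<close> with room to spare.\<close>
  define A where "A = cbox (Complex 0 (-4)) (Complex 0 4)"
  have "compact A" by (simp add: A_def compact_cbox)
  moreover have "open (Z -` V)" using Zcont V(1) by (simp add: open_vimage)
  moreover have "A \<subseteq> Z -` V"
  proof
    fix \<zeta> assume "\<zeta> \<in> A"
    hence "Z \<zeta> \<in> seg \<alpha> \<beta>" by (intro Zim) (auto simp: A_def in_cbox_complex_iff)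
    thus "\<zeta> \<in> Z -` V" using V(2) by auto
  qed
  ultimately obtain \<eta> where \<eta>: "\<eta> > 0" "(\<Union>x\<in>A. ball x \<eta>) \<subseteq> Z -` V"
    by (rule compact_subset_open_imp_ball_epsilon_subset)
  \<comment> \<open>\<open>T\<close> straddles the imaginary axis, so the primitive is defined on
    the axis itself. On \<open>W\<close>, the part to the right, \<open>exp \<zeta>\<close> has
    modulus greater than 1 and \<open>Z\<close> avoids the interval.\<close>
  define T where "T = box (Complex (-\<eta>) (-4)) (Complex \<eta> 4)"
  define W where "W = box (Complex 0 (-4)) (Complex \<eta> 4)"
  have ZT: "Z \<zeta> \<in> V" if "\<zeta> \<in> T" for \<zeta>
  proof -
    have "Complex 0 (Im \<zeta>) \<in> A" using that by (auto simp: A_def T_def in_cbox_complex_iff in_box_complex_iff)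
    moreover have "dist (Complex 0 (Im \<zeta>)) \<zeta> < \<eta>"
      using that by (auto simp: T_def in_box_complex_iff dist_norm cmod_def)
    ultimately have "\<zeta> \<in> (\<Union>x\<in>A. ball x \<eta>)" by (intro UN_I) (simp_all only: mem_ball)
    thus ?thesis using \<eta>(2) by blast
  qed
  have "(r \<circ> Z) holomorphic_on T"
  proof (rule holomorphic_on_compose_gen[OF _ r])
    show "Z holomorphic_on T"
      using Z' by (meson field_differentiable_at_within field_differentiable_def holomorphic_onI)
  qed (use ZT in auto)
  then obtain \<Phi> where \<Phi>: "\<And>\<zeta>. \<zeta> \<in> T \<Longrightarrow> (\<Phi> has_field_derivative r (Z \<zeta>)) (at \<zeta>)"
    using holomorphic_convex_primitive'[of T "r \<circ> Z"] at_within_open[of _ T]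
    by (auto simp: T_def convex_box open_box)
  have WT: "W \<subseteq> T" using \<eta>(1) by (auto simp: W_def T_def in_box_complex_iff)
  have Wd: "((\<lambda>\<zeta>. u (Z \<zeta>)) has_derivative (\<lambda>h. Re (r (Z \<zeta>) * h))) (at \<zeta>)" if "\<zeta> \<in> W" for \<zeta>
  proof -
    define w where "w = exp \<zeta>"
    have w: "norm w > 1" using that by (simp add: w_def W_def in_box_complex_iff)
    have out: "Z \<zeta> \<in> V - seg \<alpha> \<beta>" using ZT[of \<zeta>] WT that joukowski_notin_seg[OF w] by (auto simp: Z_def w_def)
    have sq: "interval_sqrt \<alpha> \<beta> (Z \<zeta>) = of_real rad * (w - 1 / w) / 2"
      using interval_sqrt_joukowski[OF w] by (simp add: Z_def w_def)
    have "interval_sqrt \<alpha> \<beta> (Z \<zeta>) \<noteq> 0" using interval_sqrt_nonzero out by blast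
    hence "r (Z \<zeta>) / interval_sqrt \<alpha> \<beta> (Z \<zeta>) * (of_real rad * (w - 1 / w) / 2) = r (Z \<zeta>)"
      unfolding sq by simp
    thus ?thesis using gradient_compose[where f = Z, OF u[OF out] Z'] by (simp only: w_def)
  qed
  obtain k1 where k1: "\<And>\<zeta>. \<zeta> \<in> W \<Longrightarrow> u (Z \<zeta>) = Re (\<Phi> \<zeta>) + k1"
    by (rule eq_Re_primitive_plus_const[of W "\<lambda>\<zeta>. u (Z \<zeta>)" "\<lambda>\<zeta>. r (Z \<zeta>)" \<Phi>])
       (use Wd \<Phi> WT in \<open>auto simp: W_def convex_box open_box\<close>)
  \<comment> \<open>On the imaginary axis \<open>Z\<close> takes values in the interval, where
    \<open>r\<close> is real; so the derivative of \<Phi> along the axis is purely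
    imaginary.\<close>
  have "((\<lambda>y. Re (\<Phi> (\<i> * of_real y))) has_real_derivative 0) (at y within {-4<..<4})" if y: "y \<in> {-4<..<4}" for y
  proof -
    have T: "\<i> * of_real y \<in> T" using y \<eta>(1) by (auto simp: T_def in_box_complex_iff)
    have "((\<lambda>y. \<i> * of_real y) has_vector_derivative \<i>) (at y)"
      by (auto intro!: derivative_eq_intros)
    from field_vector_diff_chain_at[OF this \<Phi>[OF T]]
    have "((\<lambda>y. \<Phi> (\<i> * of_real y)) has_vector_derivative \<i> * r (Z (\<i> * of_real y))) (at y)"
      by (simp add: o_def)
    hence "((\<lambda>y. Re (\<Phi> (\<i> * of_real y))) has_vector_derivative Re (\<i> * r (Z (\<i> * of_real y)))) (at y)"
      by (rule bounded_linear.has_vector_derivative[OF bounded_linear_Re])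
    moreover have "Im (r (Z (\<i> * of_real y))) = 0" by (intro real Zim) simp
    ultimately show ?thesis
      by (simp add: has_real_derivative_iff_has_vector_derivative has_vector_derivative_at_within)
  qed
  then obtain k2 where k2: "\<And>y. y \<in> {-4<..<4} \<Longrightarrow> Re (\<Phi> (\<i> * of_real y)) = k2"
    using has_field_derivative_zero_constant[of "{-4<..<4::real}"] by (metis convex_real_interval(8))
  define D where "D = cbox (Complex (-\<eta>/2) (-pi)) (Complex (\<eta>/2) pi)"
  have DT: "D \<subseteq> T" using \<eta>(1) pi_less_4 by (auto simp: D_def T_def in_box_complex_iff in_cbox_complex_iff)
  have "continuous_on D \<Phi>"
    using \<Phi> DT DERIV_isCont by (intro continuous_at_imp_continuous_on) blast
  hence uc: "uniformly_continuous_on D \<Phi>"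
    by (intro compact_uniformly_continuous) (auto simp: D_def compact_cbox)
  show ?thesis
  proof (rule that, rule tendstoI)
    fix x \<epsilon> assume x: "x \<in> seg \<alpha> \<beta>" and "\<epsilon> > (0::real)"
    obtain \<delta> where \<delta>: "\<delta> > 0" "\<And>a b. a \<in> D \<Longrightarrow> b \<in> D \<Longrightarrow> dist a b < \<delta> \<Longrightarrow> dist (\<Phi> a) (\<Phi> b) < \<epsilon>"
      using uc \<open>\<epsilon> > 0\<close> unfolding uniformly_continuous_on_def by metis
    \<comment> \<open>Near \<open>x\<close> the sum of the focal distances is close to its minimum,
      so \<open>z\<close> lies inside the ellipse belonging to \<open>m\<close>. Then
      \<open>norm w < m\<close>, and \<open>Re \<zeta> = ln (norm w)\<close> is below \<delta> and
      \<open>\<eta> / 2\<close>.\<close>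
    define m where "m = exp (min \<delta> (\<eta>/2))"
    have m: "m > 1" using \<delta>(1) \<eta>(1) by (simp add: m_def)
    have "m + 1 / m > 2"
    proof -
      have "(m - 1)\<^sup>2 > 0" using m by simp
      hence "m * m + 1 > 2 * m" by (simp add: power2_eq_square algebra_simps)
      thus ?thesis using m by (simp add: field_simps)
    qed
    hence "rad * (m + 1 / m) > rad * 2" using rad_pos by (rule mult_strict_left_mono)
    moreover have "norm (x - of_real \<alpha>) + norm (x - of_real \<beta>) = rad * 2"
    proof -
      obtain t where t: "x = of_real t" "\<alpha> \<le> t" "t \<le> \<beta>" using x unfolding seg_def by auto
      show ?thesis unfolding t(1) of_real_diff[symmetric] norm_of_real using t by simp
    qed
    moreover have "((\<lambda>z. norm (z - of_real \<alpha>) + norm (z - of_real \<beta>)) \<longlongrightarrow>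
      norm (x - of_real \<alpha>) + norm (x - of_real \<beta>)) (at x within - seg \<alpha> \<beta>)"
      by (intro tendsto_intros)
    ultimately have "\<forall>\<^sub>F z in at x within - seg \<alpha> \<beta>.
      norm (z - of_real \<alpha>) + norm (z - of_real \<beta>) < rad * (m + 1 / m)"
      by (metis order_tendstoD(2))
    moreover have "\<forall>\<^sub>F z in at x within - seg \<alpha> \<beta>. z \<in> - seg \<alpha> \<beta>"
      by (simp add: eventually_at_filter)
    ultimately show "\<forall>\<^sub>F z in at x within - seg \<alpha> \<beta>. dist (u z) (k1 + k2) < \<epsilon>"
    proof eventually_elim
      case (elim z)
      then obtain w where w: "norm w > 1" "joukowski \<alpha> \<beta> w = z" using joukowski_surj by blast
      have w0: "w \<noteq> 0" using w(1) by auto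
      have "rad * (norm w + 1 / norm w) < rad * (m + 1 / m)"
        using joukowski_ellipse[OF w0] elim(1) w(2) by simp
      hence lt: "norm w + 1 / norm w < m + 1 / m" using rad_pos by (simp only: mult_less_cancel_left_pos)
      \<comment> \<open>The function \<open>t + 1 / t\<close> increases for
        \<open>t >= 1\<close>.\<close>
      have "norm w < m"
      proof (rule ccontr)
        assume "\<not> norm w < m"
        hence g: "norm w \<ge> m" by simp
        have "m + 1 / m \<le> norm w + 1 / norm w"
        proof -
          have "norm w * m \<ge> 1 * 1" using m w(1) by (intro mult_mono) auto
          hence "(norm w - m) * (1 - 1 / (norm w * m)) \<ge> 0"
            using g m by (intro mult_nonneg_nonneg) (auto simp: divide_le_eq)
          moreover have "(norm w - m) * (1 - 1 / (norm w * m)) = norm w + 1 / norm w - (m + 1 / m)"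
          proof -
            have "(a - b) * (1 - 1 / (a * b)) = a + 1 / a - (b + 1 / b)" if "a \<noteq> 0" "b \<noteq> 0" for a b :: real
              using that by (simp add: divide_simps) (simp add: algebra_simps)
            thus ?thesis using m w0 by simp
          qed
          ultimately show ?thesis by linarith
        qed
        thus False using lt by linarith
      qed
      define \<zeta> where "\<zeta> = Ln w"
      have e: "exp \<zeta> = w" using w0 by (simp add: \<zeta>_def)
      have "ln (norm w) < ln m" using w(1) m \<open>norm w < m\<close> by (subst ln_less_cancel_iff) auto
      hence Re: "0 < Re \<zeta>" "Re \<zeta> < min \<delta> (\<eta>/2)" using w(1) w0 unfolding \<zeta>_def m_def by simp_all
      have Im: "- pi < Im \<zeta>" "Im \<zeta> \<le> pi" using w0 mpi_less_Im_Ln Im_Ln_le_pi by (auto simp: \<zeta>_def)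
      have \<zeta>W: "\<zeta> \<in> W" using Re Im \<eta>(1) pi_less_4 by (auto simp: W_def in_box_complex_iff)
      have "u z = Re (\<Phi> \<zeta>) + k1" using k1[OF \<zeta>W] e w(2) by (simp add: Z_def)
      moreover have "Re (\<Phi> (\<i> * of_real (Im \<zeta>))) = k2" using k2[of "Im \<zeta>"] Im pi_less_4 by auto
      moreover have "dist (\<Phi> \<zeta>) (\<Phi> (\<i> * of_real (Im \<zeta>))) < \<epsilon>"
      proof (rule \<delta>(2))
        show "\<zeta> \<in> D" "\<i> * of_real (Im \<zeta>) \<in> D"
          using Re Im \<eta>(1) by (auto simp: D_def in_cbox_complex_iff)
        show "dist \<zeta> (\<i> * of_real (Im \<zeta>)) < \<delta>" using Re by (simp add: dist_norm cmod_def)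
      qed
      moreover have "\<bar>Re (\<Phi> \<zeta>) - Re (\<Phi> (\<i> * of_real (Im \<zeta>)))\<bar> \<le> dist (\<Phi> \<zeta>) (\<Phi> (\<i> * of_real (Im \<zeta>)))"
        unfolding dist_norm minus_complex.sel[symmetric] by (rule abs_Re_le_cmod)
      ultimately show ?case by (simp add: dist_real_def)
    qed
  qed
qed

section \<open>Finite unions of intervals\<close>

text \<open>Gaussian elimination for \<open>n\<close> equations in \<open>n + 1\<close> unknowns. A
  pivot \<open>p\<close> for the last equation is swapped to the end by \<open>\<pi>\<close>, and
  the reduced coefficients \<open>w\<close> vanish in that equation. If there is no pivot, the last
  equation is void and the last unknown is set to 0.\<close>

lemma homogeneous_nontrivial_solution:
  fixes v :: "nat \<Rightarrow> nat \<Rightarrow> real"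
  shows "\<exists>x. (\<exists>i\<le>n. x i \<noteq> 0) \<and> (\<forall>j<n. (\<Sum>i\<le>n. x i * v i j) = 0)"
proof (induction n arbitrary: v)
  case 0
  show ?case by (intro exI[of _ "\<lambda>_. 1"]) auto
next
  case (Suc n)
  show ?case
  proof (cases "\<exists>p\<le>Suc n. v p n \<noteq> 0")
    case False
    obtain x where x: "\<exists>i\<le>n. x i \<noteq> 0" "\<forall>j<n. (\<Sum>i\<le>n. x i * v i j) = 0"
      using Suc.IH[of v] by blast
    show ?thesis
    proof (intro exI[of _ "x(Suc n := 0)"] conjI allI impI)
      obtain i where "i \<le> n" "x i \<noteq> 0" using x(1) by blast
      thus "\<exists>i\<le>Suc n. (x(Suc n := 0)) i \<noteq> 0" by (intro exI[of _ i]) simp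
      fix j assume "j < Suc n"
      hence "j < n \<or> j = n" by auto
      moreover have "(\<Sum>i\<le>Suc n. (x(Suc n := 0)) i * v i j) = (\<Sum>i\<le>n. x i * v i j)" by simp
      moreover have "(\<Sum>i\<le>n. x i * v i n) = 0" using False by (intro sum.neutral) auto
      ultimately show "(\<Sum>i\<le>Suc n. (x(Suc n := 0)) i * v i j) = 0" using x(2) by auto
    qed
  next
    case True
    then obtain p where p: "p \<le> Suc n" "v p n \<noteq> 0" by blast
    define \<pi> where "\<pi> = (\<lambda>i. if i = Suc n then p else if i = p then Suc n else i)"
    have inv: "\<pi> (\<pi> i) = i" for i by (simp add: \<pi>_def)
    have bij: "bij_betw \<pi> {..Suc n} {..Suc n}"
      using p(1) inv by (intro bij_betw_byWitness[where f' = \<pi>]) (auto simp: \<pi>_def)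
    define w where "w = (\<lambda>i j. v (\<pi> i) j - v (\<pi> i) n / v p n * v p j)"
    obtain x where x: "\<exists>i\<le>n. x i \<noteq> 0" "\<forall>j<n. (\<Sum>i\<le>n. x i * w i j) = 0"
      using Suc.IH[of w] by blast
    \<comment> \<open>The coefficient of the pivot row that turns a combination of the reduced rows
      into one of the original rows.\<close>
    define c where "c = - (\<Sum>i\<le>n. x i * (v (\<pi> i) n / v p n))"
    define y where "y = (\<lambda>i. if i = Suc n then c else x i)"
    have sum: "(\<Sum>i\<le>Suc n. y (\<pi> i) * v i j) = (\<Sum>i\<le>n. x i * w i j)" for j
    proof -
      have "(\<Sum>i\<le>Suc n. y (\<pi> i) * v i j) = (\<Sum>i\<le>Suc n. y i * v (\<pi> i) j)"
        using sum.reindex_bij_betw[OF bij, of "\<lambda>i. y (\<pi> i) * v i j"] by (simp only: inv)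
      also have "\<dots> = (\<Sum>i\<le>n. x i * v (\<pi> i) j) + c * v p j" by (simp add: y_def \<pi>_def)
      also have "\<dots> = (\<Sum>i\<le>n. x i * w i j)"
        by (simp add: c_def w_def right_diff_distrib sum_subtractf sum_distrib_left sum_distrib_right mult_ac)
      finally show ?thesis .
    qed
    have wn: "w i n = 0" for i using p(2) by (simp add: w_def)
    show ?thesis
    proof (intro exI[of _ "\<lambda>i. y (\<pi> i)"] conjI allI impI)
      obtain i where i: "i \<le> n" "x i \<noteq> 0" using x(1) by blast
      have "\<pi> i \<le> Suc n" using i(1) p(1) by (simp add: \<pi>_def)
      moreover have "y (\<pi> (\<pi> i)) \<noteq> 0" using i by (simp add: inv y_def)
      ultimately show "\<exists>i\<le>Suc n. y (\<pi> i) \<noteq> 0" by blast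
      fix j assume "j < Suc n"
      hence "j < n \<or> j = n" by auto
      thus "(\<Sum>i\<le>Suc n. y (\<pi> i) * v i j) = 0" unfolding sum using x(2) wn by auto
    qed
  qed
qed

text \<open>With \<open>t\<close> adjoined as an extra row there is a nontrivial relation between
  the rows. By injectivity it involves \<open>t\<close>, and it can be solved for
  \<open>t\<close>.\<close>

lemma injective_imp_solvable:
  fixes M :: "nat \<Rightarrow> nat \<Rightarrow> real"
  assumes "\<And>x. (\<And>j. j < n \<Longrightarrow> (\<Sum>i<n. x i * M i j) = 0) \<Longrightarrow> \<forall>i<n. x i = 0"
  obtains x where "\<And>j. j < n \<Longrightarrow> (\<Sum>i<n. x i * M i j) = t j"
proof -
  define v where "v = (\<lambda>i. if i < n then M i else t)"
  obtain x where x: "\<exists>i\<le>n. x i \<noteq> 0" "\<forall>j<n. (\<Sum>i\<le>n. x i * v i j) = 0"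
    using homogeneous_nontrivial_solution[of n v] by blast
  have s: "(\<Sum>i\<le>n. x i * v i j) = (\<Sum>i<n. x i * M i j) + x n * t j" for j
    by (simp add: v_def lessThan_Suc_atMost[symmetric])
  have "x n \<noteq> 0"
  proof
    assume "x n = 0"
    hence "\<forall>i<n. x i = 0" using x(2) s by (intro assms) auto
    thus False using x(1) \<open>x n = 0\<close> by (auto simp: le_less)
  qed
  have "(\<Sum>i<n. - x i / x n * M i j) = t j" if "j < n" for j
  proof -
    have "(\<Sum>i<n. - x i / x n * M i j) = - (\<Sum>i<n. x i * M i j) / x n"
      by (simp add: sum_divide_distrib sum_negf)
    also have "\<dots> = t j" using x(2) s[of j] that \<open>x n \<noteq> 0\<close> by (simp add: field_simps)
    finally show ?thesis .
  qed
  thus ?thesis using that[of "\<lambda>i. - x i / x n"] by blast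
qed

section \<open>The square root and the potentials of a union of intervals\<close>

locale intervals =
  fixes N :: nat and \<alpha> \<beta> :: "nat \<Rightarrow> real"
  assumes N: "N \<ge> 1" and less: "\<And>j. j < N \<Longrightarrow> \<alpha> j < \<beta> j"
    and disj: "\<And>i j x. i < N \<Longrightarrow> j < N \<Longrightarrow> i \<noteq> j \<Longrightarrow> x \<in> seg (\<alpha> i) (\<beta> i) \<Longrightarrow> x \<notin> seg (\<alpha> j) (\<beta> j)"
begin

definition E :: "complex set" where "E = (\<Union>j<N. seg (\<alpha> j) (\<beta> j))"
definition S :: "complex \<Rightarrow> complex" where "S z = (\<Prod>j<N. interval_sqrt (\<alpha> j) (\<beta> j) z)"

lemma interval: "j < N \<Longrightarrow> interval (\<alpha> j) (\<beta> j)"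
  using less by unfold_locales

lemma compact_E: "compact E" unfolding E_def by (intro compact_UN compact_seg) auto

lemma open_compl: "open (- E)" using compact_E by (simp add: compact_imp_closed open_Compl)

lemma E_nonempty: "E \<noteq> {}"
proof -
  have "0 < N" using N by simp
  moreover have "complex_of_real (\<alpha> 0) \<in> seg (\<alpha> 0) (\<beta> 0)" using less[OF \<open>0 < N\<close>] by simp
  ultimately have "complex_of_real (\<alpha> 0) \<in> E" unfolding E_def by blast
  thus ?thesis by blast
qed

lemma seg_subset: "j < N \<Longrightarrow> seg (\<alpha> j) (\<beta> j) \<subseteq> E" unfolding E_def by auto

lemma E_real: "z \<in> E \<Longrightarrow> Im z = 0" unfolding E_def by (auto simp: mem_seg_iff)

lemma cnj_notin_E: "z \<notin> E \<Longrightarrow> cnj z \<notin> E" unfolding E_def by (auto simp: mem_seg_iff)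

lemma S_holomorphic: "S holomorphic_on - E"
  unfolding S_def
  by (intro holomorphic_intros holomorphic_on_subset[OF interval.interval_sqrt_holomorphic[OF interval]])
     (auto simp: E_def)

lemma S_nonzero: "z \<notin> E \<Longrightarrow> S z \<noteq> 0"
  unfolding S_def E_def using interval.interval_sqrt_nonzero[OF interval] by auto

lemma S_cnj: "z \<notin> E \<Longrightarrow> S (cnj z) = cnj (S z)"
  unfolding S_def E_def cnj_prod using interval.interval_sqrt_cnj[OF interval]
  by (intro prod.cong) auto

lemma S_infinity:
  obtains r \<sigma> where "r > 0" "\<sigma> holomorphic_on ball 0 r" "\<sigma> 0 = 1" "\<And>w. w \<in> ball 0 r \<Longrightarrow> \<sigma> w \<noteq> 0"
    "\<And>w. w \<in> ball 0 r - {0} \<Longrightarrow> 1 / w \<notin> E \<and> S (1 / w) = \<sigma> w / w ^ N"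
proof -
  define P where "P = (\<lambda>j r \<sigma>. r > 0 \<and> \<sigma> holomorphic_on ball 0 r \<and> \<sigma> 0 = 1 \<and> (\<forall>w\<in>ball 0 r. \<sigma> w \<noteq> 0) \<and>
    (\<forall>w\<in>ball 0 r - {0}. 1 / w \<notin> seg (\<alpha> j) (\<beta> j) \<and> interval_sqrt (\<alpha> j) (\<beta> j) (1 / w) = \<sigma> w / w))"
  have "\<exists>r \<sigma>. P j r \<sigma>" if "j < N" for j
    using interval.interval_sqrt_infinity[OF interval[OF that]] unfolding P_def by metis
  then obtain r \<sigma> where P: "\<And>j. j < N \<Longrightarrow> P j (r j) (\<sigma> j)" by metis
  have r: "\<And>j. j < N \<Longrightarrow> r j > 0" "\<And>j. j < N \<Longrightarrow> \<sigma> j holomorphic_on ball 0 (r j)"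
    "\<And>j. j < N \<Longrightarrow> \<sigma> j 0 = 1" "\<And>j w. j < N \<Longrightarrow> w\<in>ball 0 (r j) \<Longrightarrow> \<sigma> j w \<noteq> 0"
    "\<And>j w. j < N \<Longrightarrow> w\<in>ball 0 (r j) - {0} \<Longrightarrow>
       1 / w \<notin> seg (\<alpha> j) (\<beta> j) \<and> interval_sqrt (\<alpha> j) (\<beta> j) (1 / w) = \<sigma> j w / w"
    using P unfolding P_def by blast+
  define \<rho> where "\<rho> = Min (r ` {..<N})"
  have "{..<N} \<noteq> {}" using N by (auto simp: lessThan_empty_iff)
  hence \<rho>: "\<rho> > 0" "\<And>j. j < N \<Longrightarrow> \<rho> \<le> r j" using r(1) by (auto simp: \<rho>_def)
  have sub: "w \<in> ball 0 (r j)" if "j < N" "w \<in> ball 0 \<rho>" for j and w :: complex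
    using \<rho>(2)[OF that(1)] that(2) by auto
  show ?thesis
  proof (rule that[of \<rho> "\<lambda>w. \<Prod>j<N. \<sigma> j w"])
    show "(\<lambda>w. \<Prod>j<N. \<sigma> j w) holomorphic_on ball 0 \<rho>"
      using sub by (intro holomorphic_intros holomorphic_on_subset[OF r(2)]) auto
    show "(\<Prod>j<N. \<sigma> j 0) = 1" using r(3) by simp
    show "(\<Prod>j<N. \<sigma> j w) \<noteq> 0" if "w \<in> ball 0 \<rho>" for w using r(4) sub that by auto
    show "1 / w \<notin> E \<and> S (1 / w) = (\<Prod>j<N. \<sigma> j w) / w ^ N" if w: "w \<in> ball 0 \<rho> - {0}" for w
    proof -
      have *: "1 / w \<notin> seg (\<alpha> j) (\<beta> j) \<and> interval_sqrt (\<alpha> j) (\<beta> j) (1 / w) = \<sigma> j w / w" if "j < N" for j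
        using r(5)[OF that, of w] sub[OF that, of w] w by blast
      have "S (1 / w) = (\<Prod>j<N. \<sigma> j w / w)" unfolding S_def using * by (intro prod.cong) auto
      thus ?thesis using * by (auto simp: E_def prod_dividef)
    qed
  qed (rule \<rho>(1))
qed

text \<open>\<open>C\<close> is a set of removable singularities, at which the splitting of the differential \<open>n dz\<close> into
  \<open>d\<psi>\<close> and a differential that is purely imaginary along \<open>E\<close> breaks down.\<close>

lemma potential_with_boundary_values:
  assumes C: "closed C" "C \<inter> E = {}"
    and n: "n holomorphic_on - E" "\<And>z. z \<notin> E \<Longrightarrow> n (cnj z) = cnj (n z)"
    and split: "\<And>z. z \<notin> E \<union> C \<Longrightarrow> n z = \<rho> z + p z / S z"
    and p: "p holomorphic_on - C" "\<And>z. z \<in> E \<Longrightarrow> Im (p z) = 0"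
    and \<psi>: "\<And>z. z \<notin> C \<Longrightarrow> (\<psi> has_derivative (\<lambda>h. Re (\<rho> z * h))) (at z)"
    and \<tau>: "r > 0" "\<tau> holomorphic_on ball 0 r" "\<tau> 0 = of_real \<kappa>"
      "\<And>w. w \<in> ball 0 r - {0} \<Longrightarrow> 1 / w \<notin> E \<and> n (1 / w) = w * \<tau> w"
  obtains u L k where "log_harmonic \<kappa> u L E"
    "\<And>z. z \<notin> E \<Longrightarrow> (u has_derivative (\<lambda>h. Re (n z * h))) (at z)"
    "\<And>j x. j < N \<Longrightarrow> x \<in> seg (\<alpha> j) (\<beta> j) \<Longrightarrow> (u \<longlongrightarrow> \<psi> x + k j) (at x within - E)"
proof -
  obtain u where u: "\<And>z. z \<notin> E \<Longrightarrow> (u has_derivative (\<lambda>h. Re (n z * h))) (at z)"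
    using potential_exists[OF compact_E E_real n] by metis
  obtain L where L: "log_harmonic \<kappa> u L E"
    using potential_log_harmonic[OF compact_E n(1) u \<tau>] by metis
  have "\<exists>k. \<forall>x\<in>seg (\<alpha> j) (\<beta> j). (u \<longlongrightarrow> \<psi> x + k) (at x within - E)" if j: "j < N" for j
  proof -
    interpret interval "\<alpha> j" "\<beta> j" by (rule interval[OF j])
    let ?s = "seg (\<alpha> j) (\<beta> j)"
    define V where "V = - (C \<union> (\<Union>i\<in>{..<N} - {j}. seg (\<alpha> i) (\<beta> i)))"
    have oV: "open V" unfolding V_def using C(1)
      by (intro open_Compl closed_Un closed_UN) (auto intro: compact_imp_closed compact_seg)
    have sV: "?s \<subseteq> V" using C(2) seg_subset[OF j] disj[OF j] by (auto simp: V_def)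
    have VE: "V - ?s \<subseteq> - (E \<union> C)" by (auto simp: V_def E_def)
    \<comment> \<open>All factors of \<open>S\<close> other than the one cut along interval
      \<open>j\<close> are absorbed into \<open>q\<close>, which is then holomorphic across that
      interval and real on it.\<close>
    define q where "q = (\<lambda>z. p z / (\<Prod>i\<in>{..<N} - {j}. interval_sqrt (\<alpha> i) (\<beta> i) z))"
    have nz: "interval_sqrt (\<alpha> i) (\<beta> i) z \<noteq> 0" if "z \<in> V" "i \<in> {..<N} - {j}" for i z
      using interval.interval_sqrt_nonzero[OF interval[of i]] that by (auto simp: V_def)
    have Vi: "V \<subseteq> - seg (\<alpha> i) (\<beta> i)" if "i \<in> {..<N} - {j}" for i using that by (auto simp: V_def)
    have holq: "q holomorphic_on V"
      unfolding q_def
    proof (intro holomorphic_on_divide holomorphic_on_prod)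
      show "p holomorphic_on V" by (rule holomorphic_on_subset[OF p(1)]) (auto simp: V_def)
      show "interval_sqrt (\<alpha> i) (\<beta> i) holomorphic_on V" if "i \<in> {..<N} - {j}" for i
        using interval.interval_sqrt_holomorphic[OF interval[of i]] Vi[OF that] that
        by (auto intro: holomorphic_on_subset)
      show "(\<Prod>i\<in>{..<N} - {j}. interval_sqrt (\<alpha> i) (\<beta> i) z) \<noteq> 0" if "z \<in> V" for z
        using nz[OF that] by simp
    qed
    have qreal: "Im (q x) = 0" if x: "x \<in> ?s" for x
    proof -
      have cx: "cnj x = x" using x by (simp add: mem_seg_iff complex_eq_iff)
      have "cnj (interval_sqrt (\<alpha> i) (\<beta> i) x) = interval_sqrt (\<alpha> i) (\<beta> i) x" if "i \<in> {..<N} - {j}" for i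
        using interval.interval_sqrt_cnj[OF interval[of i], of x] that disj[OF j, of i x] x cx by auto
      moreover have "cnj (p x) = p x" using p(2)[of x] seg_subset[OF j] x by (simp add: complex_eq_iff subset_iff)
      ultimately have "cnj (q x) = q x" by (simp add: q_def cnj_prod)
      thus ?thesis by (metis Reals_cnj_iff complex_is_Real_iff)
    qed
    have der: "((\<lambda>z. u z - \<psi> z) has_derivative (\<lambda>h. Re (q z / interval_sqrt (\<alpha> j) (\<beta> j) z * h))) (at z)"
      if z: "z \<in> V - ?s" for z
    proof -
      have zE: "z \<notin> E" "z \<notin> C" using VE z by auto
      have "S z = (\<Prod>i\<in>{..<N} - {j}. interval_sqrt (\<alpha> i) (\<beta> i) z) * interval_sqrt (\<alpha> j) (\<beta> j) z"
        unfolding S_def using j by (subst prod.remove[of _ j]) auto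
      hence "n z = \<rho> z + q z / interval_sqrt (\<alpha> j) (\<beta> j) z"
        using split[of z] zE by (simp add: q_def)
      with has_derivative_diff[OF u[OF zE(1)] \<psi>[OF zE(2)]]
      show ?thesis by (simp add: distrib_right)
    qed
    obtain k where k: "\<And>x. x \<in> ?s \<Longrightarrow> ((\<lambda>z. u z - \<psi> z) \<longlongrightarrow> k) (at x within - ?s)"
      using boundary_constant[OF oV sV holq qreal der] by metis
    have "(u \<longlongrightarrow> \<psi> x + k) (at x within - E)" if x: "x \<in> ?s" for x
    proof -
      have "((\<lambda>z. u z - \<psi> z) \<longlongrightarrow> k) (at x within - E)"
        by (rule tendsto_within_subset[OF k[OF x]]) (use seg_subset[OF j] in blast)
      moreover have "(\<psi> \<longlongrightarrow> \<psi> x) (at x within - E)"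
      proof -
        have "x \<notin> C" using x sV by (auto simp: V_def)
        from has_derivative_continuous[OF \<psi>[OF this]] have "(\<psi> \<longlongrightarrow> \<psi> x) (at x)"
          by (simp add: continuous_within)
        thus ?thesis by (rule tendsto_within_subset) simp
      qed
      ultimately have "((\<lambda>z. \<psi> z + (u z - \<psi> z)) \<longlongrightarrow> \<psi> x + k) (at x within - E)"
        by (intro tendsto_add)
      thus ?thesis by simp
    qed
    thus ?thesis by blast
  qed
  then obtain k where "\<And>j x. j < N \<Longrightarrow> x \<in> seg (\<alpha> j) (\<beta> j) \<Longrightarrow> (u \<longlongrightarrow> \<psi> x + k j) (at x within - E)"
    by metis
  thus ?thesis using that L u by blast
qed

end

section \<open>Boundary value problems solved by explicit potentials\<close>

context intervals
begin

text \<open>\<open>z ^ i / S z\<close> behaves like \<open>1 / z ^ (N - i)\<close> at infinity. Only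
  \<open>i = N - 1\<close> has a residue there, and it yields logarithmic growth.\<close>

lemma monomial_potential:
  assumes i: "i < N"
  obtains u L k where "log_harmonic (if i = N - 1 then 1 else 0) u L E"
    "\<And>z. z \<notin> E \<Longrightarrow> (u has_derivative (\<lambda>h. Re (z ^ i / S z * h))) (at z)"
    "\<And>j x. j < N \<Longrightarrow> x \<in> seg (\<alpha> j) (\<beta> j) \<Longrightarrow> (u \<longlongrightarrow> k j) (at x within - E)"
proof -
  obtain r \<sigma> where r: "r > 0" "\<sigma> holomorphic_on ball 0 r" "\<sigma> 0 = 1" "\<And>w. w \<in> ball 0 r \<Longrightarrow> \<sigma> w \<noteq> 0"
    "\<And>w. w \<in> ball 0 r - {0} \<Longrightarrow> 1 / w \<notin> E \<and> S (1 / w) = \<sigma> w / w ^ N"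
    using S_infinity by metis
  have e: "N = Suc (N - 1 - i) + i" using i by simp
  have a: "closed {}" "{} \<inter> E = {}" "(\<lambda>z. z ^ i) holomorphic_on - {}" for E :: "complex set"
    by (auto intro!: holomorphic_intros)
  have n: "(\<lambda>z. z ^ i / S z) holomorphic_on - E"
    using S_holomorphic S_nonzero by (intro holomorphic_intros) auto
  have n': "cnj z ^ i / S (cnj z) = cnj (z ^ i / S z)" if "z \<notin> E" for z using S_cnj[OF that] by simp
  have real: "Im (z ^ i) = 0" if "z \<in> E" for z
    using E_real[OF that] by (metis Reals_power complex_is_Real_iff)
  have \<tau>: "(\<lambda>w. w ^ (N - 1 - i) / \<sigma> w) holomorphic_on ball 0 r"
    using r(2,4) by (intro holomorphic_intros) auto
  \<comment> \<open>\<open>0 ^ 0 = 1\<close> singles out the case \<open>i = N - 1\<close>.\<close>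
  have \<tau>0: "0 ^ (N - 1 - i) / \<sigma> 0 = of_real (if i = N - 1 then 1 else 0)" using i r(3) by auto
  have \<tau>w: "1 / w \<notin> E \<and> (1 / w) ^ i / S (1 / w) = w * (w ^ (N - 1 - i) / \<sigma> w)" if w: "w \<in> ball 0 r - {0}" for w
  proof -
    have w0: "w \<noteq> 0" using w by simp
    have "w ^ N = w * w ^ (N - 1 - i) * w ^ i" by (subst e) (simp add: power_add)
    thus ?thesis using r(5)[OF w] w0 r(4)[of w] w by (simp add: power_divide)
  qed
  have split: "z ^ i / S z = (\<lambda>_. 0) z + (\<lambda>z. z ^ i) z / S z" if "z \<notin> E \<union> {}" for z by simp
  have zero: "((\<lambda>_. 0::real) has_derivative (\<lambda>h. Re ((\<lambda>_. 0) z * h))) (at z)" for z :: complex by simp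
  obtain u L k where u: "log_harmonic (if i = N - 1 then 1 else 0) u L E"
    "\<And>z. z \<notin> E \<Longrightarrow> (u has_derivative (\<lambda>h. Re (z ^ i / S z * h))) (at z)"
    "\<And>j x. j < N \<Longrightarrow> x \<in> seg (\<alpha> j) (\<beta> j) \<Longrightarrow> (u \<longlongrightarrow> (\<lambda>_. 0) x + k j) (at x within - E)"
    using potential_with_boundary_values[OF a(1,2) n n' split a(3) real zero r(1) \<tau> \<tau>0 \<tau>w] by metis
  show ?thesis by (rule that[OF u(1,2), of k]) (use u(3) in simp_all)
qed

lemma infinite_compl: "infinite (- E)"
proof
  assume "finite (- E)"
  hence "bounded (- E \<union> E)" using compact_imp_bounded[OF compact_E] finite_imp_bounded[OF \<open>finite (- E)\<close>]
    by (simp only: bounded_Un)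
  moreover have "- E \<union> E = UNIV" by auto
  ultimately show False using not_bounded_UNIV[where 'a = complex] by simp
qed

text \<open>A combination with zero boundary values vanishes by uniqueness. So does its gradient, a
  polynomial divided by \<open>S\<close>, on the infinite set \<open>- E\<close>; hence the
  coefficients of the polynomial are zero, and finally the additive constant
  \<open>x (N - 1)\<close>.\<close>

lemma potentials_independent:
  assumes u: "\<And>i. i < N - 1 \<Longrightarrow> log_harmonic 0 (u i) (L i) E"
    "\<And>i z. i < N - 1 \<Longrightarrow> z \<notin> E \<Longrightarrow> (u i has_derivative (\<lambda>h. Re (z ^ i / S z * h))) (at z)"
    "\<And>i j x. i < N - 1 \<Longrightarrow> j < N \<Longrightarrow> x \<in> seg (\<alpha> j) (\<beta> j) \<Longrightarrow> (u i \<longlongrightarrow> k i j) (at x within - E)"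
    and x: "\<And>j. j < N \<Longrightarrow> (\<Sum>i<N - 1. x i * k i j) + x (N - 1) = 0"
  shows "\<forall>i<N. x i = 0"
proof -
  define f where "f = (\<lambda>z. (\<Sum>i<N - 1. x i * u i z) + x (N - 1))"
  have f: "log_harmonic 0 f ((\<Sum>i<N - 1. x i * L i) + x (N - 1)) E"
  proof -
    have "log_harmonic 0 (\<lambda>z. \<Sum>i<N - 1. x i * u i z) (\<Sum>i<N - 1. x i * L i) E"
      using log_harmonic_cmult[OF u(1)] by (intro log_harmonic_sum) fastforce
    from log_harmonic_add[OF this log_harmonic_const[of "x (N - 1)"]] show ?thesis by (simp add: f_def)
  qed
  have bd: "(f \<longlongrightarrow> 0) (at \<zeta> within - E)" if \<zeta>: "\<zeta> \<in> E" for \<zeta>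
  proof -
    obtain j where j: "j < N" "\<zeta> \<in> seg (\<alpha> j) (\<beta> j)" using \<zeta> unfolding E_def by auto
    have "(f \<longlongrightarrow> (\<Sum>i<N - 1. x i * k i j) + x (N - 1)) (at \<zeta> within - E)"
      unfolding f_def using u(3) j by (intro tendsto_intros) auto
    thus ?thesis using x[OF j(1)] by simp
  qed
  have f0: "f z = 0" if "z \<notin> E" for z
    by (rule log_harmonic_unique(1)[OF compact_E E_nonempty f log_harmonic_const[of 0] bd _ that]) auto
  have poly0: "(\<Sum>i<N - 1. of_real (x i) * z ^ i) = 0" if z: "z \<notin> E" for z :: complex
  proof -
    have "(f has_derivative (\<lambda>h. (\<Sum>i<N - 1. x i * Re (z ^ i / S z * h)) + 0)) (at z)"
      unfolding f_def using u(2) z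
      by (intro has_derivative_add has_derivative_sum has_derivative_mult_right has_derivative_const) auto
    moreover have "(f has_derivative (\<lambda>h. 0)) (at z)"
      by (rule has_derivative_transform_within_open[OF has_derivative_const[of 0] open_compl])
         (use z f0 in auto)
    ultimately have "(\<lambda>h. (\<Sum>i<N - 1. x i * Re (z ^ i / S z * h)) + 0) = (\<lambda>h. 0)"
      by (rule has_derivative_unique)
    note zero = this
    have e: "(\<Sum>i<N - 1. x i * Re (z ^ i / S z * h)) = 0" for h
      using fun_cong[OF zero, of h] by (simp only: add_0_right)
    have "Re ((\<Sum>i<N - 1. of_real (x i) * z ^ i) / S z * h) = 0" for h
    proof -
      have "(\<Sum>i<N - 1. of_real (x i) * z ^ i) / S z * h = (\<Sum>i<N - 1. of_real (x i) * (z ^ i / S z * h))"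
        by (simp add: sum_divide_distrib sum_distrib_right mult.assoc)
      also have "Re \<dots> = (\<Sum>i<N - 1. x i * Re (z ^ i / S z * h))"
        unfolding Re_sum by (intro sum.cong refl) (simp only: Re_complex_of_real Im_complex_of_real times_complex.sel mult_zero_left diff_zero)
      finally show ?thesis using e by simp
    qed
    moreover have "A = 0" if "\<And>h. Re (A * h) = 0" for A :: complex
      using that[of 1] that[of \<i>] by (simp add: complex_eq_iff)
    ultimately have "(\<Sum>i<N - 1. of_real (x i) * z ^ i) / S z = 0" by blast
    thus ?thesis using S_nonzero[OF z] by simp
  qed
  define c where "c = (\<lambda>i. if i < N - 1 then complex_of_real (x i) else 0)"
  have "(\<Sum>i\<le>N. c i * z ^ i) = (\<Sum>i<N - 1. of_real (x i) * z ^ i)" for z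
    unfolding c_def by (intro sum.mono_neutral_cong_right) auto
  hence "- E \<subseteq> {z. (\<Sum>i\<le>N. c i * z ^ i) = 0}" using poly0 by auto
  hence "infinite {z. (\<Sum>i\<le>N. c i * z ^ i) = 0}" using infinite_compl infinite_super by blast
  hence "\<forall>i\<le>N. c i = 0" using polyfun_finite_roots[of c N] by blast
  hence c0: "c i = 0" if "i \<le> N" for i using that by blast
  have x0: "x i = 0" if "i < N - 1" for i using c0[of i] that by (simp add: c_def)
  obtain z where "z \<notin> E" using infinite_compl by (metis ComplD equals0I finite.emptyI)
  hence "x (N - 1) = 0" using f0[of z] x0 by (simp add: f_def)
  thus ?thesis using x0 by (metis N Suc_diff_1 less_SucE less_le_trans zero_less_one)
qed

text \<open>The \<open>N - 1\<close> potentials without logarithmic growth, together with the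
  constant function, match the \<open>N\<close> prescribed constants. Independence makes the square
  system injective and therefore solvable.\<close>

lemma dirichlet_solution:
  obtains u L where "log_harmonic 0 u L E"
    "\<And>j x. j < N \<Longrightarrow> x \<in> seg (\<alpha> j) (\<beta> j) \<Longrightarrow> (u \<longlongrightarrow> t j) (at x within - E)"
proof -
  define P where "P = (\<lambda>i u L k. log_harmonic 0 u L E \<and>
    (\<forall>z. z \<notin> E \<longrightarrow> (u has_derivative (\<lambda>h. Re (z ^ i / S z * h))) (at z)) \<and>
    (\<forall>j x. j < N \<longrightarrow> x \<in> seg (\<alpha> j) (\<beta> j) \<longrightarrow> (u \<longlongrightarrow> k j) (at x within - E)))"
  have "\<exists>u L k. P i u L k" if "i < N - 1" for i
  proof -
    have i: "i < N" "i \<noteq> N - 1" using that by auto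
    obtain u L k where "log_harmonic (if i = N - 1 then 1 else 0) u L E"
      "\<And>z. z \<notin> E \<Longrightarrow> (u has_derivative (\<lambda>h. Re (z ^ i / S z * h))) (at z)"
      "\<And>j x. j < N \<Longrightarrow> x \<in> seg (\<alpha> j) (\<beta> j) \<Longrightarrow> (u \<longlongrightarrow> k j) (at x within - E)"
      using monomial_potential[OF i(1)] by metis
    hence "P i u L k" unfolding P_def using i(2) by simp
    thus ?thesis by blast
  qed
  then obtain u L k where P: "\<And>i. i < N - 1 \<Longrightarrow> P i (u i) (L i) (k i)" by metis
  have u: "\<And>i. i < N - 1 \<Longrightarrow> log_harmonic 0 (u i) (L i) E"
    "\<And>i z. i < N - 1 \<Longrightarrow> z \<notin> E \<Longrightarrow> (u i has_derivative (\<lambda>h. Re (z ^ i / S z * h))) (at z)"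
    "\<And>i j x. i < N - 1 \<Longrightarrow> j < N \<Longrightarrow> x \<in> seg (\<alpha> j) (\<beta> j) \<Longrightarrow> (u i \<longlongrightarrow> k i j) (at x within - E)"
    using P unfolding P_def by blast+
  define M where "M = (\<lambda>i j. if i < N - 1 then k i j else 1)"
  have split: "(\<Sum>i<N. x i * M i j) = (\<Sum>i<N - 1. x i * k i j) + x (N - 1)" for x j
  proof -
    have "{..<N} = insert (N - 1) {..<N - 1}" using N by auto
    thus ?thesis by (simp add: M_def)
  qed
  have inj: "\<forall>i<N. x i = 0" if "\<And>j. j < N \<Longrightarrow> (\<Sum>i<N. x i * M i j) = 0" for x
  proof -
    have z: "\<And>j. j < N \<Longrightarrow> (\<Sum>i<N - 1. x i * k i j) + x (N - 1) = 0" using that by (simp only: split)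
    show ?thesis by (rule potentials_independent[where u = u and k = k and L = L and x = x, OF u z])
  qed
  obtain x where x: "\<And>j. j < N \<Longrightarrow> (\<Sum>i<N. x i * M i j) = t j"
    using injective_imp_solvable[OF inj, where t = t] by metis
  define f where "f = (\<lambda>z. (\<Sum>i<N - 1. x i * u i z) + x (N - 1))"
  show ?thesis
  proof (rule that)
    have "log_harmonic 0 (\<lambda>z. \<Sum>i<N - 1. x i * u i z) (\<Sum>i<N - 1. x i * L i) E"
      using log_harmonic_cmult[OF u(1)] by (intro log_harmonic_sum) fastforce
    from log_harmonic_add[OF this log_harmonic_const[of "x (N - 1)"]]
    show "log_harmonic 0 f ((\<Sum>i<N - 1. x i * L i) + x (N - 1)) E" by (simp add: f_def)
    fix j y assume j: "j < N" "y \<in> seg (\<alpha> j) (\<beta> j)"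
    have "(f \<longlongrightarrow> (\<Sum>i<N - 1. x i * k i j) + x (N - 1)) (at y within - E)"
      unfolding f_def using u(3) j by (intro tendsto_intros) auto
    thus "(f \<longlongrightarrow> t j) (at y within - E)" using x[OF j(1)] split by simp
  qed
qed

text \<open>The potential of \<open>z ^ (N - 1) / S z\<close> has the right growth; its boundary
  constants are removed by a Dirichlet solution.\<close>

lemma green_at_infinity_exists:
  obtains G \<gamma> where "log_harmonic 1 G \<gamma> E" "\<And>x. x \<in> E \<Longrightarrow> (G \<longlongrightarrow> 0) (at x within - E)"
proof -
  have N1: "N - 1 < N" using N by simp
  obtain u L k where u: "log_harmonic (if N - 1 = N - 1 then 1 else 0) u L E"
    "\<And>j x. j < N \<Longrightarrow> x \<in> seg (\<alpha> j) (\<beta> j) \<Longrightarrow> (u \<longlongrightarrow> k j) (at x within - E)"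
    using monomial_potential[OF N1] by metis
  obtain v M where v: "log_harmonic 0 v M E"
    "\<And>j x. j < N \<Longrightarrow> x \<in> seg (\<alpha> j) (\<beta> j) \<Longrightarrow> (v \<longlongrightarrow> k j) (at x within - E)"
    using dirichlet_solution[of k] by metis
  show ?thesis
  proof (rule that)
    show "log_harmonic 1 (\<lambda>z. u z - v z) (L - M) E" using log_harmonic_diff[OF u(1) v(1)] by simp
    fix x assume "x \<in> E"
    then obtain j where "j < N" "x \<in> seg (\<alpha> j) (\<beta> j)" unfolding E_def by auto
    from tendsto_diff[OF u(2)[OF this] v(2)[OF this]]
    show "((\<lambda>z. u z - v z) \<longlongrightarrow> 0) (at x within - E)" by simp
  qed
qed

lemma deriv_S_cnj:
  assumes "c \<notin> E" shows "deriv S (cnj c) = cnj (deriv S c)"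
proof -
  have "(S has_field_derivative deriv S c) (at (cnj (cnj c)))"
    using holomorphic_derivI[OF S_holomorphic open_compl, of c] assms by simp
  hence "((cnj \<circ> S \<circ> cnj) has_field_derivative cnj (deriv S c)) (at (cnj c))"
    by (rule has_field_derivative_cnj_cnj)
  moreover have "(cnj \<circ> S \<circ> cnj) z = S z" if "z \<in> - E" for z using S_cnj[of z] that by simp
  ultimately have "(S has_field_derivative cnj (deriv S c)) (at (cnj c))"
    using has_field_derivative_transform_within_open[OF _ open_compl] cnj_notin_E[OF assms] by blast
  thus ?thesis by (rule DERIV_imp_deriv)
qed

text \<open>The pole of \<open>dz / (z - c)\<close> is cancelled by subtracting
  \<open>S c dz / ((z - c) S z)\<close>, whence the difference quotient \<open>d c\<close>.
  Averaging over \<open>c\<close> and its conjugate makes the differential real and does not alter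
  the boundary values, since both points are equally far from every real \<open>x\<close>. The term
  \<open>z ^ (N - 1) / S z\<close> removes the residue at infinity.\<close>

lemma log_boundary_solution:
  assumes c: "c \<notin> E"
  obtains q T where "log_harmonic 0 q T E"
    "\<And>x. x \<in> E \<Longrightarrow> (q \<longlongrightarrow> ln (norm (x - c))) (at x within - E)"
proof -
  define d where "d = (\<lambda>b z. if z = b then deriv S b else (S z - S b) / (z - b))"
  define c' where "c' = cnj c"
  have c': "c' \<notin> E" using cnj_notin_E[OF c] by (simp add: c'_def)
  define C where "C = {c, c'}"
  define n where "n = (\<lambda>z. ((d c z + d c' z) / 2 - z ^ (N - 1)) / S z)"
  define \<rho> where "\<rho> = (\<lambda>z. (1 / (z - c) + 1 / (z - c')) / 2)"
  define p where "p = (\<lambda>z. - ((S c / (z - c) + S c' / (z - c')) / 2 + z ^ (N - 1)))"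
  define \<psi> where "\<psi> = (\<lambda>z. (ln (norm (z - c)) + ln (norm (z - c'))) / 2)"
  have Sc': "S c' = cnj (S c)" using S_cnj[OF c] by (simp add: c'_def)
  have d: "d b holomorphic_on - E" for b unfolding d_def by (rule pole_lemma_open[OF S_holomorphic open_compl])
  have dc: "d (cnj b) (cnj z) = cnj (d b z)" if "b \<notin> E" "z \<notin> E" for b z
    using deriv_S_cnj[OF that(1)] S_cnj that by (simp add: d_def)
  have C: "closed C" "C \<inter> E = {}" using c c' by (auto simp: C_def)
  have n: "n holomorphic_on - E"
    unfolding n_def using S_holomorphic S_nonzero d by (intro holomorphic_intros) auto
  have n': "n (cnj z) = cnj (n z)" if z: "z \<notin> E" for z
  proof -
    have "d c (cnj z) = cnj (d c' z)" "d c' (cnj z) = cnj (d c z)"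
      using dc[OF c' z] dc[OF c z] by (simp_all add: c'_def)
    thus ?thesis using S_cnj[OF z] by (simp add: n_def)
  qed
  have split: "n z = \<rho> z + p z / S z" if "z \<notin> E \<union> C" for z
  proof -
    have gen: "(((s - sc) * a + (s - sc') * b) / 2 - m) / s = (a + b) / 2 + - ((sc * a + sc' * b) / 2 + m) / s"
      if "s \<noteq> 0" for s sc sc' a b m :: complex
      using that by (simp add: field_simps)
    have "z \<noteq> c" "z \<noteq> c'" "S z \<noteq> 0" using that S_nonzero[of z] by (auto simp: C_def)
    thus ?thesis
      using gen[of "S z" "S c" "1 / (z - c)" "S c'" "1 / (z - c')" "z ^ (N - 1)"]
      by (simp add: n_def \<rho>_def p_def d_def)
  qed
  have p: "p holomorphic_on - C" unfolding p_def C_def by (intro holomorphic_intros) auto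
  have p': "Im (p z) = 0" if z: "z \<in> E" for z
  proof -
    have "cnj z = z" using E_real[OF z] by (simp add: complex_eq_iff)
    moreover have "cnj c = c'" "cnj c' = c" by (simp_all add: c'_def)
    moreover have "cnj (S c) = S c'" "cnj (S c') = S c" by (simp_all add: Sc')
    ultimately have "cnj (p z) = p z" by (simp add: p_def add.commute)
    thus ?thesis by (metis Reals_cnj_iff complex_is_Real_iff)
  qed
  have \<psi>: "(\<psi> has_derivative (\<lambda>h. Re (\<rho> z * h))) (at z)" if z: "z \<notin> C" for z
  proof -
    have *: "((\<lambda>z. ln (norm (z - b))) has_derivative (\<lambda>h. Re (1 / (z - b) * h))) (at z)" if "z \<noteq> b" for b
    proof -
      have "z - b \<noteq> 0" "((\<lambda>z. z - b) has_field_derivative 1) (at z)"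
        using that by (auto intro!: derivative_eq_intros)
      from gradient_compose[OF has_derivative_ln_norm[OF this(1)] this(2)] show ?thesis by simp
    qed
    have "z \<noteq> c" "z \<noteq> c'" using z by (auto simp: C_def)
    from has_derivative_mult_right[OF has_derivative_add[OF *[OF this(1)] *[OF this(2)]], of "1/2"]
    have "((\<lambda>z. 1/2 * (ln (norm (z - c)) + ln (norm (z - c')))) has_derivative
       (\<lambda>h. 1/2 * (Re (1 / (z - c) * h) + Re (1 / (z - c') * h)))) (at z)" .
    moreover have "1/2 * (Re (a * h) + Re (b * h)) = Re ((a + b) / 2 * h)" for a b h :: complex
      by (simp add: algebra_simps add_divide_distrib diff_divide_distrib)
    moreover have "\<psi> = (\<lambda>z. 1/2 * (ln (norm (z - c)) + ln (norm (z - c'))))" by (simp add: \<psi>_def)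
    ultimately show ?thesis unfolding \<rho>_def by (simp only:)
  qed
  obtain r \<sigma> where r: "r > 0" "\<sigma> holomorphic_on ball 0 r" "\<sigma> 0 = 1" "\<And>w. w \<in> ball 0 r \<Longrightarrow> \<sigma> w \<noteq> 0"
    "\<And>w. w \<in> ball 0 r - {0} \<Longrightarrow> 1 / w \<notin> E \<and> S (1 / w) = \<sigma> w / w ^ N"
    using S_infinity by metis
  \<comment> \<open>For \<open>norm w < 1 / (norm c + 1)\<close> neither \<open>1 - c * w\<close>
    nor \<open>1 - c' * w\<close> vanishes.\<close>
  define r' where "r' = min r (1 / (norm c + 1))"
  have r': "r' > 0" "r' \<le> r" using r(1) by (auto simp: r'_def add_nonneg_pos)
  \<comment> \<open>This is \<open>n (1 / w) / w\<close>, written so that it makes sense at 0, where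
    it equals \<open>1 - 1 = 0\<close>.\<close>
  define \<tau> where "\<tau> = (\<lambda>w. (1 / (1 - c * w) + 1 / (1 - c' * w)) / 2 -
      ((S c / (1 - c * w) + S c' / (1 - c' * w)) / 2 * w ^ N + 1) / \<sigma> w)"
  have nz: "1 - b * w \<noteq> 0" if "w \<in> ball 0 r'" "b = c \<or> b = c'" for w b
  proof
    assume "1 - b * w = 0"
    hence "norm (b * w) = 1" by (metis eq_iff_diff_eq_0 norm_one)
    hence e: "norm c * norm w = 1" using that(2) by (auto simp: norm_mult c'_def)
    have "norm w < 1 / (norm c + 1)" using that(1) by (simp add: r'_def)
    hence "norm w * (norm c + 1) < 1" by (simp add: pos_less_divide_eq add_nonneg_pos)
    moreover have "norm w * (norm c + 1) = 1 + norm w" using e by (simp add: distrib_left mult.commute)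
    ultimately show False using norm_ge_zero[of w] by linarith
  qed
  have \<tau>: "\<tau> holomorphic_on ball 0 r'"
    unfolding \<tau>_def using nz r(4) r'(2)
    by (intro holomorphic_intros holomorphic_on_subset[OF r(2)]) auto
  have \<tau>0: "\<tau> 0 = of_real 0" using N r(3) by (simp add: \<tau>_def)
  have \<tau>w: "1 / w \<notin> E \<and> n (1 / w) = w * \<tau> w" if w: "w \<in> ball 0 r' - {0}" for w
  proof -
    have w0: "w \<noteq> 0" and wr: "w \<in> ball 0 r - {0}" using w r'(2) by auto
    have out: "1 / w \<notin> E" "S (1 / w) = \<sigma> w / w ^ N" using r(5)[OF wr] by auto
    have s0: "\<sigma> w \<noteq> 0" using r(4) wr by auto
    have b: "1 / w - b = (1 - b * w) / w" for b using w0 by (simp add: field_simps)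
    have nzc: "1 - c * w \<noteq> 0" "1 - c' * w \<noteq> 0" using nz w by auto
    have "1 / w \<noteq> c" "1 / w \<noteq> c'" using b[of c] b[of c'] nzc w0 by auto
    hence "1 / w \<notin> E \<union> C" using out(1) by (auto simp: C_def)
    from split[OF this] have "n (1 / w) = (w / (1 - c * w) + w / (1 - c' * w)) / 2 +
       (- ((S c * w / (1 - c * w) + S c' * w / (1 - c' * w)) / 2 + (1 / w) ^ (N - 1))) / (\<sigma> w / w ^ N)"
      unfolding \<rho>_def p_def out(2) b by simp
    also have "\<dots> = w * \<tau> w"
    proof -
      have "w ^ N = w * w ^ (N - 1)" using N by (metis power_eq_if not_one_le_zero)
      hence yq: "(1 / w) ^ (N - 1) * w ^ N = w" using w0 by (simp add: power_divide)
      have gen: "- (X + y) / (s / q) = - (X * q + w) / s" if "y * q = w" for X y q s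
        using that by (auto simp: distrib_right left_diff_distrib)
      have "(- ((S c * w / (1 - c * w) + S c' * w / (1 - c' * w)) / 2 + (1 / w) ^ (N - 1))) / (\<sigma> w / w ^ N)
         = - ((S c * w / (1 - c * w) + S c' * w / (1 - c' * w)) / 2 * w ^ N + w) / \<sigma> w"
        by (rule gen[OF yq])
      note e = this
      show ?thesis unfolding \<tau>_def by (subst e) (simp add: algebra_simps add_divide_distrib diff_divide_distrib)
    qed
    finally show ?thesis using out(1) by blast
  qed
  obtain u L k where u: "log_harmonic 0 u L E"
    "\<And>j x. j < N \<Longrightarrow> x \<in> seg (\<alpha> j) (\<beta> j) \<Longrightarrow> (u \<longlongrightarrow> \<psi> x + k j) (at x within - E)"
    using potential_with_boundary_values[OF C n n' split p p' \<psi> r'(1) \<tau> \<tau>0 \<tau>w] by metis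
  obtain v M where v: "log_harmonic 0 v M E"
    "\<And>j x. j < N \<Longrightarrow> x \<in> seg (\<alpha> j) (\<beta> j) \<Longrightarrow> (v \<longlongrightarrow> k j) (at x within - E)"
    using dirichlet_solution[of k] by metis
  show ?thesis
  proof (rule that)
    show "log_harmonic 0 (\<lambda>z. u z - v z) (L - M) E" using log_harmonic_diff[OF u(1) v(1)] by simp
    fix x assume x: "x \<in> E"
    then obtain j where "j < N" "x \<in> seg (\<alpha> j) (\<beta> j)" unfolding E_def by auto
    from tendsto_diff[OF u(2)[OF this] v(2)[OF this]]
    have "((\<lambda>z. u z - v z) \<longlongrightarrow> \<psi> x) (at x within - E)" by simp
    moreover have "norm (x - c') = norm (x - c)"
      using E_real[OF x] by (simp add: c'_def cmod_def)
    ultimately show "((\<lambda>z. u z - v z) \<longlongrightarrow> ln (norm (x - c))) (at x within - E)" by (simp add: \<psi>_def)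
  qed
qed

end

section \<open>Harmonic measure, Green's functions and capacity\<close>

definition sphere_fun :: "(complex \<Rightarrow> real) \<Rightarrow> real \<Rightarrow> sphere \<Rightarrow> real" where
  "sphere_fun u L p = (case p of Fin z \<Rightarrow> u z | Infty \<Rightarrow> L)"

lemma sphere_fun_simps [simp]:
  "sphere_fun u L (Fin z) = u z" "sphere_fun u L Infty = L"
  "sphere_fun u L (inf_chart w) = (if w = 0 then L else u (1 / w))"
  by (simp_all add: sphere_fun_def inf_chart_def)

lemma Fin_vimage_sphere_compl: "Fin -` sphere_compl K = - K"
  by (auto simp: sphere_compl_def)

lemma Fin_mem_sphere_compl [simp]: "Fin z \<in> sphere_compl K \<longleftrightarrow> z \<notin> K"
  by (auto simp: sphere_compl_def)

lemma Infty_mem_sphere_compl [simp]: "Infty \<in> sphere_compl K"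
  by (auto simp: sphere_compl_def)

lemma open_inf_chart_vimage:
  assumes "compact K" shows "open (inf_chart -` sphere_compl K)"
proof -
  obtain R where R: "R > 0" "\<And>w. w \<in> K \<Longrightarrow> norm w \<le> R"
    using compact_imp_bounded[OF assms] unfolding bounded_pos by blast
  have "inf_chart w \<in> sphere_compl K" if w: "w \<in> ball 0 (1 / R)" for w
  proof (cases "w = 0")
    case False
    have "norm (1 / w) > R" using w False R(1) by (simp add: norm_divide field_simps)
    hence "1 / w \<notin> K" using R(2) by force
    thus ?thesis using False by (simp add: inf_chart_def)
  qed (simp add: inf_chart_def)
  hence e: "inf_chart -` sphere_compl K = ball 0 (1 / R) \<union> (- {0} \<inter> (\<lambda>w. 1 / w) -` (- K))"
    using R(1) by (auto simp: inf_chart_def split: if_splits)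
  have "open (- {0::complex} \<inter> (\<lambda>w. 1 / w) -` (- K))"
  proof (rule continuous_open_preimage)
    show "continuous_on (- {0::complex}) (\<lambda>w. 1 / w)" by (intro continuous_intros) auto
    show "open (- K)" using assms by (simp add: compact_imp_closed open_Compl)
  qed auto
  thus ?thesis unfolding e by (intro open_Un) auto
qed

lemma harmonic_at_inf_chart:
  assumes "\<And>z. z \<notin> K \<Longrightarrow> harmonic_at (\<lambda>z. f (Fin z)) z" "w \<noteq> 0" "1 / w \<notin> K"
  shows "harmonic_at (\<lambda>w. f (inf_chart w)) w"
proof -
  have "harmonic_at (\<lambda>w. f (Fin (1 / w))) w"
    by (rule harmonic_at_compose[where u = "\<lambda>z. f (Fin z)" and f = "\<lambda>w. 1 / w", OF assms(1)[OF assms(3)]])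
       (use assms(2) in \<open>auto intro!: analytic_intros\<close>)
  moreover have "\<forall>\<^sub>F x in nhds w. f (inf_chart x) = f (Fin (1 / x))"
    using assms(2) by (intro eventually_mono[OF eventually_nhds_in_open[of "- {0}" w]]) (auto simp: inf_chart_def)
  ultimately show ?thesis by (rule harmonic_at_transform)
qed

lemma log_harmonic_inf_chart:
  assumes "log_harmonic 0 u L K" "w \<in> inf_chart -` sphere_compl K"
  shows "harmonic_at (sphere_fun u L \<circ> inf_chart) w"
proof (cases "w = 0")
  case True
  have "sphere_fun u L \<circ> inf_chart = (\<lambda>w. if w = 0 then L else u (1 / w) + 0 * ln (norm w))"
    by (auto simp: fun_eq_iff)
  thus ?thesis using assms(1) True unfolding log_harmonic_def by metis
next
  case False
  thus ?thesis
    using harmonic_at_inf_chart[of K "sphere_fun u L" w] assms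
    by (auto simp: log_harmonic_def inf_chart_def o_def)
qed

section \<open>Harmonic measure as a Perron supremum\<close>

lemma subharmonic_on_diff_harmonic:
  assumes v: "subharmonic_on v U" and u: "\<And>z. z \<in> U \<Longrightarrow> harmonic_at u z"
  shows "subharmonic_on (\<lambda>z. v z - u z) U"
  unfolding subharmonic_on_def
proof (intro conjI ballI)
  have U: "open U" and cv: "continuous_on U v" using v unfolding subharmonic_on_def by blast+
  show "open U" by fact
  have cu: "continuous_on U u" using u by (rule harmonic_at_continuous_on)
  show "continuous_on U (\<lambda>z. v z - u z)" using cv cu by (rule continuous_on_diff)
  fix z assume z: "z \<in> U"
  obtain R where R: "R > 0" "cball z R \<subseteq> U"
    "\<forall>r\<in>{0<..R}. v z \<le> 1 / (2 * pi) * integral {0..2 * pi} (\<lambda>t. v (z + of_real r * cis t))"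
    by (rule subharmonic_onE[OF v z])
  have "v z - u z \<le> 1 / (2 * pi) * integral {0..2 * pi} (\<lambda>t. v (z + of_real r * cis t) - u (z + of_real r * cis t))"
    if r: "r \<in> {0<..R}" for r
  proof -
    have circ: "z + of_real r * cis t \<in> U" for t
      using r by (intro subsetD[OF R(2)]) (simp add: dist_norm norm_mult)
    have "((\<lambda>t. u (z + of_real r * cis t)) has_integral 2 * pi * u z) {0..2 * pi}"
    proof (rule harmonic_mean_value)
      show "harmonic_at u w" if "w \<in> cball z r" for w
        using that r by (intro u subsetD[OF R(2)]) auto
    qed (use r in auto)
    moreover have "(\<lambda>t. v (z + of_real r * cis t)) integrable_on {0..2 * pi}"
      using circ by (intro integrable_continuous_real continuous_on_compose2[OF cv]) (auto intro!: continuous_intros)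
    ultimately have "integral {0..2 * pi} (\<lambda>t. v (z + of_real r * cis t) - u (z + of_real r * cis t)) =
      integral {0..2 * pi} (\<lambda>t. v (z + of_real r * cis t)) - 2 * pi * u z"
      by (subst integral_diff) (auto simp: integral_unique integrable_on_def)
    thus ?thesis using bspec[OF R(3) r] by (simp add: field_simps)
  qed
  thus "\<exists>R>0. cball z R \<subseteq> U \<and> (\<forall>r\<in>{0<..R}. v z - u z \<le>
     1 / (2 * pi) * integral {0..2 * pi} (\<lambda>t. v (z + of_real r * cis t) - u (z + of_real r * cis t)))"
    using R by (intro exI[of _ R]) auto
qed

text \<open>\<open>d\<close>, the difference of \<open>v\<close> and \<open>u\<close>, is
  subharmonic in the plane. Subharmonicity of \<open>v\<close> at \<open>Infty\<close>, read in the
  chart \<open>1 / w\<close> and carried over to large circles, supplies the mean condition of the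
  maximum principle.\<close>

lemma perron_le:
  assumes K: "compact K" "K \<noteq> {}" and u: "log_harmonic 0 u L K"
    and bd: "\<And>\<zeta>. \<zeta> \<in> K \<Longrightarrow> (u \<longlongrightarrow> \<phi> \<zeta>) (at \<zeta> within - K)"
    and v: "subharmonic_on_sphere v (sphere_compl K)"
    and bv: "\<And>\<zeta>. \<zeta> \<in> K \<Longrightarrow> Limsup (at \<zeta> within - K) (\<lambda>w. ereal (v (Fin w))) \<le> ereal (\<phi> \<zeta>)"
    and p: "p \<in> sphere_compl K"
  shows "v p \<le> sphere_fun u L p"
proof -
  have v1: "subharmonic_on (\<lambda>z. v (Fin z)) (- K)"
    and v2: "subharmonic_on (\<lambda>w. v (inf_chart w)) (inf_chart -` sphere_compl K)"
    using v unfolding subharmonic_on_sphere_def Fin_vimage_sphere_compl o_def by simp_all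
  define d where "d = (\<lambda>z. v (Fin z) - u z)"
  have hu: "\<And>z. z \<in> - K \<Longrightarrow> harmonic_at u z" using u unfolding log_harmonic_def by blast
  have d: "subharmonic_on d (- K)" unfolding d_def by (rule subharmonic_on_diff_harmonic[OF v1 hu])
  have zero: "0 \<in> inf_chart -` sphere_compl K" by (simp add: inf_chart_def)
  have c2: "continuous_on (inf_chart -` sphere_compl K) (\<lambda>w. v (inf_chart w))"
    and o2: "open (inf_chart -` sphere_compl K)"
    using v2 unfolding subharmonic_on_def by blast+
  have "isCont (\<lambda>w. v (inf_chart w)) 0" using c2 o2 zero continuous_on_eq_continuous_at by blast
  hence "((\<lambda>w. v (inf_chart w)) \<longlongrightarrow> v Infty) (at 0)" by (simp add: isCont_def inf_chart_def)
  hence "((\<lambda>w. v (Fin (inverse w))) \<longlongrightarrow> v Infty) (at 0)"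
    by (rule Lim_transform_eventually) (auto simp: eventually_at_filter inf_chart_def inverse_eq_divide)
  from this[unfolded at_to_infinity filterlim_filtermap]
  have "((\<lambda>z. v (Fin z)) \<longlongrightarrow> v Infty) at_infinity" by simp
  hence lim: "(d \<longlongrightarrow> v Infty - L) at_infinity"
    using log_harmonic_tendsto[OF u] unfolding d_def by (intro tendsto_diff) simp_all
  obtain R where R: "R > 0" "cball 0 R \<subseteq> inf_chart -` sphere_compl K"
    "\<forall>r\<in>{0<..R}. v (inf_chart 0) \<le>
       1 / (2 * pi) * integral {0..2 * pi} (\<lambda>t. v (inf_chart (0 + of_real r * cis t)))"
    by (rule subharmonic_onE[OF v2 zero])
  have mean: "\<forall>\<^sub>F \<rho> in at_top. v Infty - L \<le> 1 / (2 * pi) * integral {0..2 * pi} (\<lambda>t. d (of_real \<rho> * cis t))"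
    using log_harmonic_mean_infinity[OF u] eventually_gt_at_top[of "1 / R"] eventually_gt_at_top[of 0]
  proof eventually_elim
    case (elim \<rho>)
    define r where "r = 1 / \<rho>"
    have r: "r \<in> {0<..R}" "r > 0" using elim R(1) by (auto simp: r_def field_simps)
    have circ: "of_real r * cis t \<in> inf_chart -` sphere_compl K" for t
      using r by (intro subsetD[OF R(2)]) (simp add: norm_mult)
    have "continuous_on {0..2 * pi} (\<lambda>t. v (inf_chart (of_real r * cis t)))"
      using circ by (intro continuous_on_compose2[OF c2]) (auto intro!: continuous_intros)
    hence int: "(\<lambda>t. v (inf_chart (of_real r * cis t))) integrable_on {0..2 * pi}"
      by (rule integrable_continuous_real)
    define I where "I = integral {0..2 * pi} (\<lambda>t. v (inf_chart (of_real r * cis t)))"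
    have eq: "inf_chart (of_real r * cis t) = Fin (1 / (of_real r * cis t))" for t
      using r(2) by (simp add: inf_chart_def)
    have "((\<lambda>t. v (Fin (1 / (of_real r * cis t)))) has_integral I) {0..2 * pi}"
      using integrable_integral[OF int] unfolding I_def eq .
    hence "((\<lambda>t. v (Fin (of_real (1 / r) * cis t))) has_integral I) {0..2 * pi}"
      by (rule mean_inf_chart)
    hence hv: "((\<lambda>t. v (Fin (of_real \<rho> * cis t))) has_integral I) {0..2 * pi}" by (simp add: r_def)
    have "((\<lambda>t. d (of_real \<rho> * cis t)) has_integral I - 2 * pi * L) {0..2 * pi}"
      unfolding d_def using has_integral_diff[OF hv elim(1)] by simp
    hence e: "integral {0..2 * pi} (\<lambda>t. d (of_real \<rho> * cis t)) = I - 2 * pi * L" by (rule integral_unique)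
    have "v Infty \<le> 1 / (2 * pi) * I"
      using bspec[OF R(3) r(1)] unfolding I_def by (simp add: inf_chart_def)
    thus ?case unfolding e by (simp add: field_simps)
  qed
  have bdd: "\<forall>\<^sub>F w in at \<zeta> within -K. d w < \<epsilon>" if "\<zeta> \<in> K" "\<epsilon> > 0" for \<zeta> \<epsilon>
  proof -
    have "Limsup (at \<zeta> within - K) (\<lambda>w. ereal (v (Fin w))) < ereal (\<phi> \<zeta> + \<epsilon>/2)"
      by (rule le_less_trans[OF bv[OF that(1)]]) (use that(2) in simp)
    hence "\<forall>\<^sub>F w in at \<zeta> within -K. v (Fin w) < \<phi> \<zeta> + \<epsilon>/2" using Limsup_lessD by fastforce
    moreover have "\<forall>\<^sub>F w in at \<zeta> within -K. u w > \<phi> \<zeta> - \<epsilon>/2"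
      using bd[OF that(1)] by (rule order_tendstoD) (use that(2) in simp)
    ultimately show ?thesis by eventually_elim (simp add: d_def)
  qed
  have le: "d z \<le> 0" if "z \<notin> K" for z
    by (rule subharmonic_max_principle[OF K d lim mean bdd that])
  show ?thesis
  proof (cases p)
    case (Fin z)
    thus ?thesis using le[of z] p by (simp add: d_def)
  next
    case Infty
    obtain R where R: "\<And>w. w \<in> K \<Longrightarrow> norm w \<le> R"
      using compact_imp_bounded[OF K(1)] unfolding bounded_iff by blast
    have "\<forall>\<^sub>F z in at_infinity. d z \<le> 0"
      unfolding eventually_at_infinity
    proof (intro exI allI impI)
      fix z :: complex assume "R + 1 \<le> norm z"
      thus "d z \<le> 0" using R[of z] by (intro le) auto
    qed
    hence "v Infty - L \<le> 0" using tendsto_upperbound[OF lim] trivial_limit_at_infinity by blast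
    thus ?thesis using Infty by simp
  qed
qed

text \<open>The solution is itself a competitor, so the supremum is a maximum;
  \<open>perron_le\<close> bounds all other competitors.\<close>

lemma harmonic_measure_eq:
  assumes K: "compact K" "K \<noteq> {}" and u: "log_harmonic 0 u L K"
    and bd: "\<And>\<zeta>. \<zeta> \<in> K \<Longrightarrow> (u \<longlongrightarrow> indicator A \<zeta>) (at \<zeta> within - K)"
    and p: "p \<in> sphere_compl K"
  shows "harmonic_measure p A K = sphere_fun u L p"
  unfolding harmonic_measure_def
proof (rule cSup_eq_maximum)
  have sub: "subharmonic_on_sphere (sphere_fun u L) (sphere_compl K)"
    unfolding subharmonic_on_sphere_def
  proof (intro conjI harmonic_at_imp_subharmonic_on)
    show "open (Fin -` sphere_compl K)" "open (inf_chart -` sphere_compl K)"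
      using K(1) open_inf_chart_vimage by (auto simp: Fin_vimage_sphere_compl compact_imp_closed open_Compl)
    show "harmonic_at (sphere_fun u L \<circ> Fin) z" if "z \<in> Fin -` sphere_compl K" for z
      using u that by (simp add: log_harmonic_def o_def)
    show "harmonic_at (sphere_fun u L \<circ> inf_chart) w" if "w \<in> inf_chart -` sphere_compl K" for w
      by (rule log_harmonic_inf_chart[OF u that])
  qed
  have "Limsup (at \<zeta> within - K) (\<lambda>w. ereal (sphere_fun u L (Fin w))) \<le> ereal (indicator A \<zeta>)" if "\<zeta> \<in> K" for \<zeta>
  proof (cases "at \<zeta> within - K = bot")
    \<comment> \<open>At an interior point of \<open>K\<close> the filter is trivial and the
      condition is void.\<close>
    case True
    thus ?thesis by (simp add: Limsup_bounded)
  next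
    case False
    have "((\<lambda>w. ereal (sphere_fun u L (Fin w))) \<longlongrightarrow> ereal (indicator A \<zeta>)) (at \<zeta> within - K)"
      using bd[OF that] by simp
    from lim_imp_Limsup[OF False this] show ?thesis by simp
  qed
  thus "sphere_fun u L p \<in> {v p |v. subharmonic_on_sphere v (sphere_compl K) \<and>
     (\<forall>\<zeta>\<in>K. Limsup (at \<zeta> within - K) (\<lambda>w. ereal (v (Fin w))) \<le> ereal (indicator A \<zeta>))}"
    using sub by blast
next
  fix x assume "x \<in> {v p |v. subharmonic_on_sphere v (sphere_compl K) \<and>
     (\<forall>\<zeta>\<in>K. Limsup (at \<zeta> within - K) (\<lambda>w. ereal (v (Fin w))) \<le> ereal (indicator A \<zeta>))}"
  then obtain v where v: "x = v p" "subharmonic_on_sphere v (sphere_compl K)"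
    "\<forall>\<zeta>\<in>K. Limsup (at \<zeta> within - K) (\<lambda>w. ereal (v (Fin w))) \<le> ereal (indicator A \<zeta>)" by blast
  show "x \<le> sphere_fun u L p"
    unfolding v(1) using v(3) by (intro perron_le[OF K u bd v(2) _ p]) auto
qed

section \<open>Uniqueness of Green's functions, and capacity\<close>

lemma harmonic_at_translate:
  "harmonic_at u (c + w) \<Longrightarrow> harmonic_at (\<lambda>w. u (c + w)) w"
  by (rule harmonic_at_compose[where f = "\<lambda>w. c + w"]) (auto intro!: analytic_intros)

lemma harmonic_at_chart_transfer:
  assumes g: "harmonic_on_sphere g (sphere_compl K - {p})" and q: "q \<in> sphere_compl K - {p}"
  shows "harmonic_at (\<lambda>w. g (chart_at q w)) 0" "\<forall>\<^sub>F w in nhds 0. chart_at q w \<noteq> p"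
proof -
  have h: "harmonic_on (g \<circ> Fin) (Fin -` (sphere_compl K - {p}))"
    "harmonic_on (g \<circ> inf_chart) (inf_chart -` (sphere_compl K - {p}))"
    using g unfolding harmonic_on_sphere_def by auto
  show "harmonic_at (\<lambda>w. g (chart_at q w)) 0"
  proof (cases q)
    case (Fin c)
    hence "harmonic_at (g \<circ> Fin) (c + 0)" using q by (intro harmonic_on_imp_harmonic_at[OF h(1)]) auto
    hence "harmonic_at (\<lambda>w. (g \<circ> Fin) (c + w)) 0" by (rule harmonic_at_translate)
    thus ?thesis using Fin by (simp add: chart_at_def)
  next
    case Infty
    hence "harmonic_at (g \<circ> inf_chart) 0"
      using q by (intro harmonic_on_imp_harmonic_at[OF h(2)]) (auto simp: inf_chart_def)
    thus ?thesis using Infty by (simp add: chart_at_def o_def)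
  qed
  show "\<forall>\<^sub>F w in nhds 0. chart_at q w \<noteq> p"
  proof (cases q)
    case (Fin c)
    show ?thesis
    proof (cases p)
      case p: (Fin d)
      have "0 \<noteq> d - c" using q Fin p by auto
      from t1_space_nhds[OF this] show ?thesis
        by eventually_elim (use Fin p in \<open>auto simp: chart_at_def\<close>)
    qed (use Fin in \<open>simp add: chart_at_def\<close>)
  next
    case Infty
    then obtain d where d: "p = Fin d" using q by (cases p) auto
    show ?thesis
    proof (cases "d = 0")
      case True
      thus ?thesis using Infty d by (simp add: chart_at_def inf_chart_def)
    next
      case False
      hence "0 \<noteq> 1 / d" by auto
      from t1_space_nhds[OF this] show ?thesis
        by eventually_elim (use Infty d False in \<open>auto simp: chart_at_def inf_chart_def eq_divide_eq\<close>)
    qed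
  qed
qed

text \<open>The logarithmic singularities at the pole cancel. The difference, given the value
  \<open>h1 0 - h2 0\<close> there, is harmonic on the whole complement of \<open>K\<close> with
  zero boundary values.\<close>

lemma green_function_unique:
  assumes K: "compact K" "K \<noteq> {}" and p: "p \<in> sphere_compl K"
    and g: "is_green_function K p g1" "is_green_function K p g2"
    and q: "q \<in> sphere_compl K - {p}"
  shows "g1 q = g2 q"
proof -
  obtain r1 h1 where h1: "r1 > 0" "harmonic_on h1 (ball 0 r1)"
    "\<forall>w\<in>ball 0 r1 - {0}. g1 (chart_at p w) = h1 w - ln (norm w)"
    using g(1) unfolding is_green_function_def by blast
  obtain r2 h2 where h2: "r2 > 0" "harmonic_on h2 (ball 0 r2)"
    "\<forall>w\<in>ball 0 r2 - {0}. g2 (chart_at p w) = h2 w - ln (norm w)"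
    using g(2) unfolding is_green_function_def by blast
  have hg: "harmonic_on_sphere g1 (sphere_compl K - {p})" "harmonic_on_sphere g2 (sphere_compl K - {p})"
    using g unfolding is_green_function_def by blast+
  define \<delta> where "\<delta> = (\<lambda>q. if q = p then h1 0 - h2 0 else g1 q - g2 q)"
  have har: "harmonic_at (\<lambda>w. \<delta> (chart_at q w)) 0" if q: "q \<in> sphere_compl K" for q
  proof (cases "q = p")
    case True
    have "harmonic_at (\<lambda>w. h1 w - h2 w) 0"
      using h1(1) h2(1) by (intro harmonic_at_diff harmonic_on_imp_harmonic_at[OF h1(2)]
        harmonic_on_imp_harmonic_at[OF h2(2)]) auto
    moreover have "\<forall>\<^sub>F w in nhds 0. \<delta> (chart_at q w) = h1 w - h2 w"
    proof (rule eventually_mono[OF eventually_nhds_in_open[of "ball 0 (min r1 r2)"]])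
      fix w :: complex assume w: "w \<in> ball 0 (min r1 r2)"
      show "\<delta> (chart_at q w) = h1 w - h2 w"
      proof (cases "w = 0")
        case True
        thus ?thesis using \<open>q = p\<close> by (cases p) (auto simp: \<delta>_def chart_at_def inf_chart_def)
      next
        case False
        hence "chart_at p w \<noteq> p" by (cases p) (auto simp: chart_at_def inf_chart_def)
        thus ?thesis using h1(3) h2(3) w False \<open>q = p\<close> by (simp add: \<delta>_def)
      qed
    qed (use h1(1) h2(1) in auto)
    ultimately show ?thesis by (rule harmonic_at_transform)
  next
    case False
    hence q': "q \<in> sphere_compl K - {p}" using q by simp
    have "harmonic_at (\<lambda>w. g1 (chart_at q w) - g2 (chart_at q w)) 0"
      by (intro harmonic_at_diff harmonic_at_chart_transfer(1)[OF hg(1) q'] harmonic_at_chart_transfer(1)[OF hg(2) q'])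
    moreover have "\<forall>\<^sub>F w in nhds 0. \<delta> (chart_at q w) = g1 (chart_at q w) - g2 (chart_at q w)"
      using harmonic_at_chart_transfer(2)[OF hg(1) q'] by eventually_elim (simp add: \<delta>_def)
    ultimately show ?thesis by (rule harmonic_at_transform)
  qed
  have d: "log_harmonic 0 (\<lambda>z. \<delta> (Fin z)) (\<delta> Infty) K"
    unfolding log_harmonic_def
  proof (intro conjI ballI)
    fix z assume "z \<in> - K"
    hence "harmonic_at (\<lambda>w. \<delta> (Fin (z + w))) (- z + z)" using har[of "Fin z"] by (simp add: chart_at_def)
    from harmonic_at_translate[OF this]
    show "harmonic_at (\<lambda>z. \<delta> (Fin z)) z" by simp
  next
    have "(\<lambda>w. \<delta> (chart_at Infty w)) = (\<lambda>w. if w = 0 then \<delta> Infty else \<delta> (Fin (1 / w)) + 0 * ln (norm w))"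
      by (auto simp: chart_at_def inf_chart_def)
    thus "harmonic_at (\<lambda>w. if w = 0 then \<delta> Infty else \<delta> (Fin (1 / w)) + 0 * ln (norm w)) 0"
      using har[of Infty] by simp
  qed
  have bd: "((\<lambda>z. \<delta> (Fin z)) \<longlongrightarrow> 0) (at \<zeta> within - K)" if \<zeta>: "\<zeta> \<in> K" for \<zeta>
  proof -
    have "((\<lambda>w. g1 (Fin w) - g2 (Fin w)) \<longlongrightarrow> 0 - 0) (at \<zeta> within - K)"
      using g \<zeta> unfolding is_green_function_def by (intro tendsto_diff) auto
    moreover have "\<forall>\<^sub>F w in at \<zeta> within - K. g1 (Fin w) - g2 (Fin w) = \<delta> (Fin w)"
    proof (cases p)
      case (Fin c)
      hence "\<zeta> \<noteq> c" using p \<zeta> by auto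
      from t1_space_nhds[OF this] have "\<forall>\<^sub>F w in at \<zeta> within - K. w \<noteq> c"
        by (rule filter_leD[OF at_within_le_nhds])
      thus ?thesis by eventually_elim (simp add: \<delta>_def Fin)
    qed (simp add: \<delta>_def)
    ultimately show ?thesis using Lim_transform_eventually by fastforce
  qed
  have "\<delta> q = 0"
  proof (cases q)
    case (Fin z)
    have "z \<notin> K" using q Fin by auto
    from log_harmonic_unique(1)[OF K d log_harmonic_const[of 0] bd _ this] show ?thesis using Fin by simp
  next
    case Infty
    from log_harmonic_unique(2)[OF K d log_harmonic_const[of 0] bd] show ?thesis using Infty by simp
  qed
  thus ?thesis using q by (simp add: \<delta>_def)
qed

text \<open>Uniqueness gives \<open>THE\<close> a meaning. The pole is excluded because
  \<open>is_green_function\<close> leaves the value \<open>g p\<close> free.\<close>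

lemma green_eq:
  assumes "compact K" "K \<noteq> {}" "p \<in> sphere_compl K" "is_green_function K p g" "q \<in> sphere_compl K - {p}"
  shows "green K q p = g q"
  unfolding green_def
proof (rule the_equality)
  show "\<exists>g'. is_green_function K p g' \<and> g' q = g q" using assms(4) by blast
  show "x = g q" if "\<exists>g. is_green_function K p g \<and> g q = x" for x
    using that green_function_unique[OF assms(1-3) _ assms(4,5)] by blast
qed

text \<open>The value 0 assigned to the pole \<open>Infty\<close> is arbitrary.\<close>

lemma is_green_function_infinity:
  assumes K: "compact K" and G: "log_harmonic 1 G \<gamma> K" "\<And>x. x \<in> K \<Longrightarrow> (G \<longlongrightarrow> 0) (at x within - K)"
  shows "is_green_function K Infty (sphere_fun G 0)"
  unfolding is_green_function_def harmonic_on_sphere_def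
proof (intro conjI ballI)
  have G1: "harmonic_at G z" if "z \<notin> K" for z using G(1) that unfolding log_harmonic_def by blast
  have "Fin -` (sphere_compl K - {Infty}) = - K" by auto
  thus "harmonic_on (sphere_fun G 0 \<circ> Fin) (Fin -` (sphere_compl K - {Infty}))"
    using K G1 by (auto intro!: harmonic_at_imp_harmonic_on simp: o_def compact_imp_closed open_Compl)
  have e: "inf_chart -` (sphere_compl K - {Infty}) = inf_chart -` sphere_compl K \<inter> - {0}"
    by (auto simp: inf_chart_def)
  show "harmonic_on (sphere_fun G 0 \<circ> inf_chart) (inf_chart -` (sphere_compl K - {Infty}))"
    unfolding e
  proof (rule harmonic_at_imp_harmonic_on)
    show "open (inf_chart -` sphere_compl K \<inter> - {0})" by (intro open_Int open_inf_chart_vimage K) auto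
    fix w assume "w \<in> inf_chart -` sphere_compl K \<inter> - {0}"
    thus "harmonic_at (sphere_fun G 0 \<circ> inf_chart) w"
      using harmonic_at_inf_chart[of K "sphere_fun G 0" w] G1 by (auto simp: inf_chart_def o_def)
  qed
  define h where "h = (\<lambda>w. if w = 0 then \<gamma> else G (1 / w) + 1 * ln (norm w))"
  have "harmonic_at h 0" using G(1) unfolding log_harmonic_def h_def by blast
  from harmonic_at_eventually[OF this] obtain r where r: "r > 0" "\<And>w. dist w 0 < r \<Longrightarrow> harmonic_at h w"
    unfolding eventually_nhds_metric by blast
  show "\<exists>r>0. \<exists>h. harmonic_on h (ball 0 r) \<and>
      (\<forall>w\<in>ball 0 r - {0}. sphere_fun G 0 (chart_at Infty w) = h w - ln (norm w))"
  proof (intro exI conjI)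
    show "harmonic_on h (ball 0 r)" using r(2) by (intro harmonic_at_imp_harmonic_on) (auto simp: dist_commute)
    show "\<forall>w\<in>ball 0 r - {0}. sphere_fun G 0 (chart_at Infty w) = h w - ln (norm w)"
      by (auto simp: h_def chart_at_def)
  qed (rule r(1))
  show "((\<lambda>w. sphere_fun G 0 (Fin w)) \<longlongrightarrow> 0) (at \<zeta> within - K)" if "\<zeta> \<in> K" for \<zeta>
    using G(2)[OF that] by simp
qed

text \<open>\<gamma> is Robin's constant: the quotient in the definition of capacity is
  \<open>exp (- (G z - ln (norm z)))\<close>, and \<open>G z - ln (norm z)\<close> tends to
  \<gamma>.\<close>

lemma capacity_eq:
  assumes K: "compact K" "K \<noteq> {}"
    and G: "log_harmonic 1 G \<gamma> K" "\<And>x. x \<in> K \<Longrightarrow> (G \<longlongrightarrow> 0) (at x within - K)"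
  shows "capacity K = exp (- \<gamma>)"
proof -
  have g: "green K (Fin z) Infty = G z" if "z \<notin> K" for z
    using green_eq[OF K _ is_green_function_infinity[OF K(1) G], of "Fin z"] that by auto
  obtain R where R: "\<And>w. w \<in> K \<Longrightarrow> norm w \<le> R"
    using compact_imp_bounded[OF K(1)] unfolding bounded_iff by blast
  have ev: "\<forall>\<^sub>F z in at_infinity. z \<notin> K \<and> z \<noteq> 0"
    unfolding eventually_at_infinity
    by (rule exI[of _ "max R 0 + 1"]) (use R in force)
  have "((\<lambda>z. exp (- (G z - 1 * ln (norm z)))) \<longlongrightarrow> exp (- \<gamma>)) at_infinity"
    by (intro tendsto_exp tendsto_minus log_harmonic_tendsto[OF G(1)])
  moreover have "\<forall>\<^sub>F z in at_infinity. exp (- (G z - 1 * ln (norm z))) =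
      norm z / abs_complex_green (Fin z) Infty K"
    using ev
  proof eventually_elim
    case (elim z)
    thus ?case unfolding abs_complex_green_def using g[of z] by (simp add: exp_diff)
  qed
  ultimately have "((\<lambda>z. norm z / abs_complex_green (Fin z) Infty K) \<longlongrightarrow> exp (- \<gamma>)) at_infinity"
    by (rule Lim_transform_eventually)
  thus ?thesis unfolding capacity_def by (rule tendsto_Lim[OF trivial_limit_at_infinity])
qed

lemma log_harmonic_ln: "log_harmonic 1 (\<lambda>z. ln (norm (z - c))) 0 {c}"
  unfolding log_harmonic_def
proof (intro conjI ballI)
  show "harmonic_at (\<lambda>z. ln (norm (z - c))) z" if "z \<in> - {c}" for z
    using that by (intro harmonic_at_ln_norm) (auto intro!: analytic_intros)
  have "harmonic_at (\<lambda>w. ln (norm (1 - c * w))) 0"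
    by (intro harmonic_at_ln_norm) (auto intro!: analytic_intros)
  moreover have "\<forall>\<^sub>F w in nhds 0. (if w = 0 then 0 else ln (norm (1 / w - c)) + 1 * ln (norm w)) = ln (norm (1 - c * w))"
  proof -
    have "open {w. norm (c * w) < 1}" by (intro open_Collect_less continuous_intros)
    hence "\<forall>\<^sub>F w in nhds 0. w \<in> {w. norm (c * w) < 1}" by (intro eventually_nhds_in_open) auto
    hence "\<forall>\<^sub>F w in nhds 0. norm (c * w) < 1" by simp
    thus ?thesis
    proof eventually_elim
      case (elim w)
      hence nz: "1 - c * w \<noteq> 0" by (metis eq_iff_diff_eq_0 norm_one less_irrefl)
      show ?case
      proof (cases "w = 0")
        case False
        have "1 - c * w = (1 / w - c) * w" using False by (simp add: field_simps)
        moreover have "1 / w - c \<noteq> 0" using nz False calculation by auto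
        ultimately show ?thesis using False by (simp add: norm_mult ln_mult)
      qed simp
    qed
  qed
  ultimately show "harmonic_at (\<lambda>w. if w = 0 then 0 else ln (norm (1 / w - c)) + 1 * ln (norm w)) 0"
    by (rule harmonic_at_transform)
qed

text \<open>The Green's function with pole \<open>c\<close> is
  \<open>q z + G z - ln (norm (z - c))\<close>: the boundary values cancel on \<open>K\<close>, the
  logarithmic terms cancel at infinity, and \<open>T + \<gamma>\<close> is left there.\<close>

lemma green_finite_pole_at_infinity:
  assumes K: "compact K" "K \<noteq> {}" and c: "c \<notin> K"
    and G: "log_harmonic 1 G \<gamma> K" "\<And>x. x \<in> K \<Longrightarrow> (G \<longlongrightarrow> 0) (at x within - K)"
    and q: "log_harmonic 0 q T K" "\<And>x. x \<in> K \<Longrightarrow> (q \<longlongrightarrow> ln (norm (x - c))) (at x within - K)"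
  shows "green K Infty (Fin c) = T + \<gamma>"
proof -
  define u where "u = (\<lambda>z. q z + G z - ln (norm (z - c)))"
  have qG: "log_harmonic 1 (\<lambda>z. q z + G z) (T + \<gamma>) K" using log_harmonic_add[OF q(1) G(1)] by simp
  have u: "log_harmonic 0 u (T + \<gamma>) (insert c K)"
    using log_harmonic_diff[OF log_harmonic_mono[OF qG] log_harmonic_mono[OF log_harmonic_ln[of c]]]
    unfolding u_def by auto
  have u1: "harmonic_at u z" if "z \<notin> K" "z \<noteq> c" for z using u that unfolding log_harmonic_def by blast
  have cK: "compact (insert c K)" using K(1) by (rule compact_insert)
  have "is_green_function K (Fin c) (sphere_fun u (T + \<gamma>))"
    unfolding is_green_function_def harmonic_on_sphere_def
  proof (intro conjI ballI)
    \<comment> \<open>Away from its pole the function is treated as one on the complement of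
      \<open>insert c K\<close>.\<close>
    have e: "sphere_compl K - {Fin c} = sphere_compl (insert c K)" by (auto simp: sphere_compl_def)
    show "harmonic_on (sphere_fun u (T + \<gamma>) \<circ> Fin) (Fin -` (sphere_compl K - {Fin c}))"
      unfolding e Fin_vimage_sphere_compl using cK u1
      by (intro harmonic_at_imp_harmonic_on) (auto simp: o_def compact_imp_closed open_Compl)
    show "harmonic_on (sphere_fun u (T + \<gamma>) \<circ> inf_chart) (inf_chart -` (sphere_compl K - {Fin c}))"
      unfolding e by (intro harmonic_at_imp_harmonic_on open_inf_chart_vimage cK log_harmonic_inf_chart[OF u])
    obtain r where r: "r > 0" "ball c r \<subseteq> - K"
      using K(1) c by (metis ComplI compact_imp_closed open_Compl open_contains_ball)
    show "\<exists>r>0. \<exists>h. harmonic_on h (ball 0 r) \<and>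
      (\<forall>w\<in>ball 0 r - {0}. sphere_fun u (T + \<gamma>) (chart_at (Fin c) w) = h w - ln (norm w))"
    proof (intro exI conjI)
      show "harmonic_on (\<lambda>w. q (c + w) + G (c + w)) (ball 0 r)"
      proof (intro harmonic_at_imp_harmonic_on open_ball)
        fix w :: complex assume "w \<in> ball 0 r"
        hence "c + w \<in> - K" using r(2) by (intro subsetD[OF r(2)]) (simp add: dist_norm)
        hence "harmonic_at (\<lambda>z. q z + G z) (c + w)" using qG unfolding log_harmonic_def by blast
        from harmonic_at_translate[OF this] show "harmonic_at (\<lambda>w. q (c + w) + G (c + w)) w" .
      qed
      show "\<forall>w\<in>ball 0 r - {0}. sphere_fun u (T + \<gamma>) (chart_at (Fin c) w) = q (c + w) + G (c + w) - ln (norm w)"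
        by (auto simp: u_def chart_at_def)
    qed (rule r(1))
    fix \<zeta> assume \<zeta>: "\<zeta> \<in> K"
    have "(u \<longlongrightarrow> ln (norm (\<zeta> - c)) + 0 - ln (norm (\<zeta> - c))) (at \<zeta> within - K)"
      unfolding u_def using \<zeta> c by (intro tendsto_intros q(2) G(2)) auto
    thus "((\<lambda>w. sphere_fun u (T + \<gamma>) (Fin w)) \<longlongrightarrow> 0) (at \<zeta> within - K)" by simp
  qed
  from green_eq[OF K _ this, of Infty] c show ?thesis by simp
qed

section \<open>Symmetry of the Green's function\<close>

lemma riemann_sum_lipschitz:
  fixes f :: "real \<Rightarrow> real"
  assumes lip: "\<And>s t. s \<in> {0..b} \<Longrightarrow> t \<in> {0..b} \<Longrightarrow> \<bar>f s - f t\<bar> \<le> C * \<bar>s - t\<bar>" and b: "b > 0"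
    and cont: "continuous_on {0..b} f" and N: "N > 0"
  shows "\<bar>integral {0..b} f - b / real N * (\<Sum>k<N. f (b * real k / real N))\<bar> \<le> C * b\<^sup>2 / real N"
proof -
  define h where "h = b / real N"
  have h: "h > 0" "h * real N = b" using b N by (simp_all add: h_def)
  have C: "C \<ge> 0" using lip[of 0 b] b by (smt (verit) atLeastAtMost_iff zero_le_mult_iff)
  have "\<bar>integral {0..h * real n} f - h * (\<Sum>k<n. f (h * real k))\<bar> \<le> real n * (C * h\<^sup>2)" if "n \<le> N" for n
    using that
  proof (induction n)
    case 0 thus ?case by simp
  next
    case (Suc n)
    define x where "x = h * real n"
    define y where "y = h * real (Suc n)"
    have xy: "0 \<le> x" "x \<le> y" "y - x = h" "y \<le> b"
      using h Suc.prems mult_left_mono[of "real (Suc n)" "real N" h] by (auto simp: x_def y_def algebra_simps)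
    have int: "f integrable_on {0..y}"
      by (rule integrable_continuous_real[OF continuous_on_subset[OF cont]]) (use xy in auto)
    have int': "f integrable_on {x..y}"
      by (rule integrable_continuous_real[OF continuous_on_subset[OF cont]]) (use xy in auto)
    have split: "integral {0..y} f = integral {0..x} f + integral {x..y} f"
      using Henstock_Kurzweil_Integration.integral_combine[OF xy(1,2) int] by simp
    have "\<bar>integral {x..y} f - h * f x\<bar> \<le> C * h\<^sup>2"
    proof -
      have "integral {x..y} (\<lambda>t. f t - f x) = integral {x..y} f - h * f x"
        using xy by (subst Henstock_Kurzweil_Integration.integral_diff[OF int']) auto
      moreover have "norm (integral {x..y} (\<lambda>t. f t - f x)) \<le> (C * h) * (y - x)"
      proof (rule integral_bound[OF xy(2)])
        show "continuous_on {x..y} (\<lambda>t. f t - f x)"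
          by (intro continuous_intros continuous_on_subset[OF cont]) (use xy in auto)
        fix t assume t: "t \<in> {x..y}"
        have "\<bar>f t - f x\<bar> \<le> C * \<bar>t - x\<bar>" using t xy by (intro lip) auto
        also have "\<dots> \<le> C * h" using t xy C by (intro mult_left_mono) auto
        finally show "norm (f t - f x) \<le> C * h" by simp
      qed
      ultimately show ?thesis using xy by (simp add: power2_eq_square mult.assoc)
    qed
    moreover have "\<bar>integral {0..x} f - h * (\<Sum>k<n. f (h * real k))\<bar> \<le> real n * (C * h\<^sup>2)"
      using Suc by (simp add: x_def)
    moreover have "h * (\<Sum>k<Suc n. f (h * real k)) = h * (\<Sum>k<n. f (h * real k)) + h * f x"
      by (simp add: x_def distrib_left)
    moreover have "real (Suc n) * (C * h\<^sup>2) = real n * (C * h\<^sup>2) + C * h\<^sup>2" by (simp add: distrib_right)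
    ultimately show ?case unfolding y_def[symmetric] split by linarith
  qed
  from this[of N] have "\<bar>integral {0..b} f - h * (\<Sum>k<N. f (h * real k))\<bar> \<le> real N * (C * h\<^sup>2)"
    using h by simp
  moreover have "real N * (C * h\<^sup>2) = C * b\<^sup>2 / real N" using N by (simp add: h_def power2_eq_square)
  moreover have "h * real k = b * real k / real N" for k by (simp add: h_def)
  ultimately show ?thesis by (simp add: h_def)
qed

lemma abs_ln_diff_le:
  fixes a b d :: real
  assumes "a \<ge> d" "b \<ge> d" "d > 0" shows "\<bar>ln a - ln b\<bar> \<le> \<bar>a - b\<bar> / d"
proof -
  have *: "ln a - ln b \<le> \<bar>a - b\<bar> / d" if "a \<ge> d" "b \<ge> d" for a b
  proof -
    have "ln a - ln b = ln (a / b)" using that assms(3) by (subst ln_div) auto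
    also have "\<dots> \<le> a / b - 1" using that assms(3) by (intro ln_le_minus_one) auto
    also have "\<dots> = (a - b) / b" using that assms(3) by (simp add: field_simps)
    also have "\<dots> \<le> \<bar>a - b\<bar> / b" using that assms(3) by (intro divide_right_mono) auto
    also have "\<dots> \<le> \<bar>a - b\<bar> / d" using that assms(3) by (intro divide_left_mono) auto
    finally show ?thesis .
  qed
  show ?thesis using *[OF assms(1,2)] *[OF assms(2,1)] by (simp add: abs_le_iff abs_minus_commute[of b a])
qed

lemma circle_lipschitz:
  assumes "r \<ge> 0"
  shows "norm ((c + of_real r * cis s) - (c + of_real r * cis t)) \<le> r * \<bar>s - t\<bar>"
proof -
  have "norm (cis s - cis t) \<le> \<bar>s - t\<bar>"
  proof -
    have "cis s - cis t = cis t * (cis (s - t) - 1)" by (simp add: algebra_simps cis_mult)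
    hence "norm (cis s - cis t) = norm (exp (\<i> * of_real (s - t)) - 1)"
      by (simp add: norm_mult cis_conv_exp)
    moreover have "2 * \<bar>sin ((s - t) / 2)\<bar> \<le> 2 * \<bar>(s - t) / 2\<bar>"
      by (intro mult_left_mono abs_sin_x_le_abs_x) simp
    ultimately show ?thesis using dist_exp_i_1[of "s - t"] by simp
  qed
  hence "r * norm (cis s - cis t) \<le> r * \<bar>s - t\<bar>" using assms by (intro mult_left_mono)
  moreover have "norm ((c + of_real r * cis s) - (c + of_real r * cis t)) = r * norm (cis s - cis t)"
  proof -
    have "(c + of_real r * cis s) - (c + of_real r * cis t) = of_real r * (cis s - cis t)"
      by (simp add: algebra_simps)
    thus ?thesis using assms by (simp only: norm_mult norm_of_real abs_of_nonneg)
  qed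
  ultimately show ?thesis by simp
qed

text \<open>\<open>Q c\<close> solves the Dirichlet problem with boundary values \<open>ln |x - c|\<close>, and \<open>T c\<close> is its value at
  infinity, that is, the integral of \<open>ln |x - c|\<close> against the harmonic measure at infinity.\<close>

locale green_domain =
  fixes K :: "complex set" and G :: "complex \<Rightarrow> real" and \<gamma> :: real
    and Q :: "complex \<Rightarrow> complex \<Rightarrow> real" and T :: "complex \<Rightarrow> real"
  assumes K: "compact K" "K \<noteq> {}" and K_real: "\<And>z. z \<in> K \<Longrightarrow> Im z = 0"
    and G: "log_harmonic 1 G \<gamma> K" "\<And>x. x \<in> K \<Longrightarrow> (G \<longlongrightarrow> 0) (at x within - K)"
    and Q: "\<And>c. c \<notin> K \<Longrightarrow> log_harmonic 0 (Q c) (T c) K"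
      "\<And>c x. c \<notin> K \<Longrightarrow> x \<in> K \<Longrightarrow> (Q c \<longlongrightarrow> ln (norm (x - c))) (at x within - K)"
begin

lemma open_compl: "open (- K)" using K(1) by (simp add: compact_imp_closed open_Compl)

lemma G_harmonic: "z \<notin> K \<Longrightarrow> harmonic_at G z" using G(1) unfolding log_harmonic_def by blast

text \<open>By the maximum principle the value at infinity depends linearly and monotonically on the
  boundary data. A finite sum that is uniformly close on \<open>K\<close> to the data \<phi> of a
  known solution is therefore just as close to it at infinity.\<close>

lemma T_combination:
  fixes c :: "nat \<Rightarrow> complex"
  assumes c: "\<And>k. k < N \<Longrightarrow> c k \<notin> K" and q: "log_harmonic 0 q t K"
    "\<And>x. x \<in> K \<Longrightarrow> (q \<longlongrightarrow> \<phi> x) (at x within - K)"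
    and close: "\<And>x. x \<in> K \<Longrightarrow> \<bar>(\<Sum>k<N. w * ln (norm (x - c k))) - \<phi> x\<bar> \<le> \<epsilon>"
  shows "\<bar>(\<Sum>k<N. w * T (c k)) - t\<bar> \<le> \<epsilon>"
proof -
  have s: "log_harmonic 0 (\<lambda>z. \<Sum>k<N. w * Q (c k) z) (\<Sum>k<N. w * T (c k)) K"
  proof (rule log_harmonic_sum)
    show "log_harmonic 0 (\<lambda>z. w * Q (c k) z) (w * T (c k)) K" if "k \<in> {..<N}" for k
      using log_harmonic_cmult[OF Q(1)[OF c], of k w] that by simp
  qed
  have sb: "((\<lambda>z. \<Sum>k<N. w * Q (c k) z) \<longlongrightarrow> (\<Sum>k<N. w * ln (norm (x - c k)))) (at x within - K)"
    if "x \<in> K" for x using Q(2)[OF c that] by (intro tendsto_intros) auto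
  have e: "log_harmonic 0 (\<lambda>z. q z + \<epsilon>) (t + \<epsilon>) K" "log_harmonic 0 (\<lambda>z. q z - \<epsilon>) (t - \<epsilon>) K"
    using log_harmonic_add[OF q(1) log_harmonic_const[of \<epsilon>]] log_harmonic_diff[OF q(1) log_harmonic_const[of \<epsilon>]]
    by simp_all
  have eb: "((\<lambda>z. q z + \<epsilon>) \<longlongrightarrow> \<phi> x + \<epsilon>) (at x within - K)" "((\<lambda>z. q z - \<epsilon>) \<longlongrightarrow> \<phi> x - \<epsilon>) (at x within - K)"
    if "x \<in> K" for x using q(2)[OF that] by (intro tendsto_intros; assumption)+
  have le: "(\<Sum>k<N. w * ln (norm (x - c k))) \<le> \<phi> x + \<epsilon>" "\<phi> x - \<epsilon> \<le> (\<Sum>k<N. w * ln (norm (x - c k)))"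
    if "x \<in> K" for x using close[OF that] by linarith+
  have "(\<Sum>k<N. w * T (c k)) \<le> t + \<epsilon>"
    by (rule log_harmonic_le_boundary(2)[OF K s e(1) sb eb(1) le(1)])
  moreover have "t - \<epsilon> \<le> (\<Sum>k<N. w * T (c k))"
    by (rule log_harmonic_le_boundary(2)[OF K e(2) s eb(2) sb le(2)])
  ultimately show ?thesis by linarith
qed

lemma T_close:
  assumes "c \<notin> K" "log_harmonic 0 q t K" "\<And>x. x \<in> K \<Longrightarrow> (q \<longlongrightarrow> \<phi> x) (at x within - K)"
    and "\<And>x. x \<in> K \<Longrightarrow> \<bar>ln (norm (x - c)) - \<phi> x\<bar> \<le> \<epsilon>"
  shows "\<bar>T c - t\<bar> \<le> \<epsilon>"
  using T_combination[of 1 "\<lambda>_. c" q t \<phi> 1 \<epsilon>] assms by simp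

lemma T_lipschitz:
  assumes d: "d > 0" "\<And>x. x \<in> K \<Longrightarrow> norm (x - c) \<ge> d" "\<And>x. x \<in> K \<Longrightarrow> norm (x - c') \<ge> d"
  shows "\<bar>T c - T c'\<bar> \<le> norm (c - c') / d"
proof -
  have nK: "c \<notin> K" "c' \<notin> K" using d(1) d(2)[of c] d(3)[of c'] by auto
  show ?thesis
  proof (rule T_close[OF nK(1) Q[OF nK(2)]])
    fix x assume x: "x \<in> K"
    have "\<bar>ln (norm (x - c)) - ln (norm (x - c'))\<bar> \<le> \<bar>norm (x - c) - norm (x - c')\<bar> / d"
      using d x by (intro abs_ln_diff_le) auto
    also have "\<dots> \<le> norm (c - c') / d"
      using d(1) norm_triangle_ineq3[of "x - c" "x - c'"] by (intro divide_right_mono) (auto simp: norm_minus_commute)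
    finally show "\<bar>ln (norm (x - c)) - ln (norm (x - c'))\<bar> \<le> norm (c - c') / d" .
  qed
qed

lemma T_continuous: "continuous_on (- K) T"
proof (rule continuous_at_imp_continuous_on, rule ballI)
  fix c assume c: "c \<in> - K"
  obtain d where d: "d > 0" "ball c (2 * d) \<subseteq> - K"
  proof -
    obtain e where "e > 0" "ball c e \<subseteq> - K" using open_compl c openE by blast
    thus ?thesis using that[of "e/2"] by simp
  qed
  have far: "norm (x - c') \<ge> d" if "x \<in> K" "c' \<in> ball c d" for x c'
  proof (rule ccontr)
    assume "\<not> norm (x - c') \<ge> d"
    hence "dist c x < 2 * d" using that(2) dist_triangle[of c x c'] by (simp add: dist_norm norm_minus_commute)
    thus False using d(2) that(1) by auto
  qed
  have "((\<lambda>c'. \<bar>T c' - T c\<bar>) \<longlongrightarrow> 0) (at c)"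
  proof (rule tendsto_sandwich[OF _ _ tendsto_const])
    show "\<forall>\<^sub>F c' in at c. \<bar>T c' - T c\<bar> \<le> norm (c' - c) / d"
    proof (rule eventually_at_in_open[THEN eventually_mono, of "ball c d"])
      show "\<bar>T c' - T c\<bar> \<le> norm (c' - c) / d" if "c' \<in> ball c d - {c}" for c'
        using d(1) that by (intro T_lipschitz far) auto
    qed (use d in auto)
    have "((\<lambda>c'. norm (c' - c) / d) \<longlongrightarrow> norm (c - c) / d) (at c)" by (intro tendsto_intros) (use d in auto)
    thus "((\<lambda>c'. norm (c' - c) / d) \<longlongrightarrow> 0) (at c)" by simp
  qed auto
  hence "((\<lambda>c'. T c' - T c) \<longlongrightarrow> 0) (at c)" by (rule tendsto_rabs_zero_cancel)
  thus "isCont T c" by (simp add: isCont_def LIM_zero_iff)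
qed

text \<open>The mean of \<open>T\<close> over a circle is the limit of Riemann sums, to which \<open>T_combination\<close> applies.\<close>

lemma T_mean:
  assumes r: "r > 0" and d: "d > 0" "\<And>x t. x \<in> K \<Longrightarrow> norm (x - (c + of_real r * cis t)) \<ge> d"
    and mean: "\<And>x. x \<in> K \<Longrightarrow> ((\<lambda>t. ln (norm (x - (c + of_real r * cis t)))) has_integral 2 * pi * \<phi> x) {0..2*pi}"
    and q: "log_harmonic 0 q t0 K" "\<And>x. x \<in> K \<Longrightarrow> (q \<longlongrightarrow> \<phi> x) (at x within - K)"
  shows "((\<lambda>t. T (c + of_real r * cis t)) has_integral 2 * pi * t0) {0..2*pi}"
proof -
  define p where "p = (\<lambda>t. c + of_real r * cis t)"
  \<comment> \<open>A Lipschitz constant for \<open>T\<close> and for the logarithms along the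
    circle, uniform in \<open>x\<close>: a point moves by at most \<open>r\<close> per unit of
    angle, and at distance \<open>d\<close> from \<open>K\<close> the slope is at most
    \<open>1 / d\<close>.\<close>
  define C where "C = r / d"
  have C: "C > 0" using r d by (simp add: C_def)
  have pK: "p t \<notin> K" for t using d(1) d(2)[of "p t" t] by (auto simp: p_def)
  have pl: "norm (p s - p t) / d \<le> C * \<bar>s - t\<bar>" for s t
    using divide_right_mono[OF circle_lipschitz[of r c s t], of d] r d(1) by (simp add: p_def C_def)
  have pd: "norm (x - p t) \<ge> d" if "x \<in> K" for x t using d(2)[OF that] by (simp add: p_def)
  have pcont: "continuous_on A p" for A unfolding p_def by (intro continuous_intros)
  have Tl: "\<bar>T (p s) - T (p t)\<bar> \<le> C * \<bar>s - t\<bar>" for s t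
    using T_lipschitz[OF d(1) pd pd, of s t] pl[of s t] by linarith
  have ll: "\<bar>ln (norm (x - p s)) - ln (norm (x - p t))\<bar> \<le> C * \<bar>s - t\<bar>" if x: "x \<in> K" for x s t
  proof -
    have "\<bar>ln (norm (x - p s)) - ln (norm (x - p t))\<bar> \<le> \<bar>norm (x - p s) - norm (x - p t)\<bar> / d"
      using pd x d(1) by (intro abs_ln_diff_le) auto
    also have "\<dots> \<le> norm (p s - p t) / d"
      using d(1) norm_triangle_ineq3[of "x - p s" "x - p t"] by (intro divide_right_mono) (auto simp: norm_minus_commute)
    finally show ?thesis using pl[of s t] by linarith
  qed
  have Tcont: "continuous_on {0..2*pi} (\<lambda>t. T (p t))"
    by (rule continuous_on_compose2[OF T_continuous pcont]) (use pK in auto)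
  define I where "I = integral {0..2*pi} (\<lambda>t. T (p t))"
  \<comment> \<open>Two quadrature errors of the same size add up: one for \<open>T\<close>, one for
    the logarithms, which \<open>T_combination\<close> carries to infinity.\<close>
  have est: "\<bar>I - 2 * pi * t0\<bar> \<le> 2 * (C * (2*pi)\<^sup>2) / real N" if N: "N > 0" for N
  proof -
    define w where "w = 2 * pi / real N"
    define s where "s = (\<lambda>k. 2 * pi * real k / real N)"
    have "\<bar>(\<Sum>k<N. w * T (p (s k))) - 2 * pi * t0\<bar> \<le> C * (2*pi)\<^sup>2 / real N"
    proof (rule T_combination[of N "\<lambda>k. p (s k)" "\<lambda>z. 2 * pi * q z" _ "\<lambda>x. 2 * pi * \<phi> x" w])
      show "p (s k) \<notin> K" for k by (rule pK)
      show "log_harmonic 0 (\<lambda>z. 2 * pi * q z) (2 * pi * t0) K"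
        using log_harmonic_cmult[OF q(1), of "2 * pi"] by simp
      show "((\<lambda>z. 2 * pi * q z) \<longlongrightarrow> 2 * pi * \<phi> x) (at x within - K)" if "x \<in> K" for x
        by (intro tendsto_intros q(2)[OF that])
      fix x assume x: "x \<in> K"
      have "continuous_on {0..2*pi} (\<lambda>t. ln (norm (x - p t)))"
        using pd[OF x] d(1) by (intro continuous_intros pcont) (metis norm_le_zero_iff not_less order_less_le_trans norm_zero)
      from riemann_sum_lipschitz[OF ll[OF x] _ this N]
      have "\<bar>integral {0..2*pi} (\<lambda>t. ln (norm (x - p t))) - w * (\<Sum>k<N. ln (norm (x - p (s k))))\<bar> \<le> C * (2*pi)\<^sup>2 / real N"
        by (simp add: w_def s_def)
      thus "\<bar>(\<Sum>k<N. w * ln (norm (x - p (s k)))) - 2 * pi * \<phi> x\<bar> \<le> C * (2*pi)\<^sup>2 / real N"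
        using integral_unique[OF mean[OF x]] by (simp add: p_def sum_distrib_left abs_minus_commute)
    qed
    moreover from riemann_sum_lipschitz[OF Tl _ Tcont N]
    have "\<bar>I - (\<Sum>k<N. w * T (p (s k)))\<bar> \<le> C * (2*pi)\<^sup>2 / real N"
      by (simp add: w_def s_def I_def sum_distrib_left)
    moreover have "2 * (C * (2*pi)\<^sup>2) / real N = C * (2*pi)\<^sup>2 / real N + C * (2*pi)\<^sup>2 / real N" by simp
    ultimately show ?thesis by linarith
  qed
  have "\<bar>I - 2 * pi * t0\<bar> \<le> 0"
  proof (rule tendsto_lowerbound)
    show "((\<lambda>N. 2 * (C * (2*pi)\<^sup>2) / real N) \<longlonglongrightarrow> 0)" by (rule lim_const_over_n)
    show "\<forall>\<^sub>F N in sequentially. \<bar>I - 2 * pi * t0\<bar> \<le> 2 * (C * (2*pi)\<^sup>2) / real N"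
      using eventually_gt_at_top[of 0] by eventually_elim (rule est)
  qed simp
  hence "I = 2 * pi * t0" by simp
  moreover have "((\<lambda>t. T (p t)) has_integral I) {0..2*pi}"
    unfolding I_def by (rule integrable_integral[OF integrable_continuous_real[OF Tcont]])
  ultimately show ?thesis by (simp add: p_def)
qed

end

section \<open>Comparison of \<open>T + \<gamma>\<close> with \<open>G\<close>\<close>

context green_domain
begin

text \<open>Minus the Green's function with pole \<open>c\<close> tends to minus infinity at
  \<open>c\<close> and to 0 on \<open>K\<close>. So it is at most 0 at infinity, where its value is
  \<open>- \<gamma> - T c\<close>.\<close>

lemma T_ge:
  assumes c: "c \<notin> K" shows "- \<gamma> \<le> T c"
proof -
  define u where "u = (\<lambda>z. ln (norm (z - c)) - G z - Q c z)"
  have "log_harmonic 0 u (0 - \<gamma> - T c) (insert c K)"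
    using log_harmonic_diff[OF log_harmonic_diff[OF log_harmonic_mono[OF log_harmonic_ln[of c]]
      log_harmonic_mono[OF G(1)]] log_harmonic_mono[OF Q(1)[OF c]], of "insert c K"]
    unfolding u_def by auto
  moreover have "\<forall>\<^sub>F w in at \<zeta> within - insert c K. u w < \<epsilon>" if \<zeta>: "\<zeta> \<in> insert c K" and "\<epsilon> > 0" for \<zeta> \<epsilon>
  proof (cases "\<zeta> = c")
    case True
    have "isCont (\<lambda>z. G z + Q c z) c"
      using harmonic_at_isCont[OF G_harmonic[OF c]] Q(1)[OF c] c harmonic_at_isCont
      unfolding log_harmonic_def by (intro continuous_intros) auto
    hence "((\<lambda>z. G z + Q c z) \<longlongrightarrow> G c + Q c c) (at c)" by (simp add: isCont_def)
    hence "\<forall>\<^sub>F z in at c. G z + Q c z > G c + Q c c - 1" by (rule order_tendstoD) simp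
    \<comment> \<open>The radius makes \<open>ln (norm (z - c))\<close> smaller than
      \<open>G c + Q c c - 1\<close>, a lower bound for \<open>G z + Q c z\<close> near
      \<open>c\<close>; thus \<open>u\<close> is negative there.\<close>
    moreover have "\<forall>\<^sub>F z in at c. z \<in> ball c (exp (G c + Q c c - 1)) - {c}"
      by (intro eventually_at_in_open) auto
    ultimately have "\<forall>\<^sub>F z in at c. u z < \<epsilon>"
    proof eventually_elim
      case (elim z)
      hence "norm (z - c) < exp (G c + Q c c - 1)" "norm (z - c) > 0"
        by (auto simp: dist_norm norm_minus_commute)
      hence "ln (norm (z - c)) < G c + Q c c - 1" by (metis exp_gt_zero ln_exp ln_less_cancel_iff)
      thus ?case using elim(1) \<open>\<epsilon> > 0\<close> by (simp add: u_def)
    qed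
    thus ?thesis unfolding True using at_le[of "- insert c K" UNIV c] by (auto intro: filter_leD)
  next
    case False
    hence \<zeta>K: "\<zeta> \<in> K" using \<zeta> by simp
    have "(u \<longlongrightarrow> ln (norm (\<zeta> - c)) - 0 - ln (norm (\<zeta> - c))) (at \<zeta> within - K)"
      unfolding u_def using False by (intro tendsto_intros G(2)[OF \<zeta>K] Q(2)[OF c \<zeta>K]) auto
    hence "(u \<longlongrightarrow> 0) (at \<zeta> within - K)" by simp
    hence "(u \<longlongrightarrow> 0) (at \<zeta> within - insert c K)" by (rule tendsto_within_subset) auto
    thus ?thesis using \<open>\<epsilon> > 0\<close> by (rule order_tendstoD)
  qed
  ultimately have "0 - \<gamma> - T c \<le> 0"
    using K by (intro log_harmonic_max_principle(2)[of "insert c K" u]) auto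
  thus ?thesis by simp
qed

text \<open>The mean value property of \<open>T\<close> comes from that of
  \<open>ln (norm (x - c))\<close> as a function of \<open>c\<close>. Of \<open>T\<close> only
  continuity and its means are known, which is what subharmonicity asks for.\<close>

lemma defect_subharmonic: "subharmonic_on (\<lambda>c. G c - T c - \<gamma>) (- K)"
  unfolding subharmonic_on_def
proof (intro conjI ballI open_compl)
  show "continuous_on (- K) (\<lambda>c. G c - T c - \<gamma>)"
    using G_harmonic by (intro continuous_on_diff T_continuous continuous_on_const harmonic_at_continuous_on) auto
  fix z assume z: "z \<in> - K"
  obtain e where e: "e > 0" "ball z e \<subseteq> - K" using open_compl z openE by blast
  have "G z - T z - \<gamma> \<le> 1 / (2 * pi) * integral {0..2 * pi} (\<lambda>t. G (z + of_real r * cis t) - T (z + of_real r * cis t) - \<gamma>)"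
    if r: "r \<in> {0<..e/2}" for r
  proof -
    have inb: "w \<notin> K" if "w \<in> cball z r" for w
      using that r e(1) by (intro ComplD subsetD[OF e(2)]) auto
    have "((\<lambda>t. G (z + of_real r * cis t)) has_integral 2 * pi * G z) {0..2*pi}"
      using r inb by (intro harmonic_mean_value G_harmonic) auto
    moreover have "((\<lambda>t. T (z + of_real r * cis t)) has_integral 2 * pi * T z) {0..2*pi}"
    proof (rule T_mean[of r "e/2" z "\<lambda>x. ln (norm (x - z))" "Q z"])
      show "norm (x - (z + of_real r * cis t)) \<ge> e/2" if "x \<in> K" for x t
      proof -
        have "norm (x - z) \<ge> e" using e(2) that by (force simp: dist_norm norm_minus_commute)
        moreover have "norm (of_real r * cis t) \<le> e / 2" using r by (simp add: norm_mult)
        ultimately show ?thesis using norm_triangle_ineq2[of "x - z" "of_real r * cis t"] by (simp add: algebra_simps)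
      qed
      fix x assume x: "x \<in> K"
      show "((\<lambda>t. ln (norm (x - (z + of_real r * cis t)))) has_integral 2 * pi * ln (norm (x - z))) {0..2*pi}"
      proof (rule harmonic_mean_value)
        show "harmonic_at (\<lambda>w. ln (norm (x - w))) w" if "w \<in> cball z r" for w
          using inb[OF that] x by (intro harmonic_at_ln_norm) (auto intro!: analytic_intros)
      qed (use r in auto)
    qed (use r e z Q in auto)
    ultimately have "((\<lambda>t. G (z + of_real r * cis t) - T (z + of_real r * cis t) - \<gamma>) has_integral
        2 * pi * G z - 2 * pi * T z - 2 * pi * \<gamma>) {0..2*pi}"
      using has_integral_const_real[of \<gamma> 0 "2*pi"] by (intro has_integral_diff) auto
    from integral_unique[OF this] show ?thesis by (simp add: field_simps)
  qed
  thus "\<exists>R>0. cball z R \<subseteq> - K \<and> (\<forall>r\<in>{0<..R}. G z - T z - \<gamma>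
      \<le> 1 / (2 * pi) * integral {0..2 * pi} (\<lambda>t. G (z + of_real r * cis t) - T (z + of_real r * cis t) - \<gamma>))"
  proof (intro exI[of _ "e/2"] conjI ballI)
    have "cball z (e/2) \<subseteq> ball z e" using e(1) by auto
    thus "cball z (e/2) \<subseteq> - K" using e(2) by (rule order_trans)
  qed (use e(1) in auto)
qed

text \<open>\<open>ln (norm (x - c))\<close> differs from \<open>ln (norm c)\<close> by at most
  \<open>R / (norm c - R)\<close>, uniformly for \<open>x\<close> in \<open>K\<close>, and a
  constant is its own solution.\<close>

lemma T_infinity: "((\<lambda>c. T c - ln (norm c)) \<longlongrightarrow> 0) at_infinity"
proof (rule tendstoI)
  fix \<epsilon> :: real assume \<epsilon>: "\<epsilon> > 0"
  obtain R where R: "R > 0" "\<And>x. x \<in> K \<Longrightarrow> norm x \<le> R"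
    using compact_imp_bounded[OF K(1)] unfolding bounded_pos by blast
  show "\<forall>\<^sub>F c in at_infinity. dist (T c - ln (norm c)) 0 < \<epsilon>"
    unfolding eventually_at_infinity
  proof (intro exI allI impI)
    fix c :: complex assume c: "R + R / \<epsilon> + 1 \<le> norm c"
    define d where "d = norm c - R"
    have "R / \<epsilon> > 0" using R(1) \<epsilon> by simp
    hence d: "d > R / \<epsilon>" "d > 0" using c by (auto simp: d_def)
    have cK: "c \<notin> K" using R(2)[of c] d(2) by (auto simp: d_def)
    have "\<bar>T c - ln (norm c)\<bar> \<le> R / d"
    proof (rule T_close[OF cK log_harmonic_const tendsto_const])
      fix x assume x: "x \<in> K"
      have "norm (x - c) \<ge> d" using norm_triangle_ineq2[of c x] R(2)[OF x] by (simp add: d_def norm_minus_commute)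
      hence "\<bar>ln (norm (x - c)) - ln (norm c)\<bar> \<le> \<bar>norm (x - c) - norm c\<bar> / d"
        using d(2) R(1) by (intro abs_ln_diff_le) (auto simp: d_def)
      also have "\<dots> \<le> R / d"
        using norm_triangle_ineq3[of "x - c" "- c"] R(2)[OF x] d(2) by (intro divide_right_mono) auto
      finally show "\<bar>ln (norm (x - c)) - ln (norm c)\<bar> \<le> R / d" .
    qed
    also have "R / d < \<epsilon>" using d \<epsilon> by (simp add: field_simps)
    finally show "dist (T c - ln (norm c)) 0 < \<epsilon>" by simp
  qed
qed

text \<open>For \<open>norm x < \<rho>\<close> the logarithmic distance from \<open>x\<close> has
  mean \<open>ln \<rho>\<close> over the circle. With \<rho> factored out, what remains is
  \<open>1 - x * w\<close> on the circle of radius \<open>1 / \<rho>\<close>, which has no zero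
  inside, so that the logarithm of its modulus has mean \<open>ln 1 = 0\<close>.\<close>

lemma T_big_circle:
  "\<forall>\<^sub>F \<rho> in at_top. ((\<lambda>t. T (of_real \<rho> * cis t)) has_integral 2 * pi * ln \<rho>) {0..2*pi}"
proof -
  obtain R where R: "R > 0" "\<And>x. x \<in> K \<Longrightarrow> norm x \<le> R"
    using compact_imp_bounded[OF K(1)] unfolding bounded_pos by blast
  have "((\<lambda>t. T (0 + of_real \<rho> * cis t)) has_integral 2 * pi * ln \<rho>) {0..2*pi}" if \<rho>: "\<rho> > R" for \<rho>
  proof (rule T_mean[of \<rho> "\<rho> - R" 0 "\<lambda>_. ln \<rho>" "\<lambda>_. ln \<rho>"])
    show "norm (x - (0 + of_real \<rho> * cis t)) \<ge> \<rho> - R" if "x \<in> K" for x t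
      using norm_triangle_ineq2[of "of_real \<rho> * cis t" x] R(2)[OF that] \<rho> R(1)
      by (simp add: norm_minus_commute norm_mult)
    fix x assume x: "x \<in> K"
    have "((\<lambda>t. ln (norm (1 - x * (0 + of_real (1 / \<rho>) * cis t)))) has_integral 2 * pi * ln (norm (1 - x * 0))) {0..2*pi}"
    proof (rule harmonic_mean_value)
      show "harmonic_at (\<lambda>w. ln (norm (1 - x * w))) w" if "w \<in> cball 0 (1 / \<rho>)" for w
      proof (rule harmonic_at_ln_norm)
        have "norm (x * w) \<le> R * (1 / \<rho>)"
          unfolding norm_mult using that R(2)[OF x] R(1) by (intro mult_mono) auto
        also have "\<dots> < 1" using \<rho> R(1) by simp
        finally show "1 - x * w \<noteq> 0" by (metis eq_iff_diff_eq_0 norm_one less_irrefl)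
      qed (auto intro!: analytic_intros)
    qed (use \<rho> R(1) in auto)
    hence "((\<lambda>t. ln (norm (1 - x * of_real (1 / \<rho>) * cis t))) has_integral 0) {0..2*pi}"
      by (simp add: mult.assoc)
    from has_integral_circle_reflect[of "\<lambda>e. ln (norm (1 - x * of_real (1 / \<rho>) * e))", OF this]
    have "((\<lambda>t. ln (norm (1 - x * of_real (1 / \<rho>) * cis (- t))) + ln \<rho>) has_integral 0 + 2 * pi * ln \<rho>) {0..2*pi}"
      using has_integral_const_real[of "ln \<rho>" 0 "2*pi"] by (intro has_integral_add) auto
    moreover have "ln (norm (1 - x * of_real (1 / \<rho>) * cis (- t))) + ln \<rho> = ln (norm (x - (0 + of_real \<rho> * cis t)))" for t
    proof -
      have "of_real \<rho> * cis t - x = of_real \<rho> * cis t * (1 - x * of_real (1 / \<rho>) * cis (- t))"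
      proof -
        have gen: "a * b * (1 - x * a' * b') = a * b - x * (a * a') * (b * b')" for a a' b b' :: complex
          by (simp add: algebra_simps)
        have "of_real \<rho> * of_real (1 / \<rho>) = (1::complex)" using \<rho> R(1) by simp
        moreover have "cis t * cis (- t) = 1" by (simp only: cis_mult add.right_inverse cis_zero)
        ultimately show ?thesis unfolding gen by (simp only: mult_1_right)
      qed
      note eq = this
      have "norm (x - (0 + of_real \<rho> * cis t)) = norm (of_real \<rho> * cis t - x)"
        by (simp add: norm_minus_commute)
      also have "\<dots> = \<rho> * norm (1 - x * of_real (1 / \<rho>) * cis (- t))"
        unfolding eq using \<rho> R(1) by (simp add: norm_mult)
      finally have ne: "norm (x - (0 + of_real \<rho> * cis t)) = \<rho> * norm (1 - x * of_real (1 / \<rho>) * cis (- t))" .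
      have "\<rho> - norm x \<le> norm (x - (0 + of_real \<rho> * cis t))"
        using norm_triangle_ineq2[of "of_real \<rho> * cis t" x] \<rho> R(1)
        by (simp add: norm_minus_commute norm_mult)
      hence "\<rho> * norm (1 - x * of_real (1 / \<rho>) * cis (- t)) > 0"
        using R(2)[OF x] \<rho> unfolding ne by linarith
      hence "norm (1 - x * of_real (1 / \<rho>) * cis (- t)) > 0" "\<rho> > 0"
        using \<rho> R(1) by (simp_all only: zero_less_mult_pos)
      hence "ln (\<rho> * norm (1 - x * of_real (1 / \<rho>) * cis (- t))) = ln \<rho> + ln (norm (1 - x * of_real (1 / \<rho>) * cis (- t)))"
        by (intro ln_mult_pos)
      thus ?thesis unfolding ne by linarith
    qed
    ultimately show "((\<lambda>t. ln (norm (x - (0 + of_real \<rho> * cis t)))) has_integral 2 * pi * ln \<rho>) {0..2*pi}" by simp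
  qed (use \<rho> R(1) in \<open>auto intro: log_harmonic_const\<close>)
  thus ?thesis by (intro eventually_mono[OF eventually_gt_at_top[of R]]) auto
qed

lemma defect_big_circle:
  "\<forall>\<^sub>F \<rho> in at_top. ((\<lambda>t. G (of_real \<rho> * cis t) - T (of_real \<rho> * cis t) - \<gamma>) has_integral 0) {0..2*pi}"
  using log_harmonic_mean_infinity[OF G(1)] T_big_circle
proof eventually_elim
  case (elim \<rho>)
  have "((\<lambda>t. G (of_real \<rho> * cis t) - T (of_real \<rho> * cis t) - \<gamma>) has_integral
      2 * pi * (\<gamma> + 1 * ln \<rho>) - 2 * pi * ln \<rho> - 2 * pi * \<gamma>) {0..2*pi}"
    using elim has_integral_const_real[of \<gamma> 0 "2*pi"] by (intro has_integral_diff) auto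
  thus ?case by (simp add: algebra_simps)
qed

text \<open>On approach to \<open>K\<close>, \<open>G\<close> tends to 0 and
  \<open>- T - \<gamma>\<close> is at most 0 by \<open>T_ge\<close>; at infinity the limit is
  0.\<close>

lemma defect_le:
  assumes "z \<notin> K" shows "G z - T z - \<gamma> \<le> 0"
proof (rule subharmonic_max_principle[OF K defect_subharmonic _ _ _ assms, of 0])
  have "((\<lambda>z. (G z - 1 * ln (norm z)) - (T z - ln (norm z)) - \<gamma>) \<longlongrightarrow> \<gamma> - 0 - \<gamma>) at_infinity"
    by (intro tendsto_intros log_harmonic_tendsto[OF G(1)] T_infinity)
  thus "((\<lambda>z. G z - T z - \<gamma>) \<longlongrightarrow> 0) at_infinity" by simp
  show "\<forall>\<^sub>F \<rho> in at_top. 0 \<le> 1 / (2 * pi) * integral {0..2 * pi} (\<lambda>t. G (of_real \<rho> * cis t) - T (of_real \<rho> * cis t) - \<gamma>)"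
    using defect_big_circle by eventually_elim (simp add: integral_unique)
  fix \<zeta> and \<epsilon> :: real assume "\<zeta> \<in> K" "\<epsilon> > 0"
  have "\<forall>\<^sub>F w in at \<zeta> within - K. G w < \<epsilon>"
    using G(2)[OF \<open>\<zeta> \<in> K\<close>] \<open>\<epsilon> > 0\<close> by (rule order_tendstoD)
  moreover have "\<forall>\<^sub>F w in at \<zeta> within - K. w \<in> - K" by (simp add: eventually_at_filter)
  ultimately show "\<forall>\<^sub>F w in at \<zeta> within - K. G w - T w - \<gamma> < \<epsilon>"
  proof eventually_elim
    case (elim w)
    thus ?case using T_ge[of w] by simp
  qed
qed

text \<open>A vertical ray pointing away from the real axis connects every point of the domain to infinity.\<close>

lemma zero_propagates:
  assumes v: "subharmonic_on v (- K)" "\<And>z. z \<notin> K \<Longrightarrow> v z \<le> 0" and c: "c \<notin> K"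
    and s: "s = 1 \<or> s = - 1" "s * Im c \<ge> 0" and t: "t \<ge> 0"
  shows "v c = 0 \<longleftrightarrow> v (c + \<i> * of_real (s * t)) = 0"
proof -
  define P where "P = (\<lambda>t. c + \<i> * of_real (s * t)) ` {0..}"
  have P: "connected P" unfolding P_def
    by (intro connected_continuous_image continuous_intros) auto
  have PK: "P \<subseteq> - K"
  proof
    fix z assume "z \<in> P"
    then obtain t where t: "t \<ge> 0" "z = c + \<i> * of_real (s * t)" by (auto simp: P_def)
    show "z \<in> - K"
    proof (cases "t = 0")
      case False
      hence "s * Im z > 0" using s t by (auto simp: distrib_left)
      thus ?thesis using K_real[of z] by auto
    qed (use t c in auto)
  qed
  define A where "A = {z\<in>-K. v z = 0}"
  define B where "B = - K \<inter> v -` {..<0}"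
  have "open A" unfolding A_def by (rule max_set_open[OF v(1)]) (use v(2) in auto)
  moreover have "open B" unfolding B_def
    using v(1) by (intro continuous_open_preimage) (auto simp: subharmonic_on_def)
  moreover have "P \<subseteq> A \<union> B"
  proof
    fix z assume "z \<in> P"
    hence "z \<notin> K" using PK by auto
    thus "z \<in> A \<union> B" using v(2)[of z] by (auto simp: A_def B_def)
  qed
  moreover have "A \<inter> B \<inter> P = {}" by (auto simp: A_def B_def)
  ultimately have "A \<inter> P = {} \<or> B \<inter> P = {}" using connectedD[OF P] by blast
  moreover have "c \<in> P" unfolding P_def by (rule image_eqI[of _ _ 0]) auto
  moreover have "c + \<i> * of_real (s * t) \<in> P" unfolding P_def by (rule image_eqI[of _ _ t]) (use t in auto)
  moreover have "z \<in> A \<longleftrightarrow> v z = 0" "z \<in> B \<longleftrightarrow> v z \<noteq> 0" if "z \<in> P" for z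
    using that PK v(2)[of z] by (auto simp: A_def B_def)
  ultimately show ?thesis by blast
qed

lemma vertical_far:
  assumes "s = 1 \<or> s = - 1" "b \<ge> 0"
  shows "norm (c + \<i> * of_real (s * (b + norm c))) \<ge> b"
proof -
  have "norm (\<i> * of_real (s * (b + norm c))) = \<bar>s\<bar> * \<bar>b + norm c\<bar>"
    by (simp only: norm_mult norm_of_real abs_mult norm_ii mult_1)
  also have "\<dots> = b + norm c" using assms by auto
  finally have "norm (\<i> * of_real (s * (b + norm c))) = b + norm c" .
  thus ?thesis using norm_triangle_ineq2[of "\<i> * of_real (s * (b + norm c))" "- c"] by (simp add: add.commute)
qed

text \<open>This is the symmetry, as \<open>T c + \<gamma>\<close> is the value at infinity of the
  Green's function with pole \<open>c\<close>. A nonpositive defect with mean 0 vanishes on a large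
  circle, and a vertical ray carries the zero from there back to \<open>c\<close>.\<close>

lemma G_eq:
  assumes c: "c \<notin> K" shows "G c = T c + \<gamma>"
proof -
  obtain \<rho>0 where \<rho>0: "\<And>\<rho>. \<rho> \<ge> \<rho>0 \<Longrightarrow>
      ((\<lambda>t. G (of_real \<rho> * cis t) - T (of_real \<rho> * cis t) - \<gamma>) has_integral 0) {0..2*pi}"
    using defect_big_circle unfolding eventually_at_top_linorder by blast
  obtain R where R: "R > 0" "\<And>x. x \<in> K \<Longrightarrow> norm x \<le> R"
    using compact_imp_bounded[OF K(1)] unfolding bounded_pos by blast
  define s :: real where "s = (if Im c \<ge> 0 then 1 else - 1)"
  have s: "s = 1 \<or> s = - 1" "s * Im c \<ge> 0" by (auto simp: s_def)
  \<comment> \<open>Large enough that the circle through \<open>z\<close> encloses \<open>K\<close>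
    and the defect has mean 0 on it.\<close>
  define b where "b = max \<rho>0 0 + R + 1"
  define z where "z = c + \<i> * of_real (s * (b + norm c))"
  have nz: "norm z \<ge> b" using vertical_far[OF s(1), of b c] R(1) by (simp add: z_def b_def)
  hence \<rho>: "norm z \<ge> \<rho>0" "norm z > R" using R(1) by (auto simp: b_def)
  obtain t where t: "t \<in> {0..2*pi}" "z = 0 + of_real (norm (z - 0)) * cis t"
    by (rule complex_as_circle_point)
  have circ: "of_real (norm z) * cis t \<in> - K" for t
    using R(2)[of "of_real (norm z) * cis t"] \<rho>(2) by (auto simp: norm_mult)
  have "G (of_real (norm z) * cis t) - T (of_real (norm z) * cis t) - \<gamma> = 0"
  proof (rule mean_ge_max_imp_eq[of "\<lambda>t. G (of_real (norm z) * cis t) - T (of_real (norm z) * cis t) - \<gamma>" 0 t])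
    have "continuous_on (- K) (\<lambda>c. G c - T c - \<gamma>)" using defect_subharmonic unfolding subharmonic_on_def by simp
    thus "continuous_on {0..2*pi} (\<lambda>t. G (of_real (norm z) * cis t) - T (of_real (norm z) * cis t) - \<gamma>)"
      by (rule continuous_on_compose2[of "- K" "\<lambda>c. G c - T c - \<gamma>"]) (use circ in \<open>auto intro!: continuous_intros\<close>)
    show "0 \<le> 1 / (2 * pi) * integral {0..2 * pi} (\<lambda>t. G (of_real (norm z) * cis t) - T (of_real (norm z) * cis t) - \<gamma>)"
      using integral_unique[OF \<rho>0[OF \<rho>(1)]] by simp
  qed (use t defect_le circ in auto)
  hence "G z - T z - \<gamma> = 0" using t(2) by simp
  hence "G c - T c - \<gamma> = 0"
    using zero_propagates[OF defect_subharmonic defect_le c s, of "b + norm c"] R(1) by (simp add: z_def b_def)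
  thus ?thesis by simp
qed

lemma G_nonneg: "c \<notin> K \<Longrightarrow> G c \<ge> 0" using G_eq T_ge by force

text \<open>A zero of \<open>G\<close> would spread along a vertical ray, on which \<open>G\<close>
  grows like \<open>ln (norm z)\<close>.\<close>

lemma G_pos:
  assumes c: "c \<notin> K" shows "G c > 0"
proof (rule ccontr)
  assume "\<not> G c > 0"
  hence G0: "- G c = 0" using G_nonneg[OF c] by simp
  have sub: "subharmonic_on (\<lambda>z. - G z) (- K)"
    using harmonic_at_cmult[OF G_harmonic, of _ "- 1"]
    by (intro harmonic_at_imp_subharmonic_on open_compl) auto
  have "\<forall>\<^sub>F z in at_infinity. G z - 1 * ln (norm z) > \<gamma> - 1"
    using log_harmonic_tendsto[OF G(1)] by (rule order_tendstoD) simp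
  then obtain b where b: "\<And>z. norm z \<ge> b \<Longrightarrow> G z - ln (norm z) > \<gamma> - 1"
    unfolding eventually_at_infinity by auto
  define s :: real where "s = (if Im c \<ge> 0 then 1 else - 1)"
  have s: "s = 1 \<or> s = - 1" "s * Im c \<ge> 0" by (auto simp: s_def)
  \<comment> \<open>From \<open>exp (1 - \<gamma>)\<close> on the logarithm is at least
    \<open>1 - \<gamma>\<close>; from \<open>b\<close> on this makes \<open>G z\<close>
    positive.\<close>
  define b' where "b' = max b 0 + exp (1 - \<gamma>)"
  have b': "b' \<ge> b" "b' \<ge> exp (1 - \<gamma>)" "b' \<ge> 0" using exp_gt_zero[of "1 - \<gamma>"] by (auto simp: b'_def simp del: exp_gt_zero)
  define z where "z = c + \<i> * of_real (s * (b' + norm c))"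
  have nz: "norm z \<ge> b'" using vertical_far[OF s(1) b'(3), of c] by (simp add: z_def)
  have "- G z = 0"
    using zero_propagates[OF sub _ c s, of "b' + norm c"] G_nonneg G0 b'(3) by (simp add: z_def)
  moreover have "ln (norm z) \<ge> 1 - \<gamma>"
  proof -
    have "exp (1 - \<gamma>) \<le> norm z" using nz b'(2) by linarith
    moreover have "norm z > 0" using calculation exp_gt_zero[of "1 - \<gamma>"] by linarith
    ultimately show ?thesis by (simp add: ln_ge_iff)
  qed
  ultimately show False using b[of z] nz b'(1) by linarith
qed

end

section \<open>Harmonic measures and Green's functions of unions of intervals\<close>

context intervals
begin

lemma harmonic_measure_solution:
  assumes j: "j < N"
  obtains u where "log_harmonic 0 u (harmonic_measure Infty (seg (\<alpha> j) (\<beta> j)) E) E"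
    "\<And>x. x \<in> E \<Longrightarrow> (u \<longlongrightarrow> indicator (seg (\<alpha> j) (\<beta> j)) x) (at x within - E)"
    "\<And>z. z \<notin> E \<Longrightarrow> u z = harmonic_measure (Fin z) (seg (\<alpha> j) (\<beta> j)) E"
proof -
  obtain u L where u: "log_harmonic 0 u L E"
    "\<And>i x. i < N \<Longrightarrow> x \<in> seg (\<alpha> i) (\<beta> i) \<Longrightarrow> (u \<longlongrightarrow> (if i = j then 1 else 0)) (at x within - E)"
    using dirichlet_solution[where t = "\<lambda>i. if i = j then 1 else 0"] by metis
  have bd: "(u \<longlongrightarrow> indicator (seg (\<alpha> j) (\<beta> j)) x) (at x within - E)" if x: "x \<in> E" for x
  proof -
    obtain i where i: "i < N" "x \<in> seg (\<alpha> i) (\<beta> i)" using x unfolding E_def by auto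
    have "(if i = j then 1 else 0) = (indicator (seg (\<alpha> j) (\<beta> j)) x :: real)"
      using i disj[OF i(1) j] by (auto simp: indicator_def)
    thus ?thesis using u(2)[OF i] by simp
  qed
  have L: "harmonic_measure Infty (seg (\<alpha> j) (\<beta> j)) E = L"
    using harmonic_measure_eq[OF compact_E E_nonempty u(1) bd, of Infty] by simp
  show ?thesis
  proof (rule that)
    show "log_harmonic 0 u (harmonic_measure Infty (seg (\<alpha> j) (\<beta> j)) E) E" using u(1) L by simp
    show "u z = harmonic_measure (Fin z) (seg (\<alpha> j) (\<beta> j)) E" if "z \<notin> E" for z
      using harmonic_measure_eq[OF compact_E E_nonempty u(1) bd, of "Fin z"] that by simp
  qed (rule bd)
qed

lemma green_domain_exists: obtains G \<gamma> Q T where "green_domain E G \<gamma> Q T"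
proof -
  obtain G \<gamma> where G: "log_harmonic 1 G \<gamma> E" "\<And>x. x \<in> E \<Longrightarrow> (G \<longlongrightarrow> 0) (at x within - E)"
    using green_at_infinity_exists by metis
  define P where "P = (\<lambda>c q T. log_harmonic 0 q T E \<and> (\<forall>x\<in>E. (q \<longlongrightarrow> ln (norm (x - c))) (at x within - E)))"
  have "\<exists>q T. P c q T" if "c \<notin> E" for c
    using log_boundary_solution[OF that] unfolding P_def by metis
  then obtain Q T where P: "\<And>c. c \<notin> E \<Longrightarrow> P c (Q c) (T c)" by metis
  show ?thesis
  proof (rule that)
    show "green_domain E G \<gamma> Q T"
      by unfold_locales (use compact_E E_nonempty E_real G P in \<open>auto simp: P_def\<close>)
  qed
qed

end

section \<open>Perturbation by short intervals\<close>

text \<open>\<open>u\<close> and \<open>U\<close> share \<kappa>, so their logarithmic terms cancel;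
  harmonic measures (\<open>\<kappa> = 0\<close>) and Green's functions
  (\<open>\<kappa> = 1\<close>) are thus covered together. Once the sum of
  \<open>u (c k) * W k z\<close> is subtracted, the boundary values on \<open>J k\<close> are the
  oscillation \<open>u x - u (c k)\<close>, dominated by those of the sum of
  \<open>\<eta> * W k z\<close>.\<close>

lemma perturbation_bound:
  fixes J :: "nat \<Rightarrow> complex set" and c :: "nat \<Rightarrow> complex"
  assumes K: "compact K" "K \<noteq> {}" and J: "\<And>k. k \<in> A \<Longrightarrow> compact (J k)" "disjoint_family_on J A"
    "finite A" and I: "I = (\<Union>k\<in>A. J k)" and KI: "K \<inter> I = {}"
    and u: "log_harmonic \<kappa> u L K" "\<And>x. x \<in> K \<Longrightarrow> (u \<longlongrightarrow> f x) (at x within - K)"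
    and U: "log_harmonic \<kappa> U M (K \<union> I)" "\<And>x. x \<in> K \<Longrightarrow> (U \<longlongrightarrow> f x) (at x within - (K \<union> I))"
      "\<And>x. x \<in> I \<Longrightarrow> (U \<longlongrightarrow> 0) (at x within - (K \<union> I))"
    and W: "\<And>k. k \<in> A \<Longrightarrow> log_harmonic 0 (W k) (\<omega> k) (K \<union> I)"
      "\<And>k x. k \<in> A \<Longrightarrow> x \<in> K \<union> I \<Longrightarrow> (W k \<longlongrightarrow> indicator (J k) x) (at x within - (K \<union> I))"
    and \<eta>: "\<And>k x. k \<in> A \<Longrightarrow> x \<in> J k \<Longrightarrow> \<bar>u x - u (c k)\<bar> \<le> \<eta>"
  shows "\<bar>L - M - (\<Sum>k\<in>A. u (c k) * \<omega> k)\<bar> \<le> \<eta> * (\<Sum>k\<in>A. \<omega> k)"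
proof -
  let ?E = "K \<union> I"
  have cE: "compact ?E" "?E \<noteq> {}" using K J(1,3) I by (auto intro!: compact_Un compact_UN)
  define h where "h = (\<lambda>z. u z - U z - (\<Sum>k\<in>A. u (c k) * W k z))"
  define g where "g = (\<lambda>z. \<Sum>k\<in>A. \<eta> * W k z)"
  define b where "b = (\<lambda>x. (if x \<in> K then 0 else u x) - (\<Sum>k\<in>A. u (c k) * indicator (J k) x))"
  define e where "e = (\<lambda>x. \<Sum>k\<in>A. \<eta> * indicator (J k) x)"
  have sumW: "log_harmonic 0 (\<lambda>z. \<Sum>k\<in>A. t k * W k z) (\<Sum>k\<in>A. t k * \<omega> k) ?E" for t
  proof (rule log_harmonic_sum)
    show "log_harmonic 0 (\<lambda>z. t k * W k z) (t k * \<omega> k) ?E" if "k \<in> A" for k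
      using log_harmonic_cmult[OF W(1)[OF that], of "t k"] by simp
  qed
  have sumWb: "((\<lambda>z. \<Sum>k\<in>A. t k * W k z) \<longlongrightarrow> (\<Sum>k\<in>A. t k * indicator (J k) x)) (at x within - ?E)"
    if "x \<in> ?E" for t x using W(2) that by (intro tendsto_intros) auto
  have h: "log_harmonic 0 h (L - M - (\<Sum>k\<in>A. u (c k) * \<omega> k)) ?E"
    using log_harmonic_diff[OF log_harmonic_diff[OF log_harmonic_mono[OF u(1)] U(1)] sumW[of "\<lambda>k. u (c k)"]]
    unfolding h_def by auto
  have hb: "(h \<longlongrightarrow> b x) (at x within - ?E)" if x: "x \<in> ?E" for x
  proof (cases "x \<in> K")
    case True
    have "(u \<longlongrightarrow> f x) (at x within - ?E)" by (rule tendsto_within_subset[OF u(2)[OF True]]) auto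
    hence "(h \<longlongrightarrow> f x - f x - (\<Sum>k\<in>A. u (c k) * indicator (J k) x)) (at x within - ?E)"
      unfolding h_def by (intro tendsto_diff U(2) True sumWb x)
    thus ?thesis using True by (simp add: b_def)
  next
    case False
    have "harmonic_at u x" using u(1) False unfolding log_harmonic_def by blast
    hence "(u \<longlongrightarrow> u x) (at x)" using harmonic_at_isCont isCont_def by blast
    hence "(u \<longlongrightarrow> u x) (at x within - ?E)" by (rule tendsto_within_subset) auto
    moreover have "(U \<longlongrightarrow> 0) (at x within - ?E)" using False x by (intro U(3)) auto
    ultimately have "(h \<longlongrightarrow> u x - 0 - (\<Sum>k\<in>A. u (c k) * indicator (J k) x)) (at x within - ?E)"
      unfolding h_def by (intro tendsto_diff sumWb x)
    thus ?thesis using False by (simp add: b_def)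
  qed
  have g: "log_harmonic 0 g (\<Sum>k\<in>A. \<eta> * \<omega> k) ?E" "log_harmonic 0 (\<lambda>z. - g z) (- (\<Sum>k\<in>A. \<eta> * \<omega> k)) ?E"
    using sumW[of "\<lambda>_. \<eta>"] log_harmonic_cmult[OF sumW[of "\<lambda>_. \<eta>"], of "- 1"] by (simp_all add: g_def)
  have gb: "(g \<longlongrightarrow> e x) (at x within - ?E)" "((\<lambda>z. - g z) \<longlongrightarrow> - e x) (at x within - ?E)" if "x \<in> ?E" for x
    unfolding g_def e_def using that by (intro tendsto_minus sumWb; assumption)+
  have le: "\<bar>b x\<bar> \<le> e x" if x: "x \<in> ?E" for x
  proof (cases "x \<in> K")
    case True
    hence "x \<notin> J k" if "k \<in> A" for k using KI I that by auto
    thus ?thesis using True by (simp add: b_def e_def)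
  next
    case False
    then obtain k where k: "k \<in> A" "x \<in> J k" using x I by auto
    have other: "indicator (J i) x = (if i = k then 1 else 0 :: real)" if "i \<in> A" for i
      using J(2) k that unfolding disjoint_family_on_def by (auto simp: indicator_def)
    have s: "(\<Sum>i\<in>A. t i * indicator (J i) x) = t k" for t :: "nat \<Rightarrow> real"
    proof -
      have "(\<Sum>i\<in>A. t i * indicator (J i) x) = (\<Sum>i\<in>A. if i = k then t i else 0)"
        by (intro sum.cong refl) (use other in auto)
      thus ?thesis using k(1) J(3) by simp
    qed
    show ?thesis using False \<eta>[OF k] s[of "\<lambda>k. u (c k)"] s[of "\<lambda>_. \<eta>"] by (simp add: b_def e_def)
  qed
  have le': "b x \<le> e x" "- e x \<le> b x" if "x \<in> ?E" for x using le[OF that] by linarith+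
  have "L - M - (\<Sum>k\<in>A. u (c k) * \<omega> k) \<le> (\<Sum>k\<in>A. \<eta> * \<omega> k)"
    by (rule log_harmonic_le_boundary(2)[OF cE h g(1) hb gb(1) le'(1)])
  moreover have "- (\<Sum>k\<in>A. \<eta> * \<omega> k) \<le> L - M - (\<Sum>k\<in>A. u (c k) * \<omega> k)"
    by (rule log_harmonic_le_boundary(2)[OF cE g(2) h gb(2) hb le'(2)])
  ultimately show ?thesis by (simp add: sum_distrib_left abs_le_iff)
qed

text \<open>In the ellipse identity \<open>1 / norm w\<close> is at most 1, and each focal distance
  is at least \<open>norm (z - c)\<close> minus the distance from \<open>c\<close> to the focus. The
  leading factor \<open>4 / (\<beta> - \<alpha>)\<close> is the exact one at infinity.\<close>

lemma (in interval) norm_joukowski_inv_ge: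
  assumes z: "z \<notin> seg \<alpha> \<beta>" and c: "\<alpha> \<le> c" "c \<le> \<beta>"
  shows "norm (joukowski_inv \<alpha> \<beta> z) \<ge> (4 * norm (z - of_real c) - 3 * (\<beta> - \<alpha>)) / (\<beta> - \<alpha>)"
proof -
  obtain w where w: "norm w > 1" "joukowski \<alpha> \<beta> w = z" using joukowski_surj[OF z] by blast
  have w0: "w \<noteq> 0" using w(1) by auto
  have tri: "norm (z - of_real c) - \<bar>c - b\<bar> \<le> norm (z - of_real b)" for b
  proof -
    have "z - of_real b = (z - of_real c) + of_real (c - b)" by simp
    thus ?thesis using norm_diff_ineq[of "z - of_real c" "of_real (c - b)"] unfolding norm_of_real by simp
  qed
  have a: "norm (z - of_real \<alpha>) \<ge> norm (z - of_real c) - (c - \<alpha>)"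
    and b: "norm (z - of_real \<beta>) \<ge> norm (z - of_real c) - (\<beta> - c)"
    using tri[of \<alpha>] tri[of \<beta>] c by simp_all
  have "1 / norm w \<le> 1" by (rule divide_le_eq_1_pos[THEN iffD2]) (use w(1) in linarith)+
  hence "rad * (norm w + 1 / norm w) \<le> rad * (norm w + 1)" using rad_pos by (intro mult_left_mono) auto
  hence "2 * norm (z - of_real c) - (\<beta> - \<alpha>) \<le> rad * (norm w + 1)"
    using joukowski_ellipse[OF w0] a b unfolding w(2) by linarith
  hence "4 * norm (z - of_real c) - 3 * (\<beta> - \<alpha>) \<le> norm w * (\<beta> - \<alpha>)" by (simp add: algebra_simps)
  thus ?thesis using joukowski_inv_joukowski[OF w(1)] less unfolding w(2) by (simp add: divide_le_eq)
qed

text \<open>The competitor \<open>G - ln |joukowski_inv| + Q c\<close> is, up to a constant, the Green function with pole \<open>c\<close>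
  made bounded by spreading the pole over the short interval.\<close>

lemma (in green_domain) short_interval_lower_bound:
  assumes c: "complex_of_real c \<notin> K"
  obtains \<kappa> len0 where "\<kappa> > 0" "len0 > 0"
    "\<And>B C I u L. \<lbrakk>B \<le> c; c \<le> C; B < C; C - B \<le> len0; compact I; seg B C \<subseteq> I; K \<inter> I = {};
       log_harmonic 0 u L (K \<union> I); \<And>x. x \<in> K \<union> I \<Longrightarrow> (u \<longlongrightarrow> indicator I x) (at x within - (K \<union> I))\<rbrakk>
     \<Longrightarrow> \<kappa> * (C - B) \<le> L"
proof -
  define c' where "c' = complex_of_real c"
  have c': "c' \<notin> K" using c by (simp add: c'_def)
  obtain d where d: "d > 0" "ball c' d \<subseteq> - K" using open_compl c' openE by blast
  have far: "norm (x - c') \<ge> d" if "x \<in> K" for x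
    using d(2) that by (force simp: dist_norm norm_minus_commute)
  define D where "D = cball c' (d/2)"
  have DK: "D \<subseteq> - K"
  proof -
    have "D \<subseteq> ball c' d" using d(1) by (auto simp: D_def)
    thus ?thesis using d(2) by (rule order_trans)
  qed
  have hq: "harmonic_at (Q c') z" if "z \<notin> K" for z using Q(1)[OF c'] that unfolding log_harmonic_def by blast
  have "continuous_on D (\<lambda>z. G z + Q c' z)"
    using DK G_harmonic hq by (intro harmonic_at_continuous_on harmonic_at_add) auto
  hence "bounded ((\<lambda>z. G z + Q c' z) ` D)"
    unfolding D_def by (intro compact_imp_bounded compact_continuous_image compact_cball)
  then obtain M where M: "M > 0" "\<And>z. z \<in> D \<Longrightarrow> G z + Q c' z \<le> M"
    unfolding bounded_pos by (force simp: abs_le_iff)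
  \<comment> \<open>The value at infinity of the Green's function with pole \<open>c\<close>; by
    symmetry it is \<open>G c'\<close>, hence positive.\<close>
  define g where "g = T c' + \<gamma>"
  have g: "g > 0" using G_pos[OF c'] G_eq[OF c'] by (simp add: g_def)
  \<comment> \<open>The first bound keeps the interval inside \<open>ball c' (d / 2)\<close>. The
    second makes the correction \<open>ln (1 - 3 * len / (4 * d))\<close> cost at most half of
    \<open>g\<close>.\<close>
  define len0 where "len0 = min (d / 4) (4 * d / 3 * (1 - exp (- g / 2)))"
  have len0: "len0 > 0" "len0 \<le> d / 4" "len0 \<le> 4 * d / 3 * (1 - exp (- g / 2))"
    using d g by (auto simp: len0_def)
  \<comment> \<open>The comparison below gives \<open>g / 2 \<le> m * L\<close> with
    \<open>m = M + 4 / len\<close>, and \<open>m\<close> is at most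
    \<open>(M * len0 + 4) / len\<close>.\<close>
  define \<kappa> where "\<kappa> = (g / 2) / (M * len0 + 4)"
  have den: "M * len0 + 4 > 0" using M(1) len0(1) by (simp add: add_pos_pos)
  show ?thesis
  proof (rule that)
    show "\<kappa> > 0" using g den by (simp add: \<kappa>_def)
    show "len0 > 0" by fact
    fix B C I u L
    assume BC: "B \<le> c" "c \<le> C" "B < C" "C - B \<le> len0" and I: "compact I" "seg B C \<subseteq> I" "K \<inter> I = {}"
      and u: "log_harmonic 0 u L (K \<union> I)" "\<And>x. x \<in> K \<union> I \<Longrightarrow> (u \<longlongrightarrow> indicator I x) (at x within - (K \<union> I))"
    interpret J: interval B C by unfold_locales (rule BC(3))
    define len where "len = C - B"
    have len: "len > 0" "len \<le> len0" using BC by (auto simp: len_def)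
    \<comment> \<open>The first term cancels Robin's constant of the interval, so that
      \<open>v\<close> is at least \<open>g / 2\<close> at infinity. The second makes
      \<open>v\<close> nonpositive on \<open>K\<close>: there
      \<open>ln (norm (x - c')) + k \<le> j x\<close>, by \<open>norm_joukowski_inv_ge\<close> and
      \<open>norm (x - c') \<ge> d\<close>.\<close>
    define k where "k = ln (4 / len) + ln (1 - 3 * len / (4 * d))"
    define j where "j = (\<lambda>z. ln (norm (joukowski_inv B C z)))"
    define v where "v = (\<lambda>z. G z - j z + Q c' z + k)"
    define S where "S = seg B C"
    have frac: "exp (- g / 2) \<le> 1 - 3 * len / (4 * d)"
    proof -
      have "3 / (4 * d) * len \<le> 3 / (4 * d) * (4 * d / 3 * (1 - exp (- g / 2)))"
        using len(2) len0(3) d(1) by (intro mult_left_mono) auto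
      also have "\<dots> = 1 - exp (- g / 2)" using d(1) by simp
      finally show ?thesis by simp
    qed
    have frac1: "1 - 3 * len / (4 * d) > 0" by (rule less_le_trans[OF exp_gt_zero frac])
    have lnf: "ln (1 - 3 * len / (4 * d)) \<ge> - g / 2" using frac frac1 by (simp add: ln_ge_iff)
    have lnf0: "ln (1 - 3 * len / (4 * d)) \<le> 0" using frac1 len(1) d(1) by (intro ln_le_zero_iff[THEN iffD2]) auto
    have S: "compact S" "S \<subseteq> ball c' (d / 2)"
    proof -
      show "compact S" by (simp add: S_def compact_seg)
      show "S \<subseteq> ball c' (d / 2)"
      proof
        fix x assume "x \<in> S"
        then obtain t where t: "x = of_real t" "B \<le> t" "t \<le> C" by (auto simp: S_def seg_def)
        have "norm (x - c') = \<bar>t - c\<bar>" unfolding t(1) c'_def of_real_diff[symmetric] norm_of_real ..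
        also have "\<dots> \<le> len" using t BC by (auto simp: len_def abs_le_iff)
        finally show "x \<in> ball c' (d / 2)" using len(2) len0(2) d(1) by (simp add: dist_norm norm_minus_commute)
      qed
    qed
    have KS: "K \<inter> S = {}" using I by (auto simp: S_def)
    have jl: "log_harmonic 1 j (ln (4 / len)) S"
      using J.interval_green_log_harmonic by (simp add: j_def len_def S_def)
    have jpos: "j z > 0" if "z \<notin> S" for z
      using J.norm_joukowski_inv_gt_1[of z] that unfolding j_def S_def by (intro ln_gt_zero)
    have v: "log_harmonic 0 v (g + ln (1 - 3 * len / (4 * d))) (K \<union> S)"
    proof -
      have "log_harmonic (1 - 1 + 0 + 0) v (\<gamma> - ln (4 / len) + T c' + k) (K \<union> S)"
        unfolding v_def
        by (intro log_harmonic_add log_harmonic_diff log_harmonic_const log_harmonic_mono[OF G(1)]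
            log_harmonic_mono[OF jl] log_harmonic_mono[OF Q(1)[OF c']]) auto
      thus ?thesis by (simp add: k_def g_def algebra_simps)
    qed
    \<comment> \<open>An upper bound for \<open>v\<close> near the interval. Estimating
      \<open>ln (4 / len)\<close> by \<open>4 / len\<close> is what makes the final bound linear in
      \<open>len\<close>.\<close>
    define m where "m = M + 4 / len"
    have m: "m > 0" using M(1) len(1) by (simp add: m_def add_pos_pos)
    have kle: "k \<le> 4 / len"
      using lnf0 ln_le_minus_one[of "4 / len"] len(1) by (simp add: k_def)
    have bK: "\<forall>\<^sub>F z in at x within - (K \<union> S). v z < \<epsilon>" if x: "x \<in> K" and "\<epsilon> > 0" for x \<epsilon>
    proof -
      have xS: "x \<notin> S" using x KS by auto
      have "harmonic_at j x" using jl xS unfolding log_harmonic_def by blast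
      hence "(j \<longlongrightarrow> j x) (at x)" using harmonic_at_isCont isCont_def by blast
      hence "(j \<longlongrightarrow> j x) (at x within - (K \<union> S))" by (rule tendsto_within_subset) auto
      moreover have "(G \<longlongrightarrow> 0) (at x within - (K \<union> S))" by (rule tendsto_within_subset[OF G(2)[OF x]]) auto
      moreover have "(Q c' \<longlongrightarrow> ln (norm (x - c'))) (at x within - (K \<union> S))"
        by (rule tendsto_within_subset[OF Q(2)[OF c' x]]) auto
      ultimately have "(v \<longlongrightarrow> 0 - j x + ln (norm (x - c')) + k) (at x within - (K \<union> S))"
        unfolding v_def by (intro tendsto_intros)
      moreover have "0 - j x + ln (norm (x - c')) + k \<le> 0"
      proof -
        define n where "n = norm (x - c')"
        have n: "n \<ge> d" "n > 0" using far[OF x] d(1) by (auto simp: n_def)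
        have "n * (4 / len) * (1 - 3 * len / (4 * d)) = (4 * n - 3 * len * (n / d)) / len"
          using len(1) d(1) by (simp add: field_simps)
        also have "\<dots> \<le> (4 * n - 3 * len * 1) / len"
          using len(1) n(1) d(1) by (intro divide_right_mono diff_left_mono mult_left_mono) auto
        also have "\<dots> \<le> norm (joukowski_inv B C x)"
          using J.norm_joukowski_inv_ge[of x c] xS BC by (simp add: S_def n_def c'_def len_def)
        finally have le: "n * (4 / len) * (1 - 3 * len / (4 * d)) \<le> norm (joukowski_inv B C x)" .
        have pos: "n * (4 / len) > 0" using n len by simp
        have "ln n + k = ln (n * (4 / len) * (1 - 3 * len / (4 * d)))"
        proof -
          have "ln (n * (4 / len) * (1 - 3 * len / (4 * d))) = ln (n * (4 / len)) + ln (1 - 3 * len / (4 * d))"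
            by (rule ln_mult_pos[OF pos frac1])
          also have "ln (n * (4 / len)) = ln n + ln (4 / len)" using n len by (intro ln_mult_pos) auto
          finally show ?thesis by (simp add: k_def)
        qed
        also have "\<dots> \<le> j x" unfolding j_def using le mult_pos_pos[OF pos frac1] by (intro ln_mono) auto
        finally show ?thesis by (simp add: n_def)
      qed
      ultimately show ?thesis using \<open>\<epsilon> > 0\<close> by (intro order_tendstoD(2)[of v "0 - j x + ln (norm (x - c')) + k"]) auto
    qed
    have bS: "\<forall>\<^sub>F z in at x within - (K \<union> S). v z < m" if x: "x \<in> S" for x
    proof -
      have "\<forall>\<^sub>F z in at x within - (K \<union> S). z \<in> ball c' (d / 2)"
        using x S(2) by (intro filter_leD[OF at_within_le_nhds] eventually_nhds_in_open) auto
      moreover have "\<forall>\<^sub>F z in at x within - (K \<union> S). z \<in> - (K \<union> S)" by (simp add: eventually_at_filter)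
      ultimately show ?thesis
      proof eventually_elim
        case (elim z)
        have "G z + Q c' z \<le> M" using elim(1) by (intro M(2)) (simp add: D_def)
        moreover have "j z > 0" using elim(2) by (intro jpos) auto
        ultimately show ?case using kle by (simp add: v_def m_def)
      qed
    qed
    \<comment> \<open>The bound is needed off the interval as well, because \<open>I\<close> may be
      larger than \<open>S\<close> and the comparison with \<open>m * u\<close> takes place on
      \<open>K \<union> I\<close>.\<close>
    have vm: "v z \<le> m" if "z \<notin> K \<union> S" for z
    proof (rule log_harmonic_le(1)[OF _ _ v log_harmonic_const _ that])
      show "compact (K \<union> S)" "K \<union> S \<noteq> {}" using K S(1) by (auto intro: compact_Un)
      fix \<zeta> and \<epsilon> :: real assume z: "\<zeta> \<in> K \<union> S" "\<epsilon> > 0"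
      have "\<forall>\<^sub>F w in at \<zeta> within - (K \<union> S). v w < m"
        using z bS bK[of \<zeta> m] m by blast
      thus "\<forall>\<^sub>F w in at \<zeta> within - (K \<union> S). v w < m + \<epsilon>" by eventually_elim (use z in simp)
    qed
    have sub: "K \<union> S \<subseteq> K \<union> I" using I by (auto simp: S_def)
    have "g + ln (1 - 3 * len / (4 * d)) \<le> m * L"
    proof (rule log_harmonic_le(2)[OF _ _ log_harmonic_mono[OF v sub]])
      show "compact (K \<union> I)" "K \<union> I \<noteq> {}" using K I(1) by (auto intro: compact_Un)
      show "log_harmonic 0 (\<lambda>z. m * u z) (m * L) (K \<union> I)" using log_harmonic_cmult[OF u(1), of m] by simp
      fix \<zeta> and \<epsilon> :: real assume \<zeta>: "\<zeta> \<in> K \<union> I" "\<epsilon> > 0"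
      have mu: "((\<lambda>z. m * u z) \<longlongrightarrow> m * indicator I \<zeta>) (at \<zeta> within - (K \<union> I))"
        by (intro tendsto_intros u(2) \<zeta>)
      show "\<forall>\<^sub>F w in at \<zeta> within - (K \<union> I). v w < m * u w + \<epsilon>"
      proof (cases "\<zeta> \<in> K")
        case True
        have "at \<zeta> within - (K \<union> I) \<le> at \<zeta> within - (K \<union> S)" using sub by (intro at_le) auto
        from filter_leD[OF this bK[OF True, of "\<epsilon>/2"]] \<zeta>(2)
        have "\<forall>\<^sub>F w in at \<zeta> within - (K \<union> I). v w < \<epsilon> / 2" by simp
        moreover have "\<forall>\<^sub>F w in at \<zeta> within - (K \<union> I). m * u w > - (\<epsilon> / 2)"
        proof (rule order_tendstoD(1)[OF mu])
          have "\<zeta> \<notin> I" using True I(3) by auto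
          thus "- (\<epsilon> / 2) < m * indicator I \<zeta>" using \<zeta>(2) by simp
        qed
        ultimately show ?thesis by eventually_elim simp
      next
        case False
        hence "\<zeta> \<in> I" using \<zeta> by simp
        hence "\<forall>\<^sub>F w in at \<zeta> within - (K \<union> I). m * u w > m - \<epsilon>"
          using \<zeta>(2) by (intro order_tendstoD(1)[OF mu]) simp
        moreover have "\<forall>\<^sub>F z in at \<zeta> within - (K \<union> I). z \<in> - (K \<union> I)" by (simp add: eventually_at_filter)
        ultimately show ?thesis
        proof eventually_elim
          case (elim w)
          have "v w \<le> m" using elim(2) sub by (intro vm) auto
          thus ?case using elim(1) by simp
        qed
      qed
    qed
    hence "g / 2 \<le> m * L" using lnf by simp
    moreover have "m \<le> (M * len0 + 4) / len"
      using M(1) len by (simp add: m_def field_simps)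
    moreover have "L \<ge> 0"
      using \<open>g / 2 \<le> m * L\<close> g m by (smt (verit) mult_pos_neg zero_less_divide_iff)
    ultimately have "g / 2 \<le> (M * len0 + 4) / len * L" by (meson mult_right_mono order_trans)
    thus "\<kappa> * (C - B) \<le> L" using len(1) den by (simp add: \<kappa>_def len_def[symmetric] field_simps)
  qed
qed

section \<open>Elementary estimates for the error terms\<close>

lemma harmonic_at_lipschitz:
  assumes "harmonic_at u c"
  obtains A \<rho> where "A > 0" "\<rho> > 0" "\<And>x. norm (x - c) < \<rho> \<Longrightarrow> \<bar>u x - u c\<bar> \<le> A * norm (x - c)"
proof -
  obtain r where r: "r > 0" "\<And>w. dist w c < r \<Longrightarrow> harmonic_at u w"
    using harmonic_at_eventually[OF assms] unfolding eventually_nhds_metric by blast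
  obtain D where "\<And>z. z \<in> ball c r \<Longrightarrow> (u has_derivative (\<lambda>h. Re (D z * h))) (at z)"
    by (rule harmonic_at_gradient[of "ball c r" u]) (use r in \<open>auto simp: dist_commute\<close>)
  hence "(u has_derivative (\<lambda>h. Re (D c * h))) (at c)" using r(1) by simp
  then obtain \<rho> where \<rho>: "\<rho> > 0"
    "\<And>y. norm (y - c) < \<rho> \<Longrightarrow> norm (u y - u c - Re (D c * (y - c))) \<le> 1 * norm (y - c)"
    unfolding has_derivative_at_alt by (meson zero_less_one)
  show ?thesis
  proof (rule that)
    show "norm (D c) + 1 > 0" by (simp add: add_nonneg_pos)
    fix x assume "norm (x - c) < \<rho>"
    from \<rho>(2)[OF this] have "\<bar>u x - u c - Re (D c * (x - c))\<bar> \<le> norm (x - c)" by simp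
    moreover have "\<bar>Re (D c * (x - c))\<bar> \<le> norm (D c) * norm (x - c)"
      using abs_Re_le_cmod[of "D c * (x - c)"] by (simp only: norm_mult)
    ultimately show "\<bar>u x - u c\<bar> \<le> (norm (D c) + 1) * norm (x - c)" by (simp add: distrib_right)
  qed (rule \<rho>(1))
qed

text \<open>The lower bound on harmonic measure only covers intervals up to a fixed length; a longer
  one is first cut down to that length around \<open>c\<close>.\<close>

lemma subinterval_of_length:
  fixes B C c b :: real
  assumes "B \<le> c" "c \<le> C" "B < C" "b > 0"
  obtains B' C' where "B \<le> B'" "B' \<le> c" "c \<le> C'" "C' \<le> C" "B' < C'" "C' - B' = min (C - B) b"
proof (cases "C - B \<le> b")
  case True thus ?thesis using assms that[of B C] by simp
next
  case False
  show ?thesis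
  proof (cases "C - c \<ge> b")
    case True thus ?thesis using assms False that[of c "c + b"] by simp
  next
    case F: False thus ?thesis using assms False that[of "C - b" C] by simp
  qed
qed

lemma abs_exp_minus_one_le:
  assumes "\<bar>y\<bar> \<le> (1::real)" shows "\<bar>exp y - 1\<bar> \<le> 2 * \<bar>y\<bar>"
proof (cases "y \<ge> 0")
  case True
  have "y * y \<le> 1 * y" using assms True by (intro mult_right_mono) auto
  thus ?thesis using exp_bound[of y] assms True by (simp add: power2_eq_square)
next
  case False
  hence "\<bar>exp y - 1\<bar> = 1 - exp y" "\<bar>y\<bar> = - y" by auto
  moreover have "1 + y \<le> exp y" by (rule exp_ge_add_one_self)
  ultimately show ?thesis using False by linarith
qed

text \<open>The perturbation argument produces the square of the total harmonic measure; this turns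
  it into the maximum of the squares, at the cost of the factor \<open>m^2\<close>.\<close>

lemma square_sum_le_Max_square:
  fixes f :: "nat \<Rightarrow> real"
  assumes "m \<ge> 1"
  shows "(\<Sum>k=1..m. f k)\<^sup>2 \<le> (real m)\<^sup>2 * (MAX k\<in>{1..m}. (f k)\<^sup>2)"
proof -
  define M where "M = (MAX k\<in>{1..m}. (f k)\<^sup>2)"
  have fM: "(f k)\<^sup>2 \<le> M" if "k \<in> {1..m}" for k unfolding M_def using that by (intro Max_ge) auto
  hence M0: "M \<ge> 0" using assms order_trans[OF zero_le_power2 fM[of 1]] by simp
  have "\<bar>f k\<bar> \<le> sqrt M" if "k \<in> {1..m}" for k
    using real_sqrt_le_mono[OF fM[OF that]] by simp
  hence "\<bar>\<Sum>k=1..m. f k\<bar> \<le> (\<Sum>k=1..m. sqrt M)"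
    by (intro order_trans[OF sum_abs] sum_mono)
  hence "\<bar>\<Sum>k=1..m. f k\<bar> \<le> real m * sqrt M" by simp
  hence "\<bar>\<Sum>k=1..m. f k\<bar>\<^sup>2 \<le> (real m * sqrt M)\<^sup>2" by (intro power_mono) auto
  thus ?thesis using M0 by (simp add: M_def power_mult_distrib)
qed

text \<open>The error in replacing \<open>u\<close> by \<open>u (c k)\<close> on \<open>J k i\<close> is at most a constant times the length of
  \<open>J k i\<close>, which in turn is at most a constant times the sum of the harmonic measures.\<close>

lemma (in green_domain) perturbation_bigo:
  fixes J :: "nat \<Rightarrow> nat \<Rightarrow> complex set" and c :: "nat \<Rightarrow> real" and \<omega> B C :: "nat \<Rightarrow> nat \<Rightarrow> real"
  assumes m: "m \<ge> 1"
    and J: "\<And>k i. J k i = seg (B k i) (C k i)" "\<And>i. disjoint_family_on (\<lambda>k. J k i) {1..m}"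
    and I: "\<And>i. I i = (\<Union>k\<in>{1..m}. J k i)" "\<And>i. K \<inter> I i = {}"
    and BC: "\<And>k i. k \<in> {1..m} \<Longrightarrow> B k i < C k i"
    and c: "\<And>k i. k \<in> {1..m} \<Longrightarrow> B k i \<le> c k \<and> c k \<le> C k i"
    and W: "\<And>k i. k \<in> {1..m} \<Longrightarrow> log_harmonic 0 (W k i) (\<omega> k i) (K \<union> I i)"
      "\<And>k i x. k \<in> {1..m} \<Longrightarrow> x \<in> K \<union> I i \<Longrightarrow> (W k i \<longlongrightarrow> indicator (J k i) x) (at x within - (K \<union> I i))"
    and \<omega>: "\<And>k. k \<in> {1..m} \<Longrightarrow> \<omega> k \<longlonglongrightarrow> 0"
    and u: "log_harmonic \<kappa> u L K" "\<And>x. x \<in> K \<Longrightarrow> (u \<longlongrightarrow> f x) (at x within - K)"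
    and U: "\<And>i. log_harmonic \<kappa> (U i) (M i) (K \<union> I i)"
      "\<And>i x. x \<in> K \<Longrightarrow> (U i \<longlongrightarrow> f x) (at x within - (K \<union> I i))"
      "\<And>i x. x \<in> I i \<Longrightarrow> (U i \<longlongrightarrow> 0) (at x within - (K \<union> I i))"
  shows "(\<lambda>i. L - M i - (\<Sum>k=1..m. u (of_real (c k)) * \<omega> k i)) \<in> O(\<lambda>i. MAX k\<in>{1..m}. (\<omega> k i)\<^sup>2)"
proof -
  define \<sigma> where "\<sigma> = (\<lambda>i. \<Sum>k=1..m. \<omega> k i)"
  have compI: "compact (I i)" for i unfolding I(1) J(1) by (intro compact_UN compact_seg) auto
  have cJ: "of_real (c k) \<in> J k i" if "k \<in> {1..m}" for k i using c[OF that] by (simp add: J(1))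
  \<comment> \<open>Any index serves, since \<open>c k\<close> lies in every \<open>J k i\<close>;
    hence the \<open>undefined\<close>.\<close>
  have cK: "complex_of_real (c k) \<notin> K" if "k \<in> {1..m}" for k
    using cJ[OF that] I(2)[of undefined] that unfolding I(1) by blast
  have \<sigma>0: "\<sigma> \<longlonglongrightarrow> 0"
    unfolding \<sigma>_def using tendsto_sum[of "{1..m}" \<omega> "\<lambda>_. 0" sequentially] \<omega> by simp
  \<comment> \<open>The sum of the \<open>W k i\<close> solves the problem for the whole set
    \<open>I i\<close>, so \<open>\<sigma> i\<close> is its harmonic measure.\<close>
  have V: "log_harmonic 0 (\<lambda>z. \<Sum>k=1..m. W k i z) (\<sigma> i) (K \<union> I i)" for i
    unfolding \<sigma>_def using W(1) by (rule log_harmonic_sum)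
  have Vb: "((\<lambda>z. \<Sum>k=1..m. W k i z) \<longlongrightarrow> indicator (I i) x) (at x within - (K \<union> I i))"
    if x: "x \<in> K \<union> I i" for i x
  proof -
    have "(\<Sum>k=1..m. indicator (J k i) x) = (indicator (I i) x :: real)"
      unfolding I(1) by (subst indicator_UN_disjoint[OF _ J(2)]) auto
    moreover have "((\<lambda>z. \<Sum>k=1..m. W k i z) \<longlongrightarrow> (\<Sum>k=1..m. indicator (J k i) x)) (at x within - (K \<union> I i))"
      by (intro tendsto_sum W(2) x)
    ultimately show ?thesis by simp
  qed
  \<comment> \<open>The lengths are not yet known to be small, so an interval counts with at most
    \<open>b0\<close> of its length.\<close>
  have "\<exists>b b0. b > 0 \<and> b0 > 0 \<and> (\<forall>i. b * min (C k i - B k i) b0 \<le> \<sigma> i)" if k: "k \<in> {1..m}" for k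
  proof -
    obtain b b0 where b: "b > 0" "b0 > 0"
      "\<And>B C I u L. \<lbrakk>B \<le> c k; c k \<le> C; B < C; C - B \<le> b0; compact I; seg B C \<subseteq> I; K \<inter> I = {};
       log_harmonic 0 u L (K \<union> I); \<And>x. x \<in> K \<union> I \<Longrightarrow> (u \<longlongrightarrow> indicator I x) (at x within - (K \<union> I))\<rbrakk>
        \<Longrightarrow> b * (C - B) \<le> L"
      using short_interval_lower_bound[OF cK[OF k]] by metis
    have "b * min (C k i - B k i) b0 \<le> \<sigma> i" for i
    proof -
      obtain B' C' where BC': "B k i \<le> B'" "B' \<le> c k" "c k \<le> C'" "C' \<le> C k i" "B' < C'"
          "C' - B' = min (C k i - B k i) b0"
        using subinterval_of_length[of "B k i" "c k" "C k i" b0] c[OF k] BC[OF k] b(2) by metis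
      have "seg B' C' \<subseteq> J k i" using BC' by (auto simp: J(1) mem_seg_iff)
      hence "seg B' C' \<subseteq> I i" using k unfolding I(1) by blast
      hence "b * (C' - B') \<le> \<sigma> i"
        using BC' by (intro b(3)[OF _ _ _ _ compI _ I(2) V Vb]) auto
      thus ?thesis using BC'(6) by simp
    qed
    thus ?thesis using b by blast
  qed
  then obtain b b0 where b: "\<And>k. k \<in> {1..m} \<Longrightarrow> b k > 0" "\<And>k. k \<in> {1..m} \<Longrightarrow> b0 k > 0"
    "\<And>k i. k \<in> {1..m} \<Longrightarrow> b k * min (C k i - B k i) (b0 k) \<le> \<sigma> i" by metis
  have \<sigma>nn: "\<sigma> i \<ge> 0" for i
  proof -
    have "0 < b 1 * min (C 1 i - B 1 i) (b0 1)" using b(1,2)[of 1] BC[of 1 i] m by simp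
    thus ?thesis using b(3)[of 1 i] m by simp
  qed
  \<comment> \<open>As soon as \<open>\<sigma> i\<close> is below \<open>b k * b0 k\<close>, the
    minimum has to be the length itself. This is the rate at which the intervals shrink.\<close>
  have len: "\<forall>\<^sub>F i in sequentially. C k i - B k i \<le> \<sigma> i / b k" if k: "k \<in> {1..m}" for k
  proof -
    have "\<forall>\<^sub>F i in sequentially. \<sigma> i < b k * b0 k"
      using \<sigma>0 by (rule order_tendstoD) (use b k in simp)
    thus ?thesis
    proof eventually_elim
      case (elim i)
      have "b k * min (C k i - B k i) (b0 k) < b k * b0 k" using b(3)[OF k, of i] elim by linarith
      hence "min (C k i - B k i) (b0 k) < b0 k" using b(1)[OF k] by simp
      hence "b k * (C k i - B k i) \<le> \<sigma> i" using b(3)[OF k, of i] by (simp add: min_def split: if_splits)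
      thus ?case using b(1)[OF k] by (simp add: field_simps)
    qed
  qed
  have "\<exists>A \<rho>. A > 0 \<and> \<rho> > 0 \<and> (\<forall>x. norm (x - of_real (c k)) < \<rho> \<longrightarrow> \<bar>u x - u (of_real (c k))\<bar> \<le> A * norm (x - of_real (c k)))"
    if k: "k \<in> {1..m}" for k
  proof -
    have "harmonic_at u (of_real (c k))" using u(1) cK[OF k] unfolding log_harmonic_def by blast
    from harmonic_at_lipschitz[OF this] show ?thesis by metis
  qed
  then obtain A \<rho> where A: "\<And>k. k \<in> {1..m} \<Longrightarrow> A k > 0" "\<And>k. k \<in> {1..m} \<Longrightarrow> \<rho> k > 0"
    "\<And>k x. k \<in> {1..m} \<Longrightarrow> norm (x - of_real (c k)) < \<rho> k \<Longrightarrow>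
       \<bar>u x - u (of_real (c k))\<bar> \<le> A k * norm (x - of_real (c k))" by metis
  \<comment> \<open>One constant for all \<open>k\<close>: the Lipschitz constant \<open>A k\<close>
    times the length bound \<open>\<sigma> i / b k\<close> is at most
    \<open>A' * \<sigma> i\<close>.\<close>
  define A' where "A' = (\<Sum>k=1..m. A k / b k)"
  have A'0: "A' \<ge> 0" unfolding A'_def using A(1) b(1) by (intro sum_nonneg) (auto intro: less_imp_le)
  have small: "\<forall>\<^sub>F i in sequentially. \<sigma> i / b k < \<rho> k" if k: "k \<in> {1..m}" for k
    using tendsto_divide_zero[OF \<sigma>0, of "b k"] by (rule order_tendstoD) (use A(2) k in simp)
  have "\<forall>\<^sub>F i in sequentially. \<forall>k\<in>{1..m}. C k i - B k i \<le> \<sigma> i / b k \<and> \<sigma> i / b k < \<rho> k"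
    by (intro eventually_ball_finite ballI eventually_conj len small) auto
  hence "\<forall>\<^sub>F i in sequentially. norm (L - M i - (\<Sum>k=1..m. u (of_real (c k)) * \<omega> k i)) \<le>
     A' * (real m)\<^sup>2 * norm (MAX k\<in>{1..m}. (\<omega> k i)\<^sup>2)"
  proof eventually_elim
    case (elim i)
    have osc: "\<bar>u x - u (of_real (c k))\<bar> \<le> A' * \<sigma> i" if k: "k \<in> {1..m}" and x: "x \<in> J k i" for k x
    proof -
      obtain t where t: "x = of_real t" "B k i \<le> t" "t \<le> C k i" using x unfolding J(1) seg_def by auto
      have "norm (x - of_real (c k)) = \<bar>t - c k\<bar>" unfolding t(1) of_real_diff[symmetric] norm_of_real ..
      also have "\<dots> \<le> C k i - B k i" using t c[OF k, of i] by (auto simp: abs_le_iff)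
      finally have n: "norm (x - of_real (c k)) \<le> \<sigma> i / b k" using elim k by force
      have "\<bar>u x - u (of_real (c k))\<bar> \<le> A k * norm (x - of_real (c k))"
        using n elim k by (intro A(3)[OF k]) force
      also have "\<dots> \<le> A k * (\<sigma> i / b k)" using n A(1)[OF k] by (intro mult_left_mono) auto
      also have "\<dots> = A k / b k * \<sigma> i" by simp
      also have "\<dots> \<le> A' * \<sigma> i"
        unfolding A'_def using k A(1) b(1) \<sigma>nn
        by (intro mult_right_mono member_le_sum) (auto intro: less_imp_le)
      finally show ?thesis .
    qed
    have "\<bar>L - M i - (\<Sum>k\<in>{1..m}. u (of_real (c k)) * \<omega> k i)\<bar> \<le> A' * \<sigma> i * (\<Sum>k\<in>{1..m}. \<omega> k i)"
    proof (rule perturbation_bound[of K "{1..m}" "\<lambda>k. J k i" "I i" \<kappa> u L f "U i" "M i" "\<lambda>k. W k i" "\<lambda>k. \<omega> k i"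
          "\<lambda>k. of_real (c k)" "A' * \<sigma> i"])
      show "compact (J k i)" for k unfolding J(1) by (rule compact_seg)
    qed (use K J(2) I u U W osc in auto)
    also have "\<dots> = A' * (\<sigma> i)\<^sup>2" by (simp add: \<sigma>_def power2_eq_square)
    also have "\<dots> \<le> A' * ((real m)\<^sup>2 * (MAX k\<in>{1..m}. (\<omega> k i)\<^sup>2))"
      unfolding \<sigma>_def using A'0 square_sum_le_Max_square[OF m] by (intro mult_left_mono)
    also have "\<dots> \<le> A' * (real m)\<^sup>2 * norm (MAX k\<in>{1..m}. (\<omega> k i)\<^sup>2)"
      using A'0 unfolding mult.assoc by (intro mult_left_mono) auto
    finally show ?case by simp
  qed
  thus ?thesis by (rule bigoI)
qed

theorem corollary0p3:
  fixes l m :: nat and a c :: "nat \<Rightarrow> real" and s :: "nat \<Rightarrow> nat"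
    and B C :: "nat \<Rightarrow> nat \<Rightarrow> real" and \<delta> :: real
    and Ej :: "nat \<Rightarrow> complex set" and E :: "complex set"
    and J :: "nat \<Rightarrow> nat \<Rightarrow> complex set" and I :: "nat \<Rightarrow> complex set"
    and \<omega> :: "nat \<Rightarrow> nat \<Rightarrow> real"
  assumes "l \<ge> 1" and "m \<ge> 1"
    and "strict_mono_on {1..2 * l} a"
    and "\<And>j. Ej j = complex_of_real ` {a (2 * j - 1)..a (2 * j)}"
    and "E = (\<Union>j\<in>{1..l}. Ej j)"
    and "strict_mono s"
    and "\<And>k n. J k n = complex_of_real ` {B k n..C k n}"
    and "\<And>n. I n = (\<Union>k\<in>{1..m}. J k n)"
    and "\<And>i k. k \<in> {1..m} \<Longrightarrow> B k (s i) < C k (s i)"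
    and "\<And>i. disjoint_family_on (\<lambda>k. J k (s i)) {1..m}"
    and "\<delta> > 0" and "\<And>i. setdist E (I (s i)) \<ge> \<delta>"
    and "\<And>k. k \<in> {1..m} \<Longrightarrow> (\<Inter>i. J k (s i)) = {complex_of_real (c k)}"
    and "\<And>k n. \<omega> k n = harmonic_measure Infty (J k n) (E \<union> I n)"
    and "\<And>k. k \<in> {1..m} \<Longrightarrow> (\<lambda>i. \<omega> k (s i)) \<longlonglongrightarrow> 0"
  shows "(\<exists>R :: nat \<Rightarrow> real. R \<in> O(\<lambda>i. MAX k\<in>{1..m}. (\<omega> k (s i))\<^sup>2) \<and>
           (\<forall>i. capacity (E \<union> I (s i)) =
              capacity E *
              (\<Prod>k=1..m. abs_complex_green Infty (Fin (complex_of_real (c k))) E powr \<omega> k (s i)) *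
              (1 + R i))) \<and>
         (\<forall>j\<in>{1..l}.
           (\<lambda>i. harmonic_measure Infty (Ej j) (E \<union> I (s i)) -
                (harmonic_measure Infty (Ej j) E -
                 (\<Sum>k=1..m. \<omega> k (s i) *
                    harmonic_measure (Fin (complex_of_real (c k))) (Ej j) E)))
           \<in> O(\<lambda>i. MAX k\<in>{1..m}. (\<omega> k (s i))\<^sup>2))"
proof -
  note l = assms(1) and m = assms(2) and a_mono = assms(3) and Ej = assms(4) and E = assms(5)
    and J = assms(7) and I = assms(8) and BC = assms(9) and disjJ = assms(10) and \<delta> = assms(11)
    and far = assms(12) and cJ = assms(13) and \<omega> = assms(14) and \<omega>0 = assms(15)
  have Ej_seg: "Ej j = seg (a (2 * j - 1)) (a (2 * j))" for j by (simp add: Ej seg_def)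
  have J_seg: "J k n = seg (B k n) (C k n)" for k n by (simp add: J seg_def)
  have I_sub: "J k n \<subseteq> I n" if "k \<in> {1..m}" for k n using that by (auto simp: I)
  have EI: "x \<notin> I (s i)" if "x \<in> E" for x i
  proof
    assume "x \<in> I (s i)"
    hence "setdist E (I (s i)) \<le> dist x x" using that by (intro setdist_le_dist)
    thus False using far[of i] \<delta> by simp
  qed
  have c: "B k (s i) \<le> c k \<and> c k \<le> C k (s i)" if "k \<in> {1..m}" for k i
  proof -
    have "complex_of_real (c k) \<in> J k (s i)" using cJ[OF that] by blast
    thus ?thesis by (simp add: J_seg)
  qed
  have a_less: "a p < a q" if "p \<in> {1..2 * l}" "q \<in> {1..2 * l}" "p < q" for p q
    using a_mono that by (rule strict_mono_onD)
  have E_disj: "x \<notin> seg (a (2 * j + 1)) (a (2 * j + 2))"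
    if h: "p < l" "j < l" "p \<noteq> j" "x \<in> seg (a (2 * p + 1)) (a (2 * p + 2))" for p j x
  proof -
    consider "p < j" | "j < p" using h(3) by linarith
    thus ?thesis
    proof cases
      case 1
      have "a (2 * p + 2) < a (2 * j + 1)" by (rule a_less) (use 1 h in auto)
      thus ?thesis using h(4) by (auto simp: mem_seg_iff)
    next
      case 2
      have "a (2 * j + 2) < a (2 * p + 1)" by (rule a_less) (use 2 h in auto)
      thus ?thesis using h(4) by (auto simp: mem_seg_iff)
    qed
  qed
  \<comment> \<open>Numbering starts at 0 here, so \<open>Ej j\<close> is interval number
    \<open>j - 1\<close>.\<close>
  interpret E0: intervals l "\<lambda>j. a (2 * j + 1)" "\<lambda>j. a (2 * j + 2)"
  proof
    show "a (2 * j + 1) < a (2 * j + 2)" if "j < l" for j by (rule a_less) (use that in auto)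
    show "x \<notin> seg (a (2 * j + 1)) (a (2 * j + 2))"
      if "p < l" "j < l" "p \<noteq> j" "x \<in> seg (a (2 * p + 1)) (a (2 * p + 2))" for p j x
      by (rule E_disj[OF that])
  qed (rule l)
  have Ej_Suc: "Ej j = seg (a (2 * (j - 1) + 1)) (a (2 * (j - 1) + 2))" if "j \<in> {1..l}" for j
  proof -
    have "2 * j - 1 = 2 * (j - 1) + 1" "2 * j = 2 * (j - 1) + 2" using that by auto
    thus ?thesis by (simp only: Ej_seg)
  qed
  have E0_E: "E0.E = E"
  proof -
    have "E = (\<Union>j\<in>{1..l}. seg (a (2 * (j - 1) + 1)) (a (2 * (j - 1) + 2)))"
      unfolding E using Ej_Suc by auto
    also have "\<dots> = (\<Union>j\<in>Suc ` {..<l}. seg (a (2 * (j - 1) + 1)) (a (2 * (j - 1) + 2)))"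
      by (simp only: image_Suc_lessThan)
    finally show ?thesis unfolding E0.E_def by simp
  qed
  obtain G \<gamma> Q T where gd: "green_domain E G \<gamma> Q T"
    using E0.green_domain_exists unfolding E0_E by metis
  interpret green_domain E G \<gamma> Q T by (rule gd)
  \<comment> \<open>The \<open>l\<close> intervals of \<open>E\<close> come first and those of
    \<open>I (s i)\<close> follow; \<open>J k (s i)\<close> has number
    \<open>l + k - 1\<close>.\<close>
  define \<alpha> where "\<alpha> = (\<lambda>i j. if j < l then a (2 * j + 1) else B (j - l + 1) (s i))"
  define \<beta> where "\<beta> = (\<lambda>i j. if j < l then a (2 * j + 2) else C (j - l + 1) (s i))"
  have seg_low: "seg (\<alpha> i j) (\<beta> i j) = seg (a (2 * j + 1)) (a (2 * j + 2))" if "j < l" for i j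
    using that by (simp add: \<alpha>_def \<beta>_def)
  have seg_high: "seg (\<alpha> i j) (\<beta> i j) = J (j - l + 1) (s i)" if "\<not> j < l" for i j
    using that by (simp add: \<alpha>_def \<beta>_def J_seg)
  have low_E: "seg (\<alpha> i j) (\<beta> i j) \<subseteq> E" if "j < l" for i j
    using E0.seg_subset[OF that] unfolding E0_E seg_low[OF that] .
  have high_I: "seg (\<alpha> i j) (\<beta> i j) \<subseteq> I (s i)" if "\<not> j < l" "j < l + m" for i j
    unfolding seg_high[OF that(1)] by (rule I_sub) (use that in auto)
  have iv: "intervals (l + m) (\<alpha> i) (\<beta> i)" for i
  proof
    show "1 \<le> l + m" using l by simp
    show "\<alpha> i j < \<beta> i j" if "j < l + m" for j
    proof (cases "j < l")
      case True thus ?thesis using E0.less[OF True] by (simp add: \<alpha>_def \<beta>_def)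
    next
      case False thus ?thesis using BC[of "j - l + 1" i] that by (simp add: \<alpha>_def \<beta>_def)
    qed
    show "x \<notin> seg (\<alpha> i j) (\<beta> i j)" if "p < l + m" "j < l + m" "p \<noteq> j" "x \<in> seg (\<alpha> i p) (\<beta> i p)" for p j x
    proof (cases "p < l")
      case p: True
      show ?thesis
      proof (cases "j < l")
        case True
        show ?thesis unfolding seg_low[OF True]
          by (rule E_disj[OF p True that(3)]) (use that(4) seg_low[OF p] in simp)
      next
        case False
        thus ?thesis using EI[of x i] low_E[OF p] high_I[OF False that(2)] that(4) by blast
      qed
    next
      case p: False
      show ?thesis
      proof (cases "j < l")
        case True
        thus ?thesis using EI[of x i] low_E[OF True] high_I[OF p that(1)] that(4) by blast
      next
        case False
        have "J (p - l + 1) (s i) \<inter> J (j - l + 1) (s i) = {}"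
          using disjJ[of i] p False that(1-3) unfolding disjoint_family_on_def by auto
        thus ?thesis using that(4) unfolding seg_high[OF p] seg_high[OF False] by blast
      qed
    qed
  qed
  have iv_E: "intervals.E (l + m) (\<alpha> i) (\<beta> i) = E \<union> I (s i)" for i
  proof -
    have "intervals.E (l + m) (\<alpha> i) (\<beta> i) = (\<Union>j<l + m. seg (\<alpha> i j) (\<beta> i j))"
      by (rule intervals.E_def[OF iv])
    also have "\<dots> = E \<union> I (s i)"
    proof (intro equalityI subsetI)
      fix x assume "x \<in> (\<Union>j<l + m. seg (\<alpha> i j) (\<beta> i j))"
      then obtain j where "j < l + m" "x \<in> seg (\<alpha> i j) (\<beta> i j)" by blast
      thus "x \<in> E \<union> I (s i)" using low_E[of j i] high_I[of j i] by (cases "j < l") auto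
    next
      fix x assume "x \<in> E \<union> I (s i)"
      thus "x \<in> (\<Union>j<l + m. seg (\<alpha> i j) (\<beta> i j))"
      proof
        assume "x \<in> E"
        then obtain j where "j < l" "x \<in> seg (a (2 * j + 1)) (a (2 * j + 2))"
          unfolding E0_E[symmetric] E0.E_def by blast
        thus ?thesis using seg_low[of j i] by (intro UN_I[of j]) auto
      next
        assume "x \<in> I (s i)"
        then obtain k where k: "k \<in> {1..m}" "x \<in> J k (s i)" unfolding I by blast
        thus ?thesis using seg_high[of "l + k - 1" i] by (intro UN_I[of "l + k - 1"]) auto
      qed
    qed
    finally show ?thesis .
  qed
  have K_compact: "compact (E \<union> I (s i))" "E \<union> I (s i) \<noteq> {}" for i
    using intervals.compact_E[OF iv[of i]] intervals.E_nonempty[OF iv[of i]] unfolding iv_E .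
  have "\<exists>u. log_harmonic 0 u (\<omega> k (s i)) (E \<union> I (s i)) \<and>
      (\<forall>x\<in>E \<union> I (s i). (u \<longlongrightarrow> indicator (J k (s i)) x) (at x within - (E \<union> I (s i))))"
    if k: "k \<in> {1..m}" for k i
  proof -
    have "l + k - 1 < l + m" "\<not> l + k - 1 < l" "l + k - 1 - l + 1 = k" using k by auto
    with intervals.harmonic_measure_solution[OF iv[of i], of "l + k - 1"] seg_high[of "l + k - 1" i]
    show ?thesis unfolding iv_E \<omega> by metis
  qed
  then obtain W where W: "\<And>k i. k \<in> {1..m} \<Longrightarrow> log_harmonic 0 (W k i) (\<omega> k (s i)) (E \<union> I (s i))"
    "\<And>k i x. k \<in> {1..m} \<Longrightarrow> x \<in> E \<union> I (s i) \<Longrightarrow> (W k i \<longlongrightarrow> indicator (J k (s i)) x) (at x within - (E \<union> I (s i)))"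
    by metis
  have EI': "E \<inter> I (s i) = {}" for i using EI by blast
  \<comment> \<open>Applied to the Green's functions with \<open>f\<close> zero for (a), and to the
    harmonic measures of \<open>Ej j\<close> with \<open>f\<close> its indicator for (b).\<close>
  have key: "(\<lambda>i. L - M i - (\<Sum>k=1..m. u (of_real (c k)) * \<omega> k (s i))) \<in> O(\<lambda>i. MAX k\<in>{1..m}. (\<omega> k (s i))\<^sup>2)"
    if "log_harmonic \<kappa> u L E" "\<And>x. x \<in> E \<Longrightarrow> (u \<longlongrightarrow> f x) (at x within - E)"
      "\<And>i. log_harmonic \<kappa> (U i) (M i) (E \<union> I (s i))"
      "\<And>i x. x \<in> E \<Longrightarrow> (U i \<longlongrightarrow> f x) (at x within - (E \<union> I (s i)))"
      "\<And>i x. x \<in> I (s i) \<Longrightarrow> (U i \<longlongrightarrow> 0) (at x within - (E \<union> I (s i)))"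
    for \<kappa> u L f U M
    by (rule perturbation_bigo[where J = "\<lambda>k i. J k (s i)" and I = "\<lambda>i. I (s i)" and c = c
      and \<omega> = "\<lambda>k i. \<omega> k (s i)" and B = "\<lambda>k i. B k (s i)" and C = "\<lambda>k i. C k (s i)" and W = W,
      OF m J_seg disjJ I EI' BC c W \<omega>0 that])
  have cE: "complex_of_real (c k) \<notin> E" if "k \<in> {1..m}" for k
  proof
    assume "complex_of_real (c k) \<in> E"
    moreover have "complex_of_real (c k) \<in> I (s 0)" using c[OF that, of 0] I_sub[OF that, of "s 0"] by (auto simp: J_seg)
    ultimately show False using EI by blast
  qed
  define MX where "MX = (\<lambda>i. MAX k\<in>{1..m}. (\<omega> k (s i))\<^sup>2)"
  show ?thesis
  proof (intro conjI ballI)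
    have "\<exists>Gi \<gamma>i. log_harmonic 1 Gi \<gamma>i (E \<union> I (s i)) \<and> (\<forall>x\<in>E \<union> I (s i). (Gi \<longlongrightarrow> 0) (at x within - (E \<union> I (s i))))" for i
      using intervals.green_at_infinity_exists[OF iv[of i]] unfolding iv_E by metis
    then obtain Gi \<gamma>i where Gi: "\<And>i. log_harmonic 1 (Gi i) (\<gamma>i i) (E \<union> I (s i))"
      "\<And>i x. x \<in> E \<union> I (s i) \<Longrightarrow> (Gi i \<longlongrightarrow> 0) (at x within - (E \<union> I (s i)))" by metis
    \<comment> \<open>The logarithm of the factor \<open>1 + R\<close>, since the capacities are
      \<open>exp (- \<gamma>)\<close> and \<open>exp (- \<gamma>i i)\<close>.\<close>
    define y where "y = (\<lambda>i. \<gamma> - \<gamma>i i - (\<Sum>k=1..m. G (of_real (c k)) * \<omega> k (s i)))"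
    have y: "y \<in> O(MX)"
      unfolding y_def MX_def by (rule key[where f = "\<lambda>_. 0", OF G Gi(1)]) (use Gi(2) in auto)
    have MX0: "MX \<longlonglongrightarrow> 0"
    proof (rule tendsto_sandwich[OF _ _ tendsto_const])
      have "(\<lambda>i. \<Sum>k=1..m. (\<omega> k (s i))\<^sup>2) \<longlonglongrightarrow> (\<Sum>k=1..m. 0\<^sup>2)"
        using \<omega>0 by (intro tendsto_sum tendsto_power)
      thus "(\<lambda>i. \<Sum>k=1..m. (\<omega> k (s i))\<^sup>2) \<longlonglongrightarrow> 0" by simp
      have MXle: "MX i \<le> (\<Sum>k=1..m. (\<omega> k (s i))\<^sup>2)" for i
      proof -
        have "MX i \<in> (\<lambda>k. (\<omega> k (s i))\<^sup>2) ` {1..m}" unfolding MX_def using m by (intro Max_in) auto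
        then obtain k where "k \<in> {1..m}" "MX i = (\<omega> k (s i))\<^sup>2" by blast
        thus ?thesis using member_le_sum[of k "{1..m}" "\<lambda>k. (\<omega> k (s i))\<^sup>2"] by simp
      qed
      show "\<forall>\<^sub>F i in sequentially. MX i \<le> (\<Sum>k=1..m. (\<omega> k (s i))\<^sup>2)" using MXle by simp
      have "0 \<le> MX i" for i
      proof -
        have "(\<omega> 1 (s i))\<^sup>2 \<le> MX i" unfolding MX_def using m by (intro Max_ge) auto
        thus ?thesis using order_trans[OF zero_le_power2] by blast
      qed
      thus "\<forall>\<^sub>F i in sequentially. 0 \<le> MX i" by simp
    qed
    have y0: "y \<longlonglongrightarrow> 0"
    proof -
      obtain b where b: "b > 0" "\<forall>\<^sub>F i in sequentially. norm (y i) \<le> b * norm (MX i)"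
        using y by (elim landau_o.bigE)
      have "(\<lambda>i. b * norm (MX i)) \<longlonglongrightarrow> b * norm (0::real)" by (intro tendsto_intros MX0)
      hence "(\<lambda>i. b * norm (MX i)) \<longlonglongrightarrow> 0" by simp
      with b(2) show ?thesis by (rule Lim_null_comparison)
    qed
    \<comment> \<open>As \<open>y\<close> tends to 0, \<open>exp (y i) - 1\<close> inherits the
      bound on \<open>y\<close>.\<close>
    define R where "R = (\<lambda>i. exp (y i) - 1)"
    have "R \<in> O(y)"
    proof (rule bigoI[where c = 2])
      have "\<forall>\<^sub>F i in sequentially. \<bar>y i\<bar> < 1"
        using tendsto_rabs[OF y0] by (rule order_tendstoD) simp
      thus "\<forall>\<^sub>F i in sequentially. norm (R i) \<le> 2 * norm (y i)"
      proof eventually_elim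
        case (elim i)
        thus ?case using abs_exp_minus_one_le[of "y i"] by (simp add: R_def)
      qed
    qed
    hence R: "R \<in> O(MX)" using y by (rule landau_o.big_trans)
    have cap: "capacity (E \<union> I (s i)) = capacity E *
        (\<Prod>k=1..m. abs_complex_green Infty (Fin (complex_of_real (c k))) E powr \<omega> k (s i)) * (1 + R i)" for i
    proof -
      have g: "abs_complex_green Infty (Fin (complex_of_real (c k))) E powr \<omega> k (s i) =
          exp (G (of_real (c k)) * \<omega> k (s i))" if "k \<in> {1..m}" for k
      proof -
        \<comment> \<open>The symmetry enters here: with pole \<open>c k\<close> the value at
          infinity is \<open>T + \<gamma>\<close>, which is \<open>G\<close> at \<open>c k\<close>,
          the coefficient that the perturbation argument yields.\<close>
        have "green E Infty (Fin (of_real (c k))) = G (of_real (c k))"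
          using green_finite_pole_at_infinity[OF K cE[OF that] G Q(1)[OF cE[OF that]] Q(2)[OF cE[OF that]]]
            G_eq[OF cE[OF that]] by simp
        thus ?thesis by (simp add: abs_complex_green_def powr_def mult.commute)
      qed
      have "capacity (E \<union> I (s i)) = exp (- \<gamma>i i)"
        by (rule capacity_eq[OF K_compact Gi])
      also have "\<dots> = exp (- \<gamma> + (\<Sum>k=1..m. G (of_real (c k)) * \<omega> k (s i)) + y i)"
        by (simp add: y_def)
      also have "\<dots> = exp (- \<gamma>) * (\<Prod>k=1..m. exp (G (of_real (c k)) * \<omega> k (s i))) * exp (y i)"
        by (simp only: exp_add exp_sum[OF finite_atLeastAtMost])
      also have "exp (- \<gamma>) = capacity E" by (rule capacity_eq[OF K G, symmetric])
      finally show ?thesis using g by (simp add: R_def)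
    qed
    show "\<exists>R. R \<in> O(\<lambda>i. MAX k\<in>{1..m}. (\<omega> k (s i))\<^sup>2) \<and>
       (\<forall>i. capacity (E \<union> I (s i)) = capacity E *
          (\<Prod>k=1..m. abs_complex_green Infty (Fin (complex_of_real (c k))) E powr \<omega> k (s i)) * (1 + R i))"
      using R cap unfolding MX_def by blast
  next
    fix j assume j: "j \<in> {1..l}"
    have j1: "j - 1 < l" using j by auto
    obtain u where u: "log_harmonic 0 u (harmonic_measure Infty (Ej j) E) E"
      "\<And>x. x \<in> E \<Longrightarrow> (u \<longlongrightarrow> indicator (Ej j) x) (at x within - E)"
      "\<And>z. z \<notin> E \<Longrightarrow> u z = harmonic_measure (Fin z) (Ej j) E"
      using E0.harmonic_measure_solution[OF j1] unfolding E0_E Ej_Suc[OF j, symmetric] by metis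
    have "\<exists>u. log_harmonic 0 u (harmonic_measure Infty (Ej j) (E \<union> I (s i))) (E \<union> I (s i)) \<and>
      (\<forall>x\<in>E \<union> I (s i). (u \<longlongrightarrow> indicator (Ej j) x) (at x within - (E \<union> I (s i))))" for i
    proof -
      have "j - 1 < l + m" "seg (\<alpha> i (j - 1)) (\<beta> i (j - 1)) = Ej j"
        using j1 seg_low[OF j1] Ej_Suc[OF j] by auto
      with intervals.harmonic_measure_solution[OF iv[of i], of "j - 1"]
      show ?thesis unfolding iv_E by metis
    qed
    then obtain U where U: "\<And>i. log_harmonic 0 (U i) (harmonic_measure Infty (Ej j) (E \<union> I (s i))) (E \<union> I (s i))"
      "\<And>i x. x \<in> E \<union> I (s i) \<Longrightarrow> (U i \<longlongrightarrow> indicator (Ej j) x) (at x within - (E \<union> I (s i)))"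
      by metis
    have EjE: "Ej j \<subseteq> E" using j unfolding E by blast
    have U0: "(U i \<longlongrightarrow> 0) (at x within - (E \<union> I (s i)))" if "x \<in> I (s i)" for i x
    proof -
      have "indicator (Ej j) x = (0::real)" using EI[of x i] that EjE by (auto simp: indicator_def)
      thus ?thesis using U(2)[of x i] that by simp
    qed
    have "(\<lambda>i. harmonic_measure Infty (Ej j) E - harmonic_measure Infty (Ej j) (E \<union> I (s i)) -
       (\<Sum>k=1..m. u (of_real (c k)) * \<omega> k (s i))) \<in> O(\<lambda>i. MAX k\<in>{1..m}. (\<omega> k (s i))\<^sup>2)"
      by (rule key[OF u(1,2) U(1) _ U0]) (use U(2) in auto)
    hence "(\<lambda>i. - (harmonic_measure Infty (Ej j) E - harmonic_measure Infty (Ej j) (E \<union> I (s i)) -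
       (\<Sum>k=1..m. u (of_real (c k)) * \<omega> k (s i)))) \<in> O(\<lambda>i. MAX k\<in>{1..m}. (\<omega> k (s i))\<^sup>2)"
      by (simp only: landau_o.big.uminus_in_iff)
    moreover have "(\<Sum>k=1..m. u (of_real (c k)) * \<omega> k (s i)) =
        (\<Sum>k=1..m. \<omega> k (s i) * harmonic_measure (Fin (complex_of_real (c k))) (Ej j) E)" for i
      by (intro sum.cong refl) (use u(3) cE in simp)
    moreover have "- (p - q - r) = q - (p - r)" for p q r :: real by simp
    ultimately show "(\<lambda>i. harmonic_measure Infty (Ej j) (E \<union> I (s i)) -
        (harmonic_measure Infty (Ej j) E -
         (\<Sum>k=1..m. \<omega> k (s i) * harmonic_measure (Fin (complex_of_real (c k))) (Ej j) E)))
        \<in> O(\<lambda>i. MAX k\<in>{1..m}. (\<omega> k (s i))\<^sup>2)"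
      by (simp only:)
  qed
qed

end
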